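(* Let $q$ be a prime power. The quotient $PGL_4(\mathbb{F}_q[t])\backslash \mathcal{B}_4$ of the Bruhat–Tits building $\mathcal{B}_4$ of $PGL(4,\mathbb{F}_q(\!(t^{-1})\!))$ is weakly Ramanujan; that is, every non-trivial discrete simultaneous spectrum $(\lambda_1,\lambda_2,\lambda_3)$ of the weighted colored adjacency operators $A_{w,1},A_{w,2},A_{w,3}$ acting on $L^2_w(PGL_4(\mathbb{F}_q[t])\backslash\mathcal{B}_4)$ is contained in the simultaneous spectrum $\mathcal{S}^4$ of the colored adjacency operators $A_1,A_2,A_3$ acting on $L^2(\mathcal{B}_4)$.
   Context: Notation. $F=\mathbb{F}_q(\!(t^{-1})\!)$, $\mathcal{O}=\mathbb{F}_q[\![t^{-1}]\!]$, $\pi=t^{-1}$, $G=PGL(4,F)$, $W=PGL(4,\mathcal{O})$, $\Gamma=PGL(4,\mathbb{F}_q[t])$. Building. The vertices of $\mathcal{B}_4$ are the homothety classes $[L]$ of $\mathcal{O}$-lattices $L$ of rank 4 in $F^4$, identified with $G/W$ by $gW\mapsto[g\mathcal{O}^4]$. Two distinct vertices are adjacent iff they have representatives with $\pi L\subset L'\subset L$; $k$-simplices are sets of $k+1$ pairwise adjacent vertices. The color is $\tau([g\mathcal{O}^4])=-\mathrm{ord}_\pi(\det g)\in\mathbb{Z}/4\mathbb{Z}$; it is $\Gamma$-invariant, hence defined on vertices of $\Gamma\backslash\mathcal{B}_4$. $G$ acts by left translation. Operators on the building. For $i=1,2,3$, $A_i$ acts on $L^2(\mathcal{B}_4)$ (square-summable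 functions on vertices) by $A_if(x)=\sum_{y\sim x,\ \tau(y)=\tau(x)+i}f(y)$, where $y\sim x$ means adjacent. $\mathcal{S}^4\subset\mathbb{C}^3$ is the set of $(\lambda_1,\lambda_2,\lambda_3)$ for which there are $f_n\in L^2(\mathcal{B}_4)$ with $\|f_n\|_2=1$ and $\lim_n\|A_if_n-\lambda_if_n\|_2=0$ for $i=1,2,3$. It is known that $\mathcal{S}^4=\{(q^{3/2}\sigma_1(\mathbf z),q^2\sigma_2(\mathbf z),q^{3/2}\sigma_3(\mathbf z)):|z_1|=\dots=|z_4|=1,\ z_1z_2z_3z_4=1\}$, where $\sigma_k$ is the $k$-th elementary symmetric polynomial in $\mathbf z=(z_1,z_2,z_3,z_4)$. Operators on the quotient. For a vertex $v$ or edge $e$ of $\Gamma\backslash\mathcal{B}_4$ (vertices and edges being $\Gamma$-orbits of those of $\mathcal{B}_4$) put $w(v)=1/|\Gamma_v|$, $w(e)=1/|\Gamma_e|$ up to one common positive constant, where $\Gamma_v,\Gamma_e$ are the (finite) stabilizers in $\Gamma$ of a lift. $L^2_w(\Gamma\backslash\mathcal{B}_4)$ is the space of functions $f$ on vertices with $\|f\|_{2,w}^2=\sum_v|f(v)|^2w(v)<\infty$. The operator $A_{w,i}$ is $A_{w,i}f(u)=\sum_{(u,v)\text{ edge},\ \tau(v)=\tau(u)+i}\frac{w(u,v)}{w(u)}f(v)$; equivalently it is induced by $A_i$ on $\Gamma$-invariant functions on vertices of $\mathcal{B}_4$. Discrete simultaneous spectrum: the triples $(\lambda_1,\lambda_2,\lambda_3)\in\mathbb{C}^3$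 for which there is a nonzero $f\in L^2_w(\Gamma\backslash\mathcal{B}_4)$ with $A_{w,i}f=\lambda_if$ for $i=1,2,3$. Such a triple is trivial if it equals $(q^{3/2}\sigma_1(\mathbf z),q^2\sigma_2(\mathbf z),q^{3/2}\sigma_3(\mathbf z))$ for $\mathbf z=e^{k\pi i/2}(q^{3/2},q^{1/2},q^{-1/2},q^{-3/2})$ with some $k\in\{0,1,2,3\}$, and non-trivial otherwise. *)

theory Defs
  imports "HOL-Analysis.Analysis" "HOL-Computational_Algebra.Formal_Laurent_Series"
begin

text \<open>
  A finite field \<open>\<F>\<^sub>q\<close> is a type \<open>'a :: {field, finite}\<close>, with \<open>q = CARD('a)\<close>. The field
  \<open>F = \<F>\<^sub>q((t\<^sup>-\<^sup>1))\<close> is \<open>'a fls\<close>, where \<open>fls_X\<close> plays the role of the uniformizer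
  \<open>\<pi> = t\<^sup>-\<^sup>1\<close>. Thus \<open>t\<close> is \<open>fls_X_inv\<close>, and \<open>ord\<^sub>\<pi>\<close> is \<open>fls_subdegree\<close>.
\<close>

type_synonym 'a matrix4 = "'a fls ^ 4 ^ 4"
type_synonym 'a lattice = "('a fls ^ 4) set"
type_synonym 'a vertex = "'a lattice set"
type_synonym 'a edge = "'a vertex set"
type_synonym 'a pgl = "'a matrix4 set"

definition power_series_ring :: "'a::field fls set" where
  "power_series_ring = range fps_to_fls"

definition polynomial_ring :: "'a::field fls set" where
  "polynomial_ring = range (\<lambda>p. poly (map_poly fls_const p) fls_X_inv)"


subsection \<open>Projective linear groups\<close>

definition GL4 :: "'a::field fls set \<Rightarrow> 'a matrix4 set" where
  "GL4 R = {g. (\<forall>i j. g $ i $ j \<in> R) \<and>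
     (\<exists>h. (\<forall>i j. h $ i $ j \<in> R) \<and> g ** h = mat 1 \<and> h ** g = mat 1)}"

definition units_in :: "'a::field fls set \<Rightarrow> 'a fls set" where
  "units_in R = {c \<in> R. \<exists>d\<in>R. c * d = 1}"

definition PGL4 :: "'a::field fls set \<Rightarrow> 'a pgl set" where
  "PGL4 R = (\<lambda>g. {mat c ** g | c. c \<in> units_in R}) ` GL4 R"

definition Gamma :: "'a::field pgl set" where
  "Gamma = PGL4 polynomial_ring"


subsection \<open>The building\<close>

definition lattice_of :: "'a::field matrix4 \<Rightarrow> 'a lattice" where
  "lattice_of g = (*v) g ` {x. \<forall>i. x $ i \<in> power_series_ring}"

definition vertex_of :: "'a::field matrix4 \<Rightarrow> 'a vertex" where
  "vertex_of g = {(*s) c ` lattice_of g | c. c \<noteq> 0}"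

definition vertices :: "'a::field vertex set" where
  "vertices = vertex_of ` GL4 UNIV"

definition adjacent :: "'a::field vertex \<Rightarrow> 'a vertex \<Rightarrow> bool" where
  "adjacent x y \<longleftrightarrow> x \<in> vertices \<and> y \<in> vertices \<and> x \<noteq> y \<and>
     (\<exists>L\<in>x. \<exists>L'\<in>y. (*s) fls_X ` L \<subseteq> L' \<and> L' \<subseteq> L)"

definition edges :: "'a::field edge set" where
  "edges = {{x, y} | x y. adjacent x y}"

text \<open>
  The type \<open>4\<close> with its ring structure is \<open>\<int>/4\<int>\<close>. The color does not depend on the chosen
  matrix: if \<open>vertex_of g = vertex_of h\<close> then \<open>h\<close> is \<open>g\<close> times an element of \<open>GL(4,\<O>)\<close>,
  up to a scalar \<open>c\<close>, and \<open>det (mat c) = c ^ 4\<close>.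
\<close>

definition color :: "'a::field vertex \<Rightarrow> 4" where
  "color x = of_int (- fls_subdegree (det (SOME g. g \<in> GL4 UNIV \<and> vertex_of g = x)))"

text \<open>
  A vertex contains all homothetic lattices, so the following is the action of the class of \<open>g\<close>
  on \<open>[L]\<close>, namely \<open>[g L]\<close>, whatever ring the entries of \<open>g\<close> and the scalars are taken from.
\<close>

definition act :: "'a::field pgl \<Rightarrow> 'a vertex \<Rightarrow> 'a vertex" where
  "act \<gamma> x = {(*v) g ` L | g L. g \<in> \<gamma> \<and> L \<in> x}"


subsection \<open>Colored adjacency operators on the building\<close>

text \<open>
  Functions on vertices are total functions of which only the values on the given vertex set
  matter.
\<close>

definition weighted_L2 :: "'v set \<Rightarrow> ('v \<Rightarrow> real) \<Rightarrow> ('v \<Rightarrow> complex) set" where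
  "weighted_L2 V w = {f. (\<lambda>v. (cmod (f v))\<^sup>2 * w v) summable_on V}"

definition L2_norm_on :: "'v set \<Rightarrow> ('v \<Rightarrow> complex) \<Rightarrow> real" where
  "L2_norm_on V f = sqrt (\<Sum>\<^sub>\<infinity>v\<in>V. (cmod (f v))\<^sup>2)"

text \<open>The sum below is finite because the building is locally finite.\<close>

definition adj_op :: "nat \<Rightarrow> ('a::{field,finite} vertex \<Rightarrow> complex) \<Rightarrow> 'a vertex \<Rightarrow> complex" where
  "adj_op i f x = (\<Sum>y | adjacent x y \<and> color y = color x + of_nat i. f y)"

text \<open>
  The operators \<open>adj_op i\<close> are bounded on \<open>L\<^sup>2\<close> of the building, so the norm in the limit is
  that of an \<open>L\<^sup>2\<close> function.
\<close>

definition building_spectrum :: "'a::{field,finite} itself \<Rightarrow> (complex \<times> complex \<times> complex) set" where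
  "building_spectrum _ = {(l 1, l 2, l 3) | l :: nat \<Rightarrow> complex.
     \<exists>f :: nat \<Rightarrow> 'a vertex \<Rightarrow> complex.
       (\<forall>n. f n \<in> weighted_L2 vertices (\<lambda>_. 1) \<and> L2_norm_on vertices (f n) = 1) \<and>
       (\<forall>i\<in>{1,2,3}. (\<lambda>n. L2_norm_on vertices (\<lambda>x. adj_op i (f n) x - l i * f n x)) \<longlonglongrightarrow> 0)}"


subsection \<open>Weighted adjacency operators on the quotient\<close>

definition quotient_vertices :: "'a::field vertex set set" where
  "quotient_vertices = (\<lambda>x. {act \<gamma> x | \<gamma>. \<gamma> \<in> Gamma}) ` vertices"

definition quotient_edges :: "'a::field edge set set" where
  "quotient_edges = (\<lambda>e. {act \<gamma> ` e | \<gamma>. \<gamma> \<in> Gamma}) ` edges"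

definition quotient_color :: "'a::field vertex set \<Rightarrow> 4" where
  "quotient_color u = color (SOME x. x \<in> u)"

definition vertex_weight :: "'a::{field,finite} vertex set \<Rightarrow> real" where
  "vertex_weight u = 1 / real (card {\<gamma> \<in> Gamma. act \<gamma> (SOME x. x \<in> u) = (SOME x. x \<in> u)})"

text \<open>
  Adjacent vertices have different colors and \<open>Gamma\<close> preserves colors, so the setwise
  stabilizer of an edge fixes both ends.
\<close>

definition edge_weight :: "'a::{field,finite} edge set \<Rightarrow> real" where
  "edge_weight e = 1 / real (card {\<gamma> \<in> Gamma. act \<gamma> ` (SOME s. s \<in> e) = (SOME s. s \<in> e)})"

definition joins :: "'a::field edge set \<Rightarrow> 'a vertex set \<Rightarrow> 'a vertex set \<Rightarrow> bool" where
  "joins e u v \<longleftrightarrow> (\<exists>x\<in>u. \<exists>y\<in>v. {x, y} \<in> e)"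

text \<open>
  The sum ranges over the edges of the quotient at \<open>u\<close>, each together with its other end \<open>v\<close>.
\<close>

definition weighted_adj_op ::
    "nat \<Rightarrow> ('a::{field,finite} vertex set \<Rightarrow> complex) \<Rightarrow> 'a vertex set \<Rightarrow> complex" where
  "weighted_adj_op i f u =
     (\<Sum>(e, v) | e \<in> quotient_edges \<and> v \<in> quotient_vertices \<and> joins e u v \<and>
                 quotient_color v = quotient_color u + of_nat i.
        of_real (edge_weight e / vertex_weight u) * f v)"

definition discrete_spectrum :: "'a::{field,finite} itself \<Rightarrow> (complex \<times> complex \<times> complex) set" where
  "discrete_spectrum _ = {(l 1, l 2, l 3) | l :: nat \<Rightarrow> complex.
     \<exists>f :: 'a vertex set \<Rightarrow> complex.
       f \<in> weighted_L2 quotient_vertices vertex_weight \<and>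
       (\<exists>v\<in>quotient_vertices. f v \<noteq> 0) \<and>
       (\<forall>i\<in>{1,2,3}. \<forall>u\<in>quotient_vertices. weighted_adj_op i f u = l i * f u)}"


subsection \<open>Trivial triples\<close>

definition elem_sym :: "nat \<Rightarrow> (nat \<Rightarrow> complex) \<Rightarrow> complex" where
  "elem_sym k z = (\<Sum>S | S \<subseteq> {1..4} \<and> card S = k. \<Prod>j\<in>S. z j)"

definition spectral_triple :: "nat \<Rightarrow> (nat \<Rightarrow> complex) \<Rightarrow> complex \<times> complex \<times> complex" where
  "spectral_triple q z =
     (of_real (real q powr (3/2)) * elem_sym 1 z,
      of_real (real q ^ 2) * elem_sym 2 z,
      of_real (real q powr (3/2)) * elem_sym 3 z)"

text \<open>
  For \<open>j = 1, 2, 3, 4\<close> the exponents \<open>(5 - 2 j) / 2\<close> are \<open>3/2, 1/2, -1/2, -3/2\<close>.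
\<close>

definition trivial_parameter :: "nat \<Rightarrow> nat \<Rightarrow> nat \<Rightarrow> complex" where
  "trivial_parameter q k j =
     exp (of_nat k * of_real pi * \<i> / 2) * of_real (real q powr ((5 - 2 * real j) / 2))"

definition trivial_triples :: "nat \<Rightarrow> (complex \<times> complex \<times> complex) set" where
  "trivial_triples q = {spectral_triple q (trivial_parameter q k) | k. k \<in> {0,1,2,3}}"

end

theory Submission
  imports Defs "HOL-Computational_Algebra.Fundamental_Theorem_Algebra"
    "HOL-Computational_Algebra.Polynomial_FPS"
begin

text \<open>
  The trivial triples turn out to be the whole discrete spectrum. By reduction theory every vertex
  of the quotient is the class of a diagonal matrix \<open>t\<^sup>a\<close> with \<open>a\<close> dominant, and the neighbours of
  such a vertex, sorted by Schubert cells, turn the eigenvalue equations into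
  \<open>\<Sum>\<^sub>S q\<^bsup>inv S\<^esup> f(a + e\<^sub>S) = \<lambda>\<^sub>i f(a)\<close>, the sum being over \<open>i\<close>-subsets \<open>S\<close>. Hence an eigenfunction is
  determined by \<open>f(0)\<close>, and along the ray of a fundamental coweight it satisfies a linear
  recurrence. Write the eigenvalues in terms of the roots \<open>y\<^sub>1, \<dots>, y\<^sub>4\<close> of
  \<open>X\<^sup>4 - \<lambda>\<^sub>1 X\<^sup>3 + q \<lambda>\<^sub>2 X\<^sup>2 - q\<^sup>3 \<lambda>\<^sub>3 X + q\<^sup>6\<close>. Along the first ray the generating function is a combination
  of a constant and \<open>\<Prod>\<^sub>i (1 - q y\<^sub>i x) / (1 - y\<^sub>i x)\<close>, whose poles with \<open>|y\<^sub>i| \<ge> q\<^bsup>3/2\<^esup>\<close> have to cancel when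
  \<open>f\<close> is square summable. Together with the dual statement along the third ray this leaves only
  \<open>c, qc, q\<^sup>2c, q\<^sup>3c\<close>, which is trivial, and \<open>a, qa, b, qb\<close>, which the second ray excludes.
\<close>

text \<open>The thresholds come from the weights. At the n-th vertex of the first or third ray the
  stabilizer has order at most a constant times q^(3n), on the second ray at most a constant times
  q^(4n), so square summability makes f(n) q^(-3n/2), respectively f(n) q^(-2n), tend to 0. The
  obstacle is that the first and third rays only test whether every large root is q times some root
  and every small root is 1/q times some root. Two strings a, qa and b, qb around the circle of
  radius q^(3/2) pass this test without being trivial. On the second ray such parameters produce the
  rates a^2, b^2, q a b and a b / q. Since |a b| = q^2, one of a^2, b^2 reaches the critical size
  q^2. Its coefficient, up to non-zero factors an explicit polynomial in a / b, must therefore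
  vanish, and the sizes of a and b leave only a = -b, where the two rates coincide and a separate
  argument is required.\<close>

no_notation fps_nth (infixl "$" 75)
notation fls_nth (infixl "$$" 75)

subsection \<open>Poles of generating functions of decaying sequences\<close>

definition lin_factor :: "complex \<Rightarrow> complex poly" where
  "lin_factor y = [:1, - y:]"

lemma poly_lin_factor [simp]: "poly (lin_factor y) x = 1 - y * x"
  by (simp add: lin_factor_def mult.commute)

lemma lin_factor_neq_0 [simp]: "lin_factor y \<noteq> 0"
  by (simp add: lin_factor_def)

lemma fps_mult_lin_factor_nth_Suc: "fps_nth (F * fps_of_poly (lin_factor y)) (Suc n) = fps_nth F (Suc n) - y * fps_nth F n"
  by (simp add: lin_factor_def fps_of_poly_pCons distrib_left flip: mult.assoc)

definition decays :: "real \<Rightarrow> complex fps \<Rightarrow> bool" where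
  "decays r F \<longleftrightarrow> (\<lambda>n. fps_nth F n * of_real r ^ n) \<longlonglongrightarrow> 0"

lemma decays_mult_linear:
  assumes "decays r F"
  shows "decays r (F * fps_of_poly (lin_factor y))"
proof -
  have "(\<lambda>n. fps_nth F (Suc n) * of_real r ^ Suc n - (y * of_real r) * (fps_nth F n * of_real r ^ n)) \<longlonglongrightarrow>
      0 - (y * of_real r) * 0"
    using assms unfolding decays_def by (intro tendsto_intros LIMSEQ_Suc)
  then have "(\<lambda>n. fps_nth (F * fps_of_poly (lin_factor y)) (Suc n) * of_real r ^ Suc n) \<longlonglongrightarrow> 0"
    unfolding fps_mult_lin_factor_nth_Suc by (simp add: algebra_simps)
  then show ?thesis
    unfolding decays_def by (rule LIMSEQ_imp_Suc)
qed

lemma decays_mult_prod_linear: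
  assumes "decays r F"
  shows "decays r (F * fps_of_poly (\<Prod>y\<in>#Y. lin_factor y))"
  using assms
proof (induction Y)
  case (add y Y)
  from decays_mult_linear[OF add.IH[OF add.prems]] show ?case
    by (simp add: fps_of_poly_mult mult_ac)
qed simp

text \<open>Equality in \<open>1 \<le> cmod c * r\<close> is allowed: on the critical circle the
  terms keep constant modulus, which already contradicts decay unless they vanish. This is why roots
  of modulus exactly q^(3/2) count among those whose poles must cancel.\<close>

lemma geometric_decay_imp_0:
  fixes u :: "nat \<Rightarrow> complex"
  assumes rec: "\<And>n. u (Suc n) = c * u n" and lim: "(\<lambda>n. u n * of_real r ^ n) \<longlonglongrightarrow> 0"
    and r: "0 < r" "1 \<le> cmod c * r"
  shows "u 0 = 0"
proof -
  have u: "u n = c ^ n * u 0" for n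
    by (induction n) (simp_all add: rec)
  have "cmod (u 0) \<le> norm (u n * of_real r ^ n)" for n
  proof -
    have "norm (u n * of_real r ^ n) = (cmod c * r) ^ n * cmod (u 0)"
      using r(1) by (simp add: u[of n] norm_mult norm_power power_mult_distrib)
    moreover have "1 \<le> (cmod c * r) ^ n"
      using r(2) by (rule one_le_power)
    ultimately show ?thesis
      using mult_right_mono[of 1 "(cmod c * r) ^ n" "cmod (u 0)"] by simp
  qed
  then have "cmod (u 0) \<le> 0"
    using tendsto_norm[OF lim] by (intro LIMSEQ_le_const[where X = "\<lambda>n. norm (u n * of_real r ^ n)"]) auto
  then show ?thesis
    by simp
qed

text \<open>Beyond the degree of \<open>N\<close> the coefficients of \<open>F\<close> form a
  geometric progression of ratio \<open>y\<close>, which cannot decay at this rate unless it is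
  zero. So \<open>F\<close> is a polynomial and the pole at 1 / y has cancelled.\<close>

lemma linear_dvd_of_decays:
  assumes "decays r F" and "F * fps_of_poly (lin_factor y) = fps_of_poly N" and "1 \<le> cmod y * r" and "0 < r"
  obtains M where "F = fps_of_poly M" "N = lin_factor y * M"
proof -
  define m where "m = degree N"
  have rec: "fps_nth F (Suc n) = y * fps_nth F n" if "m \<le> n" for n
  proof -
    have "fps_nth (F * fps_of_poly (lin_factor y)) (Suc n) = 0"
      using that by (simp add: assms(2) m_def coeff_eq_0)
    then show ?thesis
      by (simp add: fps_mult_lin_factor_nth_Suc)
  qed
  have "fps_nth F n = 0" if "m \<le> n" for n
  proof -
    have "(\<lambda>k. fps_nth F (n + k) * of_real r ^ (n + k)) \<longlonglongrightarrow> 0"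
      using LIMSEQ_ignore_initial_segment[OF assms(1)[unfolded decays_def], of n] by (simp add: add.commute)
    then have "(\<lambda>k. fps_nth F (n + k) * of_real r ^ (n + k) / of_real r ^ n) \<longlonglongrightarrow> 0"
      by (rule tendsto_divide_zero)
    then have "(\<lambda>k. fps_nth F (n + k) * of_real r ^ k) \<longlonglongrightarrow> 0"
      using assms(4) by (simp add: power_add)
    then show ?thesis
      using geometric_decay_imp_0[of "\<lambda>k. fps_nth F (n + k)" y r] rec that assms(3,4) by simp
  qed
  then have zero: "fps_nth F n = 0" if "m \<le> n" for n
    using that by blast
  define M where "M = Poly (map (\<lambda>n. fps_nth F n) [0..<m])"
  have F: "F = fps_of_poly M"
    by (rule fps_ext) (auto simp: M_def nth_default_def zero)
  have "fps_of_poly N = fps_of_poly (lin_factor y * M)"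
    using assms(2) by (simp add: F fps_of_poly_mult mult.commute)
  then have "N = lin_factor y * M"
    by (simp add: fps_of_poly_eq_iff)
  with F show thesis
    by (rule that)
qed

text \<open>The factors of small roots are absorbed into \<open>F\<close>, which preserves decay.
  The large ones are then peeled off one at a time, the quotient being a polynomial again after each
  step, so that multiplicities are counted.\<close>

lemma prod_linear_dvd_of_decays:
  assumes "decays r F" and "F * fps_of_poly (\<Prod>y\<in>#Y. lin_factor y) = fps_of_poly N" and "0 < r"
  shows "(\<Prod>y\<in>#{#y \<in># Y. 1 \<le> cmod y * r#}. lin_factor y) dvd N"
proof -
  have "(\<Prod>y\<in>#A. lin_factor y) dvd N"
    if "\<forall>y\<in>#A. 1 \<le> cmod y * r" "decays r G" "G * fps_of_poly (\<Prod>y\<in>#A. lin_factor y) = fps_of_poly N"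
    for A G N
    using that
  proof (induction A arbitrary: N)
    case (add y A)
    have "decays r (G * fps_of_poly (\<Prod>y\<in>#A. lin_factor y))"
      by (rule decays_mult_prod_linear) fact
    moreover have "G * fps_of_poly (\<Prod>y\<in>#A. lin_factor y) * fps_of_poly (lin_factor y) = fps_of_poly N"
      using add.prems(3) by (simp add: fps_of_poly_mult mult_ac)
    ultimately obtain M where M: "G * fps_of_poly (\<Prod>y\<in>#A. lin_factor y) = fps_of_poly M" "N = lin_factor y * M"
      using add.prems(1) assms(3) by (elim linear_dvd_of_decays) auto
    from add.IH[OF _ add.prems(2) M(1)] add.prems(1) show ?case
      unfolding M(2) by (simp add: mult_dvd_mono)
  qed simp
  note * = this
  have "image_mset lin_factor Y = image_mset lin_factor {#y \<in># Y. 1 \<le> cmod y * r#} +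
      image_mset lin_factor {#y \<in># Y. \<not> 1 \<le> cmod y * r#}"
    by (metis image_mset_union multiset_partition)
  then have "F * fps_of_poly (\<Prod>y\<in>#{#y \<in># Y. \<not> 1 \<le> cmod y * r#}. lin_factor y) *
      fps_of_poly (\<Prod>y\<in>#{#y \<in># Y. 1 \<le> cmod y * r#}. lin_factor y) = fps_of_poly N"
    using assms(2) by (simp add: fps_of_poly_mult mult_ac)
  then show ?thesis
    by (intro *[OF _ decays_mult_prod_linear[OF assms(1)]]) auto
qed

text \<open>Each \<open>y\<close> in \<open>A\<close> makes the right-hand product vanish at 1 / y,
  so it occurs in \<open>B\<close> and can be cancelled on both sides. The value 0 is excluded
  because \<open>lin_factor 0 = 1\<close> leaves no trace in a product.\<close>

lemma prod_linear_dvd_imp_subset: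
  fixes A B :: "complex multiset"
  assumes "0 \<notin># A" and "(\<Prod>y\<in>#A. lin_factor y) dvd (\<Prod>y\<in>#B. lin_factor y)"
  shows "A \<subseteq># B"
  using assms
proof (induction A arbitrary: B)
  case (add y A)
  have "poly (\<Prod>y\<in>#B. lin_factor y) (inverse y) = 0"
    using add.prems by (auto elim!: dvdE)
  then obtain b where "b \<in># B" "b = y"
    using add.prems(1) by (auto simp: poly_prod_mset field_simps)
  then obtain C where B: "B = add_mset y C"
    by (metis multi_member_split)
  have "lin_factor y * (\<Prod>y\<in>#A. lin_factor y) dvd lin_factor y * (\<Prod>y\<in>#C. lin_factor y)"
    using add.prems(2) by (simp add: B)
  then have "(\<Prod>y\<in>#A. lin_factor y) dvd (\<Prod>y\<in>#C. lin_factor y)"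
    by (subst (asm) dvd_mult_cancel_left) auto
  with add show ?case
    by (simp add: B)
qed simp

lemma quartic_roots:
  fixes c0 c1 c2 c3 :: complex
  obtains y1 y2 y3 y4 where "c3 = - (y1 + y2 + y3 + y4)"
    "c2 = y1*y2 + y1*y3 + y1*y4 + y2*y3 + y2*y4 + y3*y4"
    "c1 = - (y1*y2*y3 + y1*y2*y4 + y1*y3*y4 + y2*y3*y4)"
    "c0 = y1*y2*y3*y4"
proof -
  define p where "p = [:c0, c1, c2, c3, 1:]"
  obtain y where "smult (lead_coeff p) (\<Prod>i<degree p. [:- y i, 1:]) = p"
    using complex_poly_decompose' by blast
  then have "p = (\<Prod>i<4. [:- y i, 1:])"
    by (simp add: p_def numeral_eq_Suc)
  then have "p = [:- y 0, 1:] * [:- y 1, 1:] * [:- y 2, 1:] * [:- y 3, 1:]"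
    by (simp add: eval_nat_numeral mult_ac)
  then show thesis
    by (intro that[of "y 0" "y 1" "y 2" "y 3"]) (auto simp: p_def algebra_simps)
qed

subsection \<open>Hecke recurrences on the dominant chamber\<close>

text \<open>The computation behind \<open>no_double_segment\<close>: \<open>\<tau>\<close> is the
  quotient a / b, and \<open>D0\<close>, \<open>D1\<close> are the first two values of the sequence
  \<open>D\<close> there, up to normalization. The left-hand side is then the initial value of
  \<open>E\<close>, and the factorization shows for which \<open>\<tau>\<close> it can
  vanish.\<close>

lemma segment_identity:
  fixes q \<tau> \<sigma> :: complex
  assumes "\<tau> \<noteq> 0" "\<tau> * \<sigma> = (1 + \<tau>)^2" "\<kappa> = 1 + q^2" "p = 1 + q + q^2"
    and D0: "D0 = q^3 * (\<sigma> * (q * \<sigma> + \<kappa>) - (1 + q)^2 * ((1 + q) * \<sigma> - q * \<kappa>))"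
    and D1: "D1 = q^2 * \<sigma> * (D0 + q * \<kappa> * (q^2 * \<sigma> + q * \<kappa>) - q^4 * \<kappa> * p) -
       q * (1 + q)^2 * (q^2 * \<sigma> * (q^2 * \<sigma> + q * \<kappa> - q^2 * p) - q^4 * ((1 + q) * \<sigma> - q * \<kappa>))"
  shows "\<tau> * D1 - q^2 * D0 = q^6 * (\<tau> + 1) * (\<tau> - q)^2 * (\<tau> - q^2)"
proof -
  have \<sigma>: "\<sigma> = (1 + \<tau>)^2 / \<tau>"
    using assms(1,2) by (simp add: field_simps)
  show ?thesis
    unfolding D1 D0 assms(3,4) \<sigma> using assms(1)
    by (simp add: divide_simps) (simp add: algebra_simps eval_nat_numeral)
qed

lemma fps_mult_of_poly_pCons_nth_Suc:
  "fps_nth ((F :: complex fps) * fps_of_poly (pCons a p)) (Suc n) = fps_nth F (Suc n) * a + fps_nth (F * fps_of_poly p) n"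
  by (simp add: fps_of_poly_pCons distrib_left flip: mult.assoc)

text \<open>The sum of the squares of the six pairwise differences. Unlike the sum of squares it is
  unchanged when one integer is added to all coordinates, so it compares tuples of different total,
  such as the centre and the terms of a Hecke relation.\<close>

definition sq_dev :: "int \<Rightarrow> int \<Rightarrow> int \<Rightarrow> int \<Rightarrow> int" where
  "sq_dev a b c d = 4 * (a^2 + b^2 + c^2 + d^2) - (a + b + c + d)^2"

lemma sq_dev_nonneg: "0 \<le> sq_dev a b c d"
proof -
  have "sq_dev a b c d = (a-b)^2 + (a-c)^2 + (a-d)^2 + (b-c)^2 + (b-d)^2 + (c-d)^2"
    by (simp add: sq_dev_def power2_eq_square algebra_simps)
  then show ?thesis
    by simp
qed

lemma sq_dev_less:
  assumes "w + x + y + z = a + b + c + d" "w^2 + x^2 + y^2 + z^2 < a^2 + b^2 + c^2 + d^2"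
  shows "sq_dev w x y z < sq_dev a b c d"
  using assms by (simp add: sq_dev_def)

text \<open>Insertion sort by adjacent transpositions: \<open>third\<close> inserts the last entry
  into a sorted triple, \<open>2\<close> inserts the third entry into a sorted pair, and the end of
  the proof sorts the first two.\<close>

lemma sorted4_wlog:
  fixes P :: "int \<Rightarrow> int \<Rightarrow> int \<Rightarrow> int \<Rightarrow> bool"
  assumes s12: "\<And>a b c d. P b a c d = P a b c d" and s23: "\<And>a b c d. P a c b d = P a b c d"
    and s34: "\<And>a b c d. P a b d c = P a b c d"
    and sorted: "\<And>a b c d. b \<le> a \<Longrightarrow> c \<le> b \<Longrightarrow> d \<le> c \<Longrightarrow> P a b c d"
  shows "P a b c d"
proof -
  have third: "P a b c d" if "b \<le> a" "c \<le> b" for a b c d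
  proof -
    consider "d \<le> c" | "c \<le> d" "d \<le> b" | "b \<le> d" "d \<le> a" | "a \<le> d"
      by linarith
    then show ?thesis
    proof cases
      case 1
      with that show ?thesis by (intro sorted)
    next
      case 2
      with that have "P a b d c" by (intro sorted)
      then show ?thesis by (rule iffD1[OF s34])
    next
      case 3
      with that have "P a d b c" by (intro sorted)
      then have "P a b d c" by (rule iffD1[OF s23])
      then show ?thesis by (rule iffD1[OF s34])
    next
      case 4
      with that have "P d a b c" by (intro sorted)
      then have "P a d b c" by (rule iffD1[OF s12])
      then have "P a b d c" by (rule iffD1[OF s23])
      then show ?thesis by (rule iffD1[OF s34])
    qed
  qed
  have 2: "P a b c d" if "b \<le> a" for a b c d
  proof -
    consider "c \<le> b" | "b \<le> c" "c \<le> a" | "a \<le> c"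
      by linarith
    then show ?thesis
    proof cases
      case 1
      with that show ?thesis by (intro third)
    next
      case 2
      with that have "P a c b d" by (intro third)
      then show ?thesis by (rule iffD1[OF s23])
    next
      case 3
      with that have "P c a b d" by (intro third)
      then have "P a c b d" by (rule iffD1[OF s12])
      then show ?thesis by (rule iffD1[OF s23])
    qed
  qed
  show ?thesis
  proof (cases "b \<le> a")
    case False
    then have "P b a c d" by (intro 2) simp
    then show ?thesis by (rule iffD1[OF s12])
  qed (rule 2)
qed

text \<open>
  The joint eigenfunctions restricted to the vertices of diagonal matrices with entries
  \<open>t\<^sup>a, t\<^sup>b, t\<^sup>c, t\<^sup>d\<close>. The eigenvalue equations have the stated form on the dominant
  chamber only; the values outside are given by the symmetry.
\<close>

locale sector_eigenfunction =
  fixes N :: nat and q :: complex and \<Phi> :: "int \<Rightarrow> int \<Rightarrow> int \<Rightarrow> int \<Rightarrow> complex" and l1 l2 l3 :: complex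
  assumes N_ge_2: "2 \<le> N" and q_def: "q = of_nat N"
    and swap12: "\<Phi> b a c d = \<Phi> a b c d"
    and swap23: "\<Phi> a c b d = \<Phi> a b c d"
    and swap34: "\<Phi> a b d c = \<Phi> a b c d"
    and shift: "\<Phi> (a + k) (b + k) (c + k) (d + k) = \<Phi> a b c d"
    and hecke1: "b \<le> a \<Longrightarrow> c \<le> b \<Longrightarrow> d \<le> c \<Longrightarrow>
      \<Phi> (a + 1) b c d + q * \<Phi> a (b + 1) c d + q^2 * \<Phi> a b (c + 1) d + q^3 * \<Phi> a b c (d + 1) =
      l1 * \<Phi> a b c d"
    and hecke2: "b \<le> a \<Longrightarrow> c \<le> b \<Longrightarrow> d \<le> c \<Longrightarrow>
      \<Phi> (a + 1) (b + 1) c d + q * \<Phi> (a + 1) b (c + 1) d + q^2 * \<Phi> (a + 1) b c (d + 1) +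
      q^2 * \<Phi> a (b + 1) (c + 1) d + q^3 * \<Phi> a (b + 1) c (d + 1) + q^4 * \<Phi> a b (c + 1) (d + 1) =
      l2 * \<Phi> a b c d"
    and hecke3: "b \<le> a \<Longrightarrow> c \<le> b \<Longrightarrow> d \<le> c \<Longrightarrow>
      \<Phi> (a + 1) (b + 1) (c + 1) d + q * \<Phi> (a + 1) (b + 1) c (d + 1) +
      q^2 * \<Phi> (a + 1) b (c + 1) (d + 1) + q^3 * \<Phi> a (b + 1) (c + 1) (d + 1) =
      l3 * \<Phi> a b c d"
begin

lemmas swaps = swap12 swap23 swap34

text \<open>Reversing and negating coordinates preserves the dominant chamber. After a shift by
  (1,1,1,1) it replaces the subset raised in a Hecke relation by the reversed complement, which has
  equally many inversions. So the first and third relations change places, and the second is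
  preserved with its two q^2 terms exchanged.\<close>

lemma dual: "sector_eigenfunction N q (\<lambda>a b c d. \<Phi> (- d) (- c) (- b) (- a)) l3 l2 l1"
proof
  fix a b c d k :: int
  show "\<Phi> (- (d + k)) (- (c + k)) (- (b + k)) (- (a + k)) = \<Phi> (- d) (- c) (- b) (- a)"
    using shift[of "- d" "- k" "- c" "- b" "- a"] by simp
  assume le: "b \<le> a" "c \<le> b" "d \<le> c"
  have sh: "\<Phi> (w + 1) (x + 1) (y + 1) (z + 1) = \<Phi> w x y z" for w x y z
    by (rule shift)
  show "\<Phi> (- d) (- c) (- b) (- (a + 1)) + q * \<Phi> (- d) (- c) (- (b + 1)) (- a) +
      q^2 * \<Phi> (- d) (- (c + 1)) (- b) (- a) + q^3 * \<Phi> (- (d + 1)) (- c) (- b) (- a) =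
      l3 * \<Phi> (- d) (- c) (- b) (- a)"
    using hecke3[of "- c" "- d" "- b" "- a"] le
      sh[of "- d" "- c" "- b" "- a - 1"] sh[of "- d" "- c" "- b - 1" "- a"]
      sh[of "- d" "- c - 1" "- b" "- a"] sh[of "- d - 1" "- c" "- b" "- a"] by simp
  have "\<Phi> (- d) (- c) (- (b + 1)) (- (a + 1)) + q * \<Phi> (- d) (- (c + 1)) (- b) (- (a + 1)) +
      q^2 * \<Phi> (- d) (- (c + 1)) (- (b + 1)) (- a) + q^2 * \<Phi> (- (d + 1)) (- c) (- b) (- (a + 1)) +
      q^3 * \<Phi> (- (d + 1)) (- c) (- (b + 1)) (- a) + q^4 * \<Phi> (- (d + 1)) (- (c + 1)) (- b) (- a) =
      l2 * \<Phi> (- d) (- c) (- b) (- a)"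
    using hecke2[of "- c" "- d" "- b" "- a"] le
      sh[of "- d" "- c" "- b - 1" "- a - 1"] sh[of "- d" "- c - 1" "- b" "- a - 1"]
      sh[of "- d - 1" "- c" "- b" "- a - 1"] sh[of "- d" "- c - 1" "- b - 1" "- a"]
      sh[of "- d - 1" "- c" "- b - 1" "- a"] sh[of "- d - 1" "- c - 1" "- b" "- a"]
    by simp
  then show "\<Phi> (- d) (- c) (- (b + 1)) (- (a + 1)) + q * \<Phi> (- d) (- (c + 1)) (- b) (- (a + 1)) +
      q^2 * \<Phi> (- (d + 1)) (- c) (- b) (- (a + 1)) + q^2 * \<Phi> (- d) (- (c + 1)) (- (b + 1)) (- a) +
      q^3 * \<Phi> (- (d + 1)) (- c) (- (b + 1)) (- a) + q^4 * \<Phi> (- (d + 1)) (- (c + 1)) (- b) (- a) =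
      l2 * \<Phi> (- d) (- c) (- b) (- a)"
    by (simp only: add_ac)
  show "\<Phi> (- d) (- (c + 1)) (- (b + 1)) (- (a + 1)) + q * \<Phi> (- (d + 1)) (- c) (- (b + 1)) (- (a + 1)) +
      q^2 * \<Phi> (- (d + 1)) (- (c + 1)) (- b) (- (a + 1)) + q^3 * \<Phi> (- (d + 1)) (- (c + 1)) (- (b + 1)) (- a) =
      l1 * \<Phi> (- d) (- c) (- b) (- a)"
    using hecke1[of "- c" "- d" "- b" "- a"] le
      sh[of "- d" "- c - 1" "- b - 1" "- a - 1"] sh[of "- d - 1" "- c" "- b - 1" "- a - 1"]
      sh[of "- d - 1" "- c - 1" "- b" "- a - 1"] sh[of "- d - 1" "- c - 1" "- b - 1" "- a"] by simp
qed (simp_all add: N_ge_2 q_def swaps)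

lemma of_nat_poly_neq_0:
  "q \<noteq> 0" "1 + q \<noteq> 0" "1 + q^2 \<noteq> 0" "1 + q + q^2 \<noteq> 0" "1 - q^4 \<noteq> 0"
proof -
  have "of_nat N \<noteq> (0::complex)" "of_nat (1 + N) \<noteq> (0::complex)" "of_nat (1 + N^2) \<noteq> (0::complex)"
    "of_nat (1 + N + N^2) \<noteq> (0::complex)"
    using N_ge_2 by (simp_all only: of_nat_eq_0_iff)
  then show "q \<noteq> 0" "1 + q \<noteq> 0" "1 + q^2 \<noteq> 0" "1 + q + q^2 \<noteq> 0"
    by (simp_all add: q_def add.assoc)
  have "1 < N^4"
    using N_ge_2 by (intro one_less_power) auto
  then have "of_nat (N^4) \<noteq> (1::complex)"
    by (simp only: of_nat_eq_1_iff)
  then show "1 - q^4 \<noteq> 0"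
    by (simp add: q_def)
qed

text \<open>
  This is the generating function of the one-row Hall-Littlewood polynomials \<open>P\<^bsub>(n)\<^esub>(y; t)\<close> at \<open>t = q\<close>.
\<close>

lemma ray_generating_function:
  defines "D \<equiv> [:1, - l1, q * l2, - (q^3 * l3), q^6:]"
    and "Dq \<equiv> [:1, - (q * l1), q^3 * l2, - (q^6 * l3), q^10:]"
  shows "Abs_fps (\<lambda>n. \<Phi> (int n) 0 0 0) * fps_of_poly (smult (1 - q^4) D) =
    fps_of_poly (smult (\<Phi> 0 0 0 0) (Dq - smult (q^4) D))"
proof -
  define u v w where "u n = \<Phi> (int n) 0 0 0" and "v n = \<Phi> (int n) 1 0 0" and "w n = \<Phi> (int n) 1 1 0" for n
  have 1: "u (Suc n) = l1 * u n - q * (1 + q + q^2) * v n" for n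
    using hecke1[of 0 n 0 0] by (simp add: swaps u_def v_def algebra_simps power2_eq_square power3_eq_cube)
  have 2: "(1 + q + q^2) * v (Suc n) = l2 * u n - q^2 * (1 + q + q^2) * w n" for n
    using hecke2[of 0 n 0 0]
    by (simp add: swaps u_def v_def w_def algebra_simps power2_eq_square power3_eq_cube power4_eq_xxxx)
  have 3: "(1 + q + q^2) * w (Suc (Suc n)) = l3 * u (Suc n) - q^3 * u n" for n
    using hecke3[of 0 "Suc n" 0 0] shift[of n 1 0 0 0]
    by (simp add: swaps u_def v_def w_def algebra_simps power2_eq_square power3_eq_cube)
  \<comment> \<open>At the origin all four terms of the third relation are permutations of
    (1,1,1,0), whereas further out the last term is shifted back onto the ray. Together with
    \<open>v0\<close> and \<open>w0\<close> this boundary behaviour determines the low coefficients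
    of the numerator.\<close>
  have 4: "(1 + q + q^2) * w (Suc 0) = l3 * u 0 - q^3 * w (Suc 0)"
    using hecke3[of 0 0 0 0]
    by (simp add: swaps u_def v_def w_def algebra_simps power2_eq_square power3_eq_cube)
  have v0: "v 0 = u 1" and w0: "w 0 = v 1"
    by (simp_all add: u_def v_def w_def swaps)
  define p where "p = 1 + q + q^2"
  note rels = 1[folded p_def] 2[folded p_def] 3[folded p_def]
  \<comment> \<open>Eliminating \<open>v\<close> and \<open>w\<close> leaves a recurrence for
    \<open>u\<close> alone, whose characteristic polynomial is the quartic of the overview.\<close>
  have rec: "u (n + 4) = l1 * u (n + 3) - q * l2 * u (n + 2) + q^3 * l3 * u (n + 1) - q^6 * u n" for n
  proof -
    have "p * v (n + 3) = l2 * u (n + 2) - q^2 * (l3 * u (n + 1) - q^3 * u n)"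
      using rels(2)[of "n + 2"] rels(3)[of n] by (simp add: numeral_eq_Suc mult.assoc)
    moreover have "u (n + 4) = l1 * u (n + 3) - q * (p * v (n + 3))"
      using rels(1)[of "n + 3"] by (simp add: numeral_eq_Suc mult.assoc)
    ultimately have "u (n + 4) = l1 * u (n + 3) - q * (l2 * u (n + 2) - q^2 * (l3 * u (n + 1) - q^3 * u n))"
      by simp
    then show ?thesis
      by (simp add: algebra_simps eval_nat_numeral)
  qed
  have u2: "u 2 = l1 * u 1 - q * p * v 1" and u3: "u 3 = l1 * u 2 - q * p * v 2"
    and v2: "p * v 2 = l2 * u 1 - q^2 * p * w 1"
    using rels(1)[of 1] rels(1)[of 2] rels(2)[of 1] by (simp_all add: numeral_eq_Suc)
  \<comment> \<open>The factor 1 - q^4 clears 1 + q + q^2 + q^3 and 1 + q^2, the coefficients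
    produced by coinciding terms of the relations at the origin.\<close>
  have n1: "(1 - q^4) * (u 1 - l1 * u 0) = - (q * l1) * (1 - q^3) * u 0"
    using rels(1)[of 0] unfolding v0 p_def One_nat_def by algebra
  have v1: "p * v 1 * (1 - q^4) = l2 * u 0 * (1 - q^2)"
    using rels(2)[of 0] unfolding w0 One_nat_def by algebra
  have n2: "(1 - q^4) * (u 2 - l1 * u 1 + q * l2 * u 0) = q^3 * l2 * (1 - q^2) * u 0"
    using v1 u2 by algebra
  have w1: "w 1 * (1 - q^4) = l3 * u 0 * (1 - q)"
    using 4 unfolding One_nat_def by algebra
  have n3: "(1 - q^4) * (u 3 - l1 * u 2 + q * l2 * u 1 - q^3 * l3 * u 0) = - (q^6 * l3 * (1 - q) * u 0)"
    using w1 u3 v2 unfolding p_def by algebra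
  show ?thesis
  proof (rule fps_ext)
    fix n :: nat
    consider "n = (0::nat)" | "n = 1" | "n = 2" | "n = 3" | m where "n = m + 4"
      by (atomize_elim) presburger
    then show "fps_nth (Abs_fps (\<lambda>n. \<Phi> (int n) 0 0 0) * fps_of_poly (smult (1 - q^4) D)) n =
      fps_nth (fps_of_poly (smult (\<Phi> 0 0 0 0) (Dq - smult (q^4) D))) n"
    proof cases
      case 1
      then show ?thesis
        by (simp add: D_def Dq_def algebra_simps)
    next
      case 2
      with n1 show ?thesis
        by (simp add: D_def Dq_def fps_mult_of_poly_pCons_nth_Suc fps_of_poly_const u_def algebra_simps eval_nat_numeral)
    next
      case 3
      with n2 show ?thesis
        by (simp add: D_def Dq_def fps_mult_of_poly_pCons_nth_Suc fps_of_poly_const u_def algebra_simps eval_nat_numeral)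
    next
      case 4
      with n3 show ?thesis
        by (simp add: D_def Dq_def fps_mult_of_poly_pCons_nth_Suc fps_of_poly_const u_def algebra_simps eval_nat_numeral)
    next
      case (5 m)
      have "(1 - q^4) * (u (m + 4) - l1 * u (m + 3) + q * l2 * u (m + 2) - q^3 * l3 * u (m + 1) + q^6 * u m) = 0"
        using rec[of m] by simp
      with 5 show ?thesis
        by (simp add: D_def Dq_def fps_mult_of_poly_pCons_nth_Suc fps_of_poly_const u_def algebra_simps eval_nat_numeral)
    qed
  qed
qed

text \<open>By decay the factors of \<open>D\<close> belonging to large roots divide the numerator,
  a combination of \<open>Dq\<close> and \<open>D\<close>. They also divide \<open>D\<close>, hence
  they divide \<open>Dq\<close>, whose parameters are the q y_i. So each large root is q times some
  root, with multiplicity.\<close>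

lemma roots_on_ray:
  assumes "\<Phi> 0 0 0 0 \<noteq> 0" and "0 < r" and "(\<lambda>n. \<Phi> (int n) 0 0 0 * of_real r ^ n) \<longlonglongrightarrow> 0"
    and "l1 = y1 + y2 + y3 + y4"
    and "q * l2 = y1*y2 + y1*y3 + y1*y4 + y2*y3 + y2*y4 + y3*y4"
    and "q^3 * l3 = y1*y2*y3 + y1*y2*y4 + y1*y3*y4 + y2*y3*y4"
    and "q^6 = y1*y2*y3*y4"
  shows "{#y \<in># {#y1, y2, y3, y4#}. 1 \<le> cmod y * r#} \<subseteq># {#q * y1, q * y2, q * y3, q * y4#}"
proof -
  define Y where "Y = {#y1, y2, y3, y4#}"
  define D where "D = [:1, - l1, q * l2, - (q^3 * l3), q^6:]"
  define Dq where "Dq = [:1, - (q * l1), q^3 * l2, - (q^6 * l3), q^10:]"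
  define R where "R = smult (inverse (1 - q^4)) (smult (\<Phi> 0 0 0 0) (Dq - smult (q^4) D))"
  have D: "D = (\<Prod>y\<in>#Y. lin_factor y)"
    unfolding D_def assms(4-) by (simp add: Y_def lin_factor_def algebra_simps)
  have "Dq = [:1, - (q * l1), q^2 * (q * l2), - (q^3 * (q^3 * l3)), q^4 * q^6:]"
    by (simp add: Dq_def eval_nat_numeral mult.assoc)
  then have Dq: "Dq = (\<Prod>y\<in>#image_mset ((*) q) Y. lin_factor y)"
    unfolding assms(4-) by (simp add: Y_def lin_factor_def algebra_simps eval_nat_numeral)
  have "fps_of_poly (smult (1 - q^4) D) = fps_const (1 - q^4) * fps_of_poly D"
    by (rule fps_of_poly_smult)
  then have "fps_const (1 - q^4) * (Abs_fps (\<lambda>n. \<Phi> (int n) 0 0 0) * fps_of_poly D) =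
      fps_const (1 - q^4) * fps_of_poly R"
    using ray_generating_function of_nat_poly_neq_0(5)
    by (simp add: D_def Dq_def R_def mult_ac flip: fps_of_poly_smult)
  then have "Abs_fps (\<lambda>n. \<Phi> (int n) 0 0 0) * fps_of_poly D = fps_of_poly R"
    using of_nat_poly_neq_0(5) by simp
  then have "(\<Prod>y\<in>#{#y \<in># Y. 1 \<le> cmod y * r#}. lin_factor y) dvd R"
    using assms(2,3) unfolding D by (intro prod_linear_dvd_of_decays) (auto simp: decays_def)
  moreover have "(\<Prod>y\<in>#{#y \<in># Y. 1 \<le> cmod y * r#}. lin_factor y) dvd D"
    unfolding D by (intro prod_mset_subset_imp_dvd image_mset_subseteq_mono) simp
  \<comment> \<open>The value at the origin is a common factor of the numerator; its being non-zero
    is what lets \<open>Dq\<close> be recovered from \<open>R\<close> and \<open>D\<close>.\<close>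
  moreover have "Dq = smult ((1 - q^4) / \<Phi> 0 0 0 0) R + smult (q^4) D"
    using assms(1) of_nat_poly_neq_0(5) by (simp add: R_def)
  ultimately have "(\<Prod>y\<in>#{#y \<in># Y. 1 \<le> cmod y * r#}. lin_factor y) dvd (\<Prod>y\<in>#image_mset ((*) q) Y. lin_factor y)"
    unfolding Dq[symmetric] by (simp add: dvd_smult)
  moreover have "0 \<notin># Y"
    using assms(7) of_nat_poly_neq_0(1) by (auto simp: Y_def)
  ultimately have "{#y \<in># Y. 1 \<le> cmod y * r#} \<subseteq># image_mset ((*) q) Y"
    by (intro prod_linear_dvd_imp_subset) auto
  then show ?thesis
    by (simp add: Y_def)
qed

section \<open>An eigenfunction is determined by its value at the origin\<close>

lemma quantum_integer_neq_0:
  "1 + q + q^2 + q^3 \<noteq> 0" "1 + q + q^2 + q^2 + q^3 + q^4 \<noteq> 0"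
proof -
  have "1 + q + q^2 + q^3 = (1 + q) * (1 + q^2)" "1 + q + q^2 + q^2 + q^3 + q^4 = (1 + q^2) * (1 + q + q^2)"
    by (simp_all add: algebra_simps eval_nat_numeral)
  with of_nat_poly_neq_0 show "1 + q + q^2 + q^3 \<noteq> 0" "1 + q + q^2 + q^2 + q^3 + q^4 \<noteq> 0"
    by simp_all
qed

text \<open>Lower every entry equal to the maximum by one and apply the Hecke relation that raises
  as many entries. Its centre and terms either have smaller \<open>sq_dev\<close> or are
  permutations of (a, b, c, d). Hence the value there, multiplied by a sum of powers of q that is
  not zero, vanishes.\<close>

lemma vanishes_step:
  assumes IH: "\<And>w x y z. sq_dev w x y z < sq_dev a b c d \<Longrightarrow> \<Phi> w x y z = 0"
    and le: "b \<le> a" "c \<le> b" "d \<le> c" and zero: "\<Phi> 0 0 0 0 = 0"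
  shows "\<Phi> a b c d = 0"
proof -
  have sm: "\<Phi> w x y z = 0"
    if "w + x + y + z = a + b + c + d" "w^2 + x^2 + y^2 + z^2 < a^2 + b^2 + c^2 + d^2" for w x y z
    using that by (intro IH sq_dev_less)
  define k where "k = a - 1"
  have a: "a = k + 1"
    by (simp add: k_def)
  \<comment> \<open>Here \<open>e\<close> is the lowest entry that the term raises. If it equals k
    the term is a permutation of (a, b, c, d); if it is smaller, the sum of squares drops.\<close>
  have upd: "\<Phi> w x y z = (if e = k then \<Phi> a b c d else 0)"
    if "e = k \<Longrightarrow> \<Phi> w x y z = \<Phi> a b c d" "w + x + y + z = a + b + c + d"
      "e \<noteq> k \<Longrightarrow> w^2 + x^2 + y^2 + z^2 < a^2 + b^2 + c^2 + d^2" for w x y z e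
    using that sm by simp
  consider "b < a" | "b = a" "c < a" | "b = a" "c = a" "d < a" | "b = a" "c = a" "d = a"
    using le by linarith
  then show ?thesis
  proof cases
    case 1
    then have le': "b \<le> k"
      by (simp add: a)
    have "sq_dev k b c d < sq_dev a b c d"
      using le le' by (simp add: sq_dev_def a power2_eq_square algebra_simps)
    then have 0: "\<Phi> k b c d = 0"
      by (rule IH)
    have 2: "\<Phi> k (b + 1) c d = (if b = k then \<Phi> a b c d else 0)"
    proof (rule upd)
      assume "b = k"
      with le le' have "b = k"
        by auto
      then show "\<Phi> k (b + 1) c d = \<Phi> a b c d"
        by (simp add: a swaps)
    qed (use le le' in \<open>simp_all add: a power2_eq_square algebra_simps\<close>)
    have 3: "\<Phi> k b (c + 1) d = (if c = k then \<Phi> a b c d else 0)"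
    proof (rule upd)
      assume "c = k"
      with le le' have "b = k \<and> c = k"
        by auto
      then show "\<Phi> k b (c + 1) d = \<Phi> a b c d"
        by (simp add: a swaps)
    qed (use le le' in \<open>simp_all add: a power2_eq_square algebra_simps\<close>)
    have 4: "\<Phi> k b c (d + 1) = (if d = k then \<Phi> a b c d else 0)"
    proof (rule upd)
      assume "d = k"
      with le le' have "b = k \<and> c = k \<and> d = k"
        by auto
      then show "\<Phi> k b c (d + 1) = \<Phi> a b c d"
        by (simp add: a swaps)
    qed (use le le' in \<open>simp_all add: a power2_eq_square algebra_simps\<close>)
    have "\<Phi> a b c d + q * (if b = k then \<Phi> a b c d else 0) + q^2 * (if c = k then \<Phi> a b c d else 0) +
        q^3 * (if d = k then \<Phi> a b c d else 0) = 0"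
      using hecke1[of b k c d] le le' unfolding 0 2 3 4 by (simp add: a)
    moreover have "c = k \<Longrightarrow> b = k" "d = k \<Longrightarrow> c = k"
      using le le' by auto
    ultimately have "\<Phi> a b c d * (1 + q + q^2 + q^3) = 0 \<or> \<Phi> a b c d * (1 + q + q^2) = 0 \<or>
        \<Phi> a b c d * (1 + q) = 0 \<or> \<Phi> a b c d = 0"
      by (cases "b = k"; cases "c = k"; cases "d = k") (simp_all add: algebra_simps del: mult_eq_0_iff)
    then show ?thesis
      using of_nat_poly_neq_0 quantum_integer_neq_0 by simp
  next
    case 2
    have "sq_dev k k c d < sq_dev a b c d"
      using le 2 by (simp add: sq_dev_def a power2_eq_square algebra_simps)
    then have 0: "\<Phi> k k c d = 0"
      by (rule IH)
    have 13: "\<Phi> a k (c + 1) d = (if c = k then \<Phi> a b c d else 0)"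
    proof (rule upd)
      assume "c = k"
      with le 2 a have "b = k + 1 \<and> c = k"
        by auto
      then show "\<Phi> a k (c + 1) d = \<Phi> a b c d"
        by (simp add: a swaps)
    qed (use le 2 a in \<open>simp_all add: a power2_eq_square algebra_simps\<close>)
    have 14: "\<Phi> a k c (d + 1) = (if d = k then \<Phi> a b c d else 0)"
    proof (rule upd)
      assume "d = k"
      with le 2 a have "b = k + 1 \<and> c = k \<and> d = k"
        by auto
      then show "\<Phi> a k c (d + 1) = \<Phi> a b c d"
        by (simp add: a swaps)
    qed (use le 2 a in \<open>simp_all add: a power2_eq_square algebra_simps\<close>)
    have 23: "\<Phi> k a (c + 1) d = (if c = k then \<Phi> a b c d else 0)"
    proof (rule upd)
      assume "c = k"
      with le 2 a have "b = k + 1 \<and> c = k"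
        by auto
      then show "\<Phi> k a (c + 1) d = \<Phi> a b c d"
        by (simp add: a swaps)
    qed (use le 2 a in \<open>simp_all add: a power2_eq_square algebra_simps\<close>)
    have 24: "\<Phi> k a c (d + 1) = (if d = k then \<Phi> a b c d else 0)"
    proof (rule upd)
      assume "d = k"
      with le 2 a have "b = k + 1 \<and> c = k \<and> d = k"
        by auto
      then show "\<Phi> k a c (d + 1) = \<Phi> a b c d"
        by (simp add: a swaps)
    qed (use le 2 a in \<open>simp_all add: a power2_eq_square algebra_simps\<close>)
    have 34: "\<Phi> k k (c + 1) (d + 1) = (if d = k then \<Phi> a b c d else 0)"
    proof (rule upd)
      assume "d = k"
      with le 2 a have "b = k + 1 \<and> c = k \<and> d = k"
        by auto
      then show "\<Phi> k k (c + 1) (d + 1) = \<Phi> a b c d"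
        by (simp add: a swaps)
    qed (use le 2 a in \<open>simp_all add: a power2_eq_square algebra_simps\<close>)
    have "\<Phi> a b c d + q * (if c = k then \<Phi> a b c d else 0) + q^2 * (if d = k then \<Phi> a b c d else 0) +
        q^2 * (if c = k then \<Phi> a b c d else 0) + q^3 * (if d = k then \<Phi> a b c d else 0) +
        q^4 * (if d = k then \<Phi> a b c d else 0) = 0"
    proof -
      have "c \<le> k"
        using 2 a by simp
      from hecke2[of k k c d, folded a, OF order_refl this le(3)] show ?thesis
        unfolding 0 13 14 23 24 34 by (simp add: 2)
    qed
    moreover have "d = k \<Longrightarrow> c = k"
      using le 2 k_def by auto
    ultimately have "\<Phi> a b c d * (1 + q + q^2 + q^2 + q^3 + q^4) = 0 \<or> \<Phi> a b c d * (1 + q + q^2) = 0 \<or> \<Phi> a b c d = 0"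
      by (cases "c = k"; cases "d = k") (simp_all add: algebra_simps del: mult_eq_0_iff)
    then show ?thesis
      using of_nat_poly_neq_0 quantum_integer_neq_0 by simp
  next
    case 3
    have "sq_dev k k k d < sq_dev a b c d"
      using le 3 by (simp add: sq_dev_def a power2_eq_square algebra_simps)
    then have 0: "\<Phi> k k k d = 0"
      by (rule IH)
    have 124: "\<Phi> a a k (d + 1) = (if d = k then \<Phi> a b c d else 0)"
    proof (rule upd)
      assume "d = k"
      with le 3 a have "b = k + 1 \<and> c = k + 1 \<and> d = k"
        by auto
      then show "\<Phi> a a k (d + 1) = \<Phi> a b c d"
        by (simp add: a swaps)
    qed (use le 3 a in \<open>simp_all add: a power2_eq_square algebra_simps\<close>)
    have 134: "\<Phi> a k a (d + 1) = (if d = k then \<Phi> a b c d else 0)"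
    proof (rule upd)
      assume "d = k"
      with le 3 a have "b = k + 1 \<and> c = k + 1 \<and> d = k"
        by auto
      then show "\<Phi> a k a (d + 1) = \<Phi> a b c d"
        by (simp add: a swaps)
    qed (use le 3 a in \<open>simp_all add: a power2_eq_square algebra_simps\<close>)
    have 234: "\<Phi> k a a (d + 1) = (if d = k then \<Phi> a b c d else 0)"
    proof (rule upd)
      assume "d = k"
      with le 3 a have "b = k + 1 \<and> c = k + 1 \<and> d = k"
        by auto
      then show "\<Phi> k a a (d + 1) = \<Phi> a b c d"
        by (simp add: a swaps)
    qed (use le 3 a in \<open>simp_all add: a power2_eq_square algebra_simps\<close>)
    have "\<Phi> a b c d + q * (if d = k then \<Phi> a b c d else 0) + q^2 * (if d = k then \<Phi> a b c d else 0) +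
        q^3 * (if d = k then \<Phi> a b c d else 0) = 0"
    proof -
      have "d \<le> k"
        using 3 a by simp
      from hecke3[of k k k d, folded a, OF order_refl order_refl this] show ?thesis
        unfolding 0 124 134 234 by (simp add: 3)
    qed
    then have "\<Phi> a b c d * (1 + q + q^2 + q^3) = 0 \<or> \<Phi> a b c d = 0"
      by (cases "d = k") (simp_all add: algebra_simps del: mult_eq_0_iff)
    then show ?thesis
      using of_nat_poly_neq_0 quantum_integer_neq_0 by simp
  next
    case 4
    then show ?thesis
      using shift[of 0 a 0 0 0] zero by simp
  qed
qed

text \<open>Induction on \<open>sq_dev\<close>. The Hecke relations hold for dominant tuples only,
  so within one value of the measure the claim is reduced to sorted tuples, the measure being
  symmetric too.\<close>

lemma vanishes_if_0:
  assumes "\<Phi> 0 0 0 0 = 0"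
  shows "\<Phi> a b c d = 0"
proof (induction "nat (sq_dev a b c d)" arbitrary: a b c d rule: less_induct)
  case less
  define m where "m = sq_dev a b c d"
  have IH: "\<Phi> w x y z = 0" if "sq_dev w x y z < m" for w x y z
    using less that sq_dev_nonneg[of w x y z] by (simp add: m_def)
  have "sq_dev a b c d = m \<longrightarrow> \<Phi> a b c d = 0" for a b c d
  proof (rule sorted4_wlog)
    fix a b c d :: int
    assume "b \<le> a" "c \<le> b" "d \<le> c"
    then show "sq_dev a b c d = m \<longrightarrow> \<Phi> a b c d = 0"
      using vanishes_step[OF _ _ _ _ assms] IH by blast
  qed (simp_all add: swaps sq_dev_def ac_simps)
  then show ?case
    by (simp add: m_def)
qed

text \<open>
  Excludes the roots \<open>a, q a, b, q b\<close> with \<open>s = a + b\<close>, \<open>\<epsilon> q\<^sup>2 = a b\<close> and \<open>\<tau> = a / b\<close>. The sequence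
  \<open>D\<close> of the proof kills the roots \<open>q\<close> and \<open>1 / q\<close> of the recurrence along the second ray; the
  remaining ones are \<open>\<tau>\<close> and \<open>1 / \<tau>\<close>, and \<open>E\<close> is the part of \<open>D\<close> that grows like \<open>\<tau>\<close>.
\<close>

lemma no_double_segment:
  assumes "\<Phi> 0 0 0 0 \<noteq> 0" and \<epsilon>: "\<epsilon> * \<epsilon> = 1" and l1: "l1 = (1 + q) * s" and l3: "l3 = \<epsilon> * (1 + q) * s"
    and l2: "l2 = s^2 + \<epsilon> * q * (1 + q^2)" and s: "\<tau> * s^2 = \<epsilon> * q^2 * (1 + \<tau>)^2"
    and \<tau>: "1 \<le> cmod \<tau>" "cmod \<tau> < of_nat N"
    and lim: "(\<lambda>n. \<Phi> (int n) (int n) 0 0 * (1 / of_nat N ^ 2) ^ n) \<longlonglongrightarrow> 0"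
  shows False
proof -
  define X Y Z V B where "X n = \<Phi> (int n) (int n) 0 0" and "Y n = \<Phi> (int n + 1) (int n) 0 0"
    and "Z n = \<Phi> (int n) (int n) 1 0" and "V n = \<Phi> (int n + 1) (int n) 1 0"
    and "B n = \<Phi> (int n + 2) (int n) 0 0" for n
  note defs = X_def Y_def Z_def V_def B_def
  \<comment> \<open>\<open>e\<close> is the product a b. The factors \<open>\<kappa>\<close> and
    \<open>p\<close> make up the Gaussian binomial coefficient of 4 over 2, which multiplies
    \<open>X 1\<close> in the second relation at the origin.\<close>
  define e p \<kappa> where "e = \<epsilon> * q^2" and "p = 1 + q + q^2" and "\<kappa> = 1 + q^2"
  note nz = of_nat_poly_neq_0
  have a1: "(1 + q) * (Y n + q^2 * Z n) = (1 + q) * (s * X n)" for n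
    using hecke1[of n n 0 0] by (simp add: swaps defs l1 algebra_simps eval_nat_numeral)
  then have a: "Y n + q^2 * Z n = s * X n" for n
    using nz(2) by simp
  have "(1 + q) * (Z (n + 2) + q^2 * Y n) = (1 + q) * (\<epsilon> * s * X (n + 1))" for n
    using hecke3[of "n + 1" "n + 1" 0 0] shift[of "n + 1" 1 n 0 0]
    by (simp add: swaps defs l3 algebra_simps eval_nat_numeral)
  then have b: "Z (n + 2) + q^2 * Y n = \<epsilon> * s * X (n + 1)" for n
    using nz(2) by simp
  have "(1 + q) * (Z 1 + q^2 * Z 1) = (1 + q) * (\<epsilon> * s * X 0)"
    using hecke3[of 0 0 0 0] by (simp add: swaps defs l3 algebra_simps eval_nat_numeral)
  then have "Z 1 + q^2 * Z 1 = \<epsilon> * s * X 0"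
    using nz(2) by simp
  then have b0: "\<kappa> * Z 1 = \<epsilon> * s * X 0"
    by (simp add: \<kappa>_def distrib_right)
  have c: "X (n + 2) + q * (1 + q)^2 * V (n + 1) + q^4 * X n = l2 * X (n + 1)" for n
    using hecke2[of "n + 1" "n + 1" 0 0] shift[of n 1 n 0 0]
    by (simp add: swaps defs algebra_simps eval_nat_numeral)
  have c0: "\<kappa> * p * X 1 = l2 * X 0"
    using hecke2[of 0 0 0 0] by (simp add: swaps defs \<kappa>_def p_def algebra_simps eval_nat_numeral)
  have d: "B n + q * X (n + 1) + q^2 * (1 + q) * V n = l1 * Y n" for n
    using hecke1[of n "n + 1" 0 0] by (simp add: swaps defs algebra_simps eval_nat_numeral)
  have f: "(1 + q) * V (n + 2) + q^2 * B n + q^3 * X (n + 1) = l3 * Y (n + 1)" for n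
    using hecke3[of "n + 1" "n + 2" 0 0] shift[of "n + 2" 1 n 0 0] shift[of "n + 1" 1 "n + 1" 0 0]
    by (simp add: swaps defs algebra_simps eval_nat_numeral)
  have f0: "p * V 1 + q^3 * X 0 = l3 * Y 0"
    using hecke3[of 0 1 0 0] shift[of 0 1 0 0 0] shift[of 1 1 0 0 0]
    by (simp add: swaps defs p_def algebra_simps eval_nat_numeral)
  have V0: "V 0 = X 1" and Z0: "Z 0 = Y 0"
    by (simp_all add: swaps defs)
  have Y0: "\<kappa> * Y 0 = s * X 0"
    using a[of 0] by (simp add: Z0 \<kappa>_def algebra_simps)
  \<comment> \<open>This proportionality reflects \<open>l3 = \<epsilon> * l1\<close>. It closes the
    relations next to the ray into the first-order recurrences \<open>Yrec\<close> and
    \<open>Vrec\<close>.\<close>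
  have ZY: "Z (n + 1) = \<epsilon> * Y n" for n
  proof (induction n)
    case 0
    have "\<kappa> * Z 1 = \<kappa> * (\<epsilon> * Y 0)"
      using b0 Y0 by algebra
    then show ?case
      using nz(3) by (simp add: \<kappa>_def)
  next
    case (Suc n)
    then show ?case
      using a[of "n + 1"] b[of n] \<epsilon> by (simp add: numeral_2_eq_2) algebra
  qed
  have Yrec: "Y (n + 1) = s * X (n + 1) - e * Y n" for n
    using a[of "n + 1"] ZY[of n] unfolding e_def by algebra
  have Vrec: "V (n + 1) = \<epsilon> * s * Y n - e * V n" for n
  proof (induction n)
    case 0
    have "\<kappa> * p * V 1 = \<kappa> * p * (\<epsilon> * s * Y 0 - e * X 1)"
      using f0 c0 Y0 \<epsilon> unfolding e_def l3 l2 p_def \<kappa>_def by algebra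
    then show ?case
      using nz(3,4) by (simp add: \<kappa>_def p_def V0)
  next
    case (Suc n)
    have "(1 + q) * V (n + 2) = (1 + q) * (\<epsilon> * s * Y (n + 1) - e * V (n + 1))"
      using Suc f[of n] d[of n] \<epsilon> unfolding e_def l3 l1 by algebra
    then show ?case
      using nz(2) by simp
  qed
  define D E where "D n = s^2 * X (n + 1) - q * (1 + q)^2 * V (n + 1)"
    and "E n = \<tau> * D (n + 1) - e * D n" for n
  \<comment> \<open>The polynomial x^2 - \<epsilon> q \<kappa> x + q^4 has the roots q e and e / q,
    so these two rates are absent from \<open>D\<close>.\<close>
  have D: "D n = X (n + 2) - \<epsilon> * q * \<kappa> * X (n + 1) + q^4 * X n" for n
    using c[of n] unfolding D_def l2 \<kappa>_def by algebra
  \<comment> \<open>By \<open>Vrec\<close> and \<open>Yrec\<close>, applying (shift + e) to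
    \<open>V\<close> gives a multiple of \<open>Y\<close> and applying it again gives a multiple of
    \<open>X\<close>.\<close>
  have "V (n + 3) + 2 * e * V (n + 2) + e^2 * V (n + 1) = \<epsilon> * s^2 * X (n + 2)" for n
  proof -
    have "V (n + 3) = \<epsilon> * s * Y (n + 2) - e * V (n + 2)" "V (n + 2) = \<epsilon> * s * Y (n + 1) - e * V (n + 1)"
      "Y (n + 2) = s * X (n + 2) - e * Y (n + 1)"
      using Vrec[of "n + 2"] Vrec[of "n + 1"] Yrec[of "n + 1"] by (simp_all add: numeral_eq_Suc)
    then show ?thesis by algebra
  qed
  note V3 = this
  have e2: "e^2 = q^4"
    using \<epsilon> unfolding e_def by algebra
  have Drec: "D (n + 2) = (s^2 - 2 * e) * D (n + 1) - e^2 * D n" for n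
  proof -
    have "D (n + 2) + 2 * e * D (n + 1) + e^2 * D n =
        s^2 * (X (n + 3) + 2 * e * X (n + 2) + e^2 * X (n + 1)) -
        q * (1 + q)^2 * (V (n + 3) + 2 * e * V (n + 2) + e^2 * V (n + 1))"
      by (simp add: D_def numeral_eq_Suc algebra_simps)
    also have "\<dots> = s^2 * (X (n + 3) - \<epsilon> * q * \<kappa> * X (n + 2) + q^4 * X (n + 1))"
      unfolding V3 unfolding e2 by (simp add: e_def \<kappa>_def algebra_simps eval_nat_numeral)
    also have "\<dots> = s^2 * D (n + 1)"
      using D[of "n + 1"] by (simp add: numeral_eq_Suc)
    finally show ?thesis
      by algebra
  qed
  \<comment> \<open>By the relation between \<open>\<tau>\<close> and \<open>s\<close> the
    characteristic roots of \<open>Drec\<close> are e \<tau> and e / \<tau>; passing to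
    \<open>E\<close> removes the second.\<close>
  have Erec: "E (Suc n) = (e * \<tau>) * E n" for n
    using Drec[of n] s unfolding E_def e_def by (simp add: numeral_2_eq_2) algebra
  define \<rho> :: real where "\<rho> = 1 / of_nat N ^ 2"
  have \<rho>: "0 < \<rho>" "of_real \<rho> = 1 / q^2"
    using N_ge_2 by (simp_all add: \<rho>_def q_def)
  have "cmod \<epsilon> ^ 2 = 1"
    using arg_cong[OF \<epsilon>, of cmod] by (simp add: norm_mult power2_eq_square)
  then have "cmod \<epsilon> = 1"
    using norm_ge_zero[of \<epsilon>] by (auto simp: power2_eq_1_iff simp del: norm_ge_zero)
  \<comment> \<open>The decay known on the second ray is exactly critical for the rate
    \<open>e\<close>, so the rate e \<tau> with |\<tau>| >= 1 does not decay.\<close>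
  then have e: "cmod e * \<rho> = 1"
    using N_ge_2 by (simp add: e_def \<rho>_def q_def norm_mult norm_power)
  have Xlim: "(\<lambda>n. X (n + k) * of_real \<rho> ^ n) \<longlonglongrightarrow> 0" for k
  proof -
    have "(\<lambda>n. X (n + k) * of_real \<rho> ^ (n + k)) \<longlonglongrightarrow> 0"
      using LIMSEQ_ignore_initial_segment[OF lim, of k] by (simp add: X_def \<rho>_def)
    then have "(\<lambda>n. X (n + k) * of_real \<rho> ^ (n + k) / of_real \<rho> ^ k) \<longlonglongrightarrow> 0"
      by (rule tendsto_divide_zero)
    then show ?thesis
      using \<rho>(1) by (simp add: power_add)
  qed
  have Dlim: "(\<lambda>n. D (n + k) * of_real \<rho> ^ n) \<longlonglongrightarrow> 0" for k
  proof -
    have "(\<lambda>n. X (n + (k + 2)) * of_real \<rho> ^ n - (\<epsilon> * q * \<kappa>) * (X (n + (k + 1)) * of_real \<rho> ^ n) +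
        q^4 * (X (n + k) * of_real \<rho> ^ n)) \<longlonglongrightarrow> 0 - (\<epsilon> * q * \<kappa>) * 0 + q^4 * 0"
      by (intro tendsto_intros Xlim)
    then show ?thesis
      by (simp add: D algebra_simps)
  qed
  have "(\<lambda>n. \<tau> * (D (n + 1) * of_real \<rho> ^ n) - e * (D (n + 0) * of_real \<rho> ^ n)) \<longlonglongrightarrow> \<tau> * 0 - e * 0"
    by (intro tendsto_intros Dlim)
  then have "(\<lambda>n. E n * of_real \<rho> ^ n) \<longlonglongrightarrow> 0"
    by (simp add: E_def algebra_simps)
  moreover have "1 \<le> cmod (e * \<tau>) * \<rho>"
  proof -
    have "cmod (e * \<tau>) * \<rho> = cmod \<tau> * (cmod e * \<rho>)"
      by (simp add: norm_mult mult_ac)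
    then show ?thesis
      using \<tau>(1) e by simp
  qed
  ultimately have E0: "E 0 = 0"
    using geometric_decay_imp_0[of E "e * \<tau>"] Erec \<rho>(1) by simp
  define \<sigma> where "\<sigma> = \<epsilon> * s^2 / q^2"
  have \<tau>0: "\<tau> \<noteq> 0"
    using \<tau>(1) by auto
  have s2: "s^2 = \<epsilon> * q^2 * \<sigma>"
    using \<epsilon> nz(1) by (simp add: \<sigma>_def flip: mult.assoc)
  have \<tau>\<sigma>: "\<tau> * \<sigma> = (1 + \<tau>)^2"
    using s \<epsilon> nz(1) unfolding \<sigma>_def by (simp add: field_simps)
  have V1: "V 1 = \<epsilon> * s * Y 0 - e * X 1" and V2: "V 2 = \<epsilon> * s * Y 1 - e * V 1" and Y1: "Y 1 = s * X 1 - e * Y 0"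
    using Vrec[of 0] Vrec[of 1] Yrec[of 0] by (simp_all add: V0 numeral_2_eq_2)
  define P0 where "P0 = q^3 * (\<sigma> * (q * \<sigma> + \<kappa>) - (1 + q)^2 * ((1 + q) * \<sigma> - q * \<kappa>))"
  define P1 where "P1 = q^2 * \<sigma> * (P0 + q * \<kappa> * (q^2 * \<sigma> + q * \<kappa>) - q^4 * \<kappa> * p) -
       q * (1 + q)^2 * (q^2 * \<sigma> * (q^2 * \<sigma> + q * \<kappa> - q^2 * p) - q^4 * ((1 + q) * \<sigma> - q * \<kappa>))"
  have X1: "\<kappa> * p * X 1 = \<epsilon> * (q^2 * \<sigma> + q * \<kappa>) * X 0"
    using c0 unfolding l2 s2 \<kappa>_def by algebra
  have sY0: "\<kappa> * (s * Y 0) = \<epsilon> * q^2 * \<sigma> * X 0"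
    using Y0 s2 by algebra
  have pV1: "\<kappa> * p * V 1 = q^2 * ((1 + q) * \<sigma> - q * \<kappa>) * X 0"
    using V1 X1 sY0 \<epsilon> unfolding e_def p_def by algebra
  have "\<kappa> * p * D 0 = \<epsilon> * q^2 * \<sigma> * (\<kappa> * p * X 1) - q * (1 + q)^2 * (\<kappa> * p * V 1)"
    unfolding D_def s2 by (simp add: algebra_simps)
  then have pD0: "\<kappa> * p * D 0 = P0 * X 0"
    unfolding X1 pV1 P0_def using \<epsilon> by algebra
  have "X 2 = D 0 + \<epsilon> * q * \<kappa> * X 1 - q^4 * X 0"
    using D[of 0] by (simp add: numeral_2_eq_2)
  then have "\<kappa> * p * X 2 = \<kappa> * p * D 0 + \<epsilon> * q * \<kappa> * (\<kappa> * p * X 1) - q^4 * \<kappa> * p * X 0"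
    by algebra
  then have pX2: "\<kappa> * p * X 2 = (P0 + q * \<kappa> * (q^2 * \<sigma> + q * \<kappa>) - q^4 * \<kappa> * p) * X 0"
    unfolding X1 pD0 using \<epsilon> by algebra
  have "\<kappa> * p * V 2 = \<epsilon> * (s^2 * (\<kappa> * p * X 1) - e * p * (\<kappa> * (s * Y 0))) - e * (\<kappa> * p * V 1)"
    unfolding V2 Y1 by (simp add: algebra_simps power2_eq_square)
  then have pV2: "\<kappa> * p * V 2 =
      \<epsilon> * (q^2 * \<sigma> * (q^2 * \<sigma> + q * \<kappa> - q^2 * p) - q^4 * ((1 + q) * \<sigma> - q * \<kappa>)) * X 0"
    unfolding X1 sY0 pV1 s2 e_def using \<epsilon> by algebra
  have "\<kappa> * p * D 1 = \<epsilon> * q^2 * \<sigma> * (\<kappa> * p * X 2) - q * (1 + q)^2 * (\<kappa> * p * V 2)"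
    unfolding D_def s2 by (simp add: numeral_2_eq_2 algebra_simps)
  then have pD1: "\<kappa> * p * D 1 = \<epsilon> * P1 * X 0"
    unfolding pX2 pV2 P1_def by algebra
  have "\<kappa> * p * E 0 = \<epsilon> * (\<tau> * P1 - q^2 * P0) * X 0"
    using pD0 pD1 unfolding E_def e_def One_nat_def add_0 by algebra
  also have "\<tau> * P1 - q^2 * P0 = q^6 * (\<tau> + 1) * (\<tau> - q)^2 * (\<tau> - q^2)"
    using \<tau>0 \<tau>\<sigma> \<kappa>_def p_def P0_def P1_def by (rule segment_identity)
  finally have "\<tau> = - 1 \<or> \<tau> = q \<or> \<tau> = q^2"
    using E0 \<epsilon> nz(1) assms(1) by (auto simp: X_def add_eq_0_iff2)
  moreover have "\<tau> \<noteq> q" "\<tau> \<noteq> q^2"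
    using \<tau>(2) N_ge_2 by (auto simp: q_def norm_mult power2_eq_square)
  \<comment> \<open>For \<open>\<tau> = - 1\<close> the rates e \<tau> and e / \<tau> coincide, and
    the vanishing of \<open>E\<close> only says that \<open>D\<close> is geometric of ratio -e. This
    ratio is critical, so \<open>D 0\<close> has to vanish, against its explicit value.\<close>
  ultimately have \<tau>1: "\<tau> = - 1"
    by blast
  then have "\<sigma> = 0"
    using \<tau>\<sigma> by simp
  then have "\<kappa> * p * D 0 = q^4 * (1 + q)^2 * \<kappa> * X 0"
    using pD0 unfolding P0_def by algebra
  then have "D 0 \<noteq> 0"
    using assms(1) nz by (auto simp: X_def \<kappa>_def)
  moreover have "D 0 = 0"
  proof (rule geometric_decay_imp_0[of D "- e"])
    show "D (Suc n) = - e * D n" for n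
    proof -
      have "E n = 0"
        by (induction n) (simp_all add: E0 Erec)
      then show ?thesis
        unfolding E_def \<tau>1 Suc_eq_plus1 by algebra
    qed
    show "(\<lambda>n. D n * of_real \<rho> ^ n) \<longlonglongrightarrow> 0"
      using Dlim[of 0] by simp
  qed (use \<rho>(1) e in auto)
  ultimately show False
    by simp
qed

end

subsection \<open>Spectral parameters of square summable eigenfunctions\<close>

lemma multi_member_split2:
  assumes "a \<in># Y" "b \<in># Y" "a \<noteq> b"
  obtains Z where "Y = add_mset a (add_mset b Z)"
proof -
  obtain Y' where Y': "Y = add_mset a Y'"
    using assms(1) by (blast dest: multi_member_split)
  with assms have "b \<in># Y'"
    by auto
  then obtain Z where "Y' = add_mset b Z"
    by (blast dest: multi_member_split)
  with Y' that show thesis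
    by blast
qed

lemma multi_member_split3:
  assumes "a \<in># Y" "b \<in># Y" "c \<in># Y" "a \<noteq> b" "a \<noteq> c" "b \<noteq> c"
  obtains Z where "Y = add_mset a (add_mset b (add_mset c Z))"
proof -
  obtain Y' where Y': "Y = add_mset a (add_mset b Y')"
    using assms by (auto elim: multi_member_split2)
  with assms have "c \<in># Y'"
    by auto
  then obtain Z where "Y' = add_mset c Z"
    by (blast dest: multi_member_split)
  with Y' that show thesis
    by blast
qed

text \<open>Division by q keeps large roots in the multiset, and multiplication by q keeps small
  ones. So from every root one can move towards the circle |y| = R in steps of ratio q, and the
  roots arrange themselves in strings crossing the circle. A string of length one is impossible,
  which leaves one string of length four or two of length two. The product condition rules out roots
  on the circle itself.\<close>

lemma segment_cases:
  fixes q y1 y2 y3 y4 :: complex and R :: real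
  assumes N: "q = of_nat N" "2 \<le> N" and R: "0 < R" "cmod (y1 * y2 * y3 * y4) = R^4"
    and big: "{#y \<in># {#y1, y2, y3, y4#}. R \<le> cmod y#} \<subseteq># {#q * y1, q * y2, q * y3, q * y4#}"
    and small: "{#y \<in># {#y1, y2, y3, y4#}. cmod y \<le> R#} \<subseteq># {#y1 / q, y2 / q, y3 / q, y4 / q#}"
  obtains c where "{#y1, y2, y3, y4#} = {#c, q * c, q^2 * c, q^3 * c#}"
  | a b where "{#y1, y2, y3, y4#} = {#a, q * a, b, q * b#}" "cmod a < R" "R < cmod (q * a)" "cmod b < R" "R < cmod (q * b)"
proof -
  note * = that
  define Y where "Y = {#y1, y2, y3, y4#}"
  have q0: "q \<noteq> 0" and nq: "cmod q = of_nat N"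
    using N by auto
  have up: "count Y y \<le> count Y (y / q)" if "R \<le> cmod y" for y
  proof -
    have "count {#q * y1, q * y2, q * y3, q * y4#} y = count Y (y / q)"
      using q0 by (simp add: Y_def field_simps)
    moreover have "count {#y \<in># Y. R \<le> cmod y#} y = count Y y"
      using that by simp
    ultimately show ?thesis
      using mset_subset_eq_count[OF big, of y] by (simp add: Y_def)
  qed
  have down: "count Y y \<le> count Y (q * y)" if "cmod y \<le> R" for y
  proof -
    have "count {#y1 / q, y2 / q, y3 / q, y4 / q#} y = count Y (q * y)"
      using q0 by (simp add: Y_def field_simps)
    moreover have "count {#y \<in># Y. cmod y \<le> R#} y = count Y y"
      using that by simp
    ultimately show ?thesis
      using mset_subset_eq_count[OF small, of y] by (simp add: Y_def)
  qed
  have up_mem: "y / q \<in># Y" if "y \<in># Y" "R \<le> cmod y" for y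
    using up[OF that(2)] that(1) by (metis count_greater_zero_iff order_less_le_trans)
  have down_mem: "q * y \<in># Y" if "y \<in># Y" "cmod y \<le> R" for y
    using down[OF that(2)] that(1) by (metis count_greater_zero_iff order_less_le_trans)
  have norm_mult_q: "cmod (q * x) = of_nat N * cmod x" for x
    by (simp add: norm_mult nq)
  have size_Y: "size Y = 4"
    by (simp add: Y_def)
  have zero: "0 \<notin># Y"
    using R by (auto simp: Y_def)
  have q_neq: "q * x \<noteq> x" "q * (q * x) \<noteq> x" "q * (q * (q * x)) \<noteq> x"
    "x \<noteq> q * x" "x \<noteq> q * (q * x)" "x \<noteq> q * (q * (q * x))" if "x \<noteq> 0" for x
  proof -
    have "cmod x < cmod (q * x)" "cmod x < cmod (q * (q * x))" "cmod x < cmod (q * (q * (q * x)))"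
    proof -
      have *: "cmod y < cmod (q * y)" if "y \<noteq> 0" for y
        using N(2) that by (simp add: norm_mult_q)
      show "cmod x < cmod (q * x)" "cmod x < cmod (q * (q * x))" "cmod x < cmod (q * (q * (q * x)))"
        using *[of x] *[of "q * x"] *[of "q * (q * x)"] \<open>x \<noteq> 0\<close> q0 by (simp_all only: mult_eq_0_iff) auto
    qed
    then show "q * x \<noteq> x" "q * (q * x) \<noteq> x" "q * (q * (q * x)) \<noteq> x"
      "x \<noteq> q * x" "x \<noteq> q * (q * x)" "x \<noteq> q * (q * (q * x))"
      by (metis less_irrefl)+
  qed
  have less_q: "cmod x < cmod (q * x)" if "x \<noteq> 0" for x
    using N(2) that by (simp add: norm_mult_q)
  \<comment> \<open>A root y on the circle brings y / q and q y with it. The product condition puts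
    the fourth root w on the circle as well, and q w can only be q y. Then y is double while y / q
    is simple.\<close>
  have neq_R: "cmod y \<noteq> R" if y: "y \<in># Y" for y
  proof
    assume yR: "cmod y = R"
    define z where "z = y / q"
    have y_def: "y = q * z"
      using q0 by (simp add: z_def)
    have z0: "z \<noteq> 0"
      using R yR by (auto simp: y_def)
    have "z \<in># Y" "q * y \<in># Y"
      using up_mem[OF y] down_mem[OF y] yR by (auto simp: z_def)
    then obtain Z where Z: "Y = add_mset y (add_mset z (add_mset (q * y) Z))"
      using y q_neq[OF z0] q0 by (elim multi_member_split3[of y Y z "q * y"]) (auto simp: y_def)
    then have "size Z = 1"
      using size_Y by (simp add: Z)
    then obtain w where w: "Y = {#y, z, q * y, w#}"
      using Z size_1_singleton_mset by blast
    have "cmod (\<Prod>y\<in>#Y. y) = R^4"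
      using R(2) by (simp add: Y_def mult.assoc)
    then have "R^3 * cmod w = R^3 * R"
      using q0 yR by (simp add: w z_def norm_mult norm_divide nq power_eq_if mult_ac)
    then have wR: "cmod w = R"
      using R(1) by simp
    then have "q * w \<in># Y"
      by (intro down_mem) (auto simp: w)
    moreover have "cmod (q * w) \<noteq> cmod w" "cmod (q * w) \<noteq> cmod y"
      using wR yR R(1) N(2) by (auto simp: norm_mult_q)
    moreover have "cmod z < cmod (q * w)"
      using less_q[OF z0] less_q[of w] wR yR R(1) y_def by fastforce
    ultimately have "w = y"
      using q0 by (auto simp: w)
    then have "count Y y = 2" "count Y z = 1"
      using q_neq[OF z0] q0 by (auto simp: w y_def)
    with up[of y] yR show False
      by (simp add: z_def)
  qed
  have "Max (cmod ` set_mset Y) \<in> cmod ` set_mset Y"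
    by (rule Max_in) (auto simp: Y_def)
  then obtain m where m: "m \<in># Y" "Max (cmod ` set_mset Y) = cmod m"
    by blast
  have max: "cmod y \<le> cmod m" if "y \<in># Y" for y
    unfolding m(2)[symmetric] using that by (intro Max_ge) auto
  have "R < cmod m"
  proof (rule ccontr)
    assume "\<not> R < cmod m"
    then have lt: "cmod y < R" if "y \<in># Y" for y
      using max[OF that] neq_R[OF that] by linarith
    have "cmod (y1 * y2) < R * R" "cmod (y3 * y4) < R * R"
      unfolding norm_mult using lt by (auto simp: Y_def intro!: mult_strict_mono R)
    then have "cmod (y1 * y2) * cmod (y3 * y4) < (R * R) * (R * R)"
      using R(1) by (intro mult_strict_mono) auto
    then show False
      using R(2) by (simp add: norm_mult mult_ac power4_eq_xxxx)
  qed
  define a where "a = m / q"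
  have m_def: "m = q * a"
    using q0 by (simp add: a_def)
  have a: "a \<in># Y"
    using up_mem[OF m(1)] \<open>R < cmod m\<close> by (simp add: a_def)
  then have a0: "a \<noteq> 0"
    using zero by auto
  from a m(1) obtain Z where Z: "Y = add_mset (q * a) (add_mset a Z)"
    using q_neq[OF a0] unfolding m_def by (elim multi_member_split2[of "q * a" Y a]) auto
  then have "size Z = 2"
    using size_Y by (simp add: Z)
  then obtain u Z' where Z': "Z = add_mset u Z'"
    by (metis multi_member_split numeral_2_eq_2 size_eq_Suc_imp_elem)
  with \<open>size Z = 2\<close> have "size Z' = 1"
    by simp
  then obtain v where "Z' = {#v#}"
    using size_1_singleton_mset by blast
  with Z Z' have uv: "Y = {#q * a, a, u, v#}"
    by simp
  have u0: "u \<noteq> 0" and v0: "v \<noteq> 0"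
    using zero by (auto simp: uv)
  note max = max[unfolded m_def] and big_m = \<open>R < cmod m\<close>[unfolded m_def]
  \<comment> \<open>The situation with \<open>a\<close> inside and another root \<open>u\<close>
    outside the circle; it serves both orders of the last two roots. The root u / q must be v, or
    else u repeats q a and multiplicity makes v repeat a.\<close>
  have two: thesis
    if uv: "Y = {#q * a, a, u, v#}" and "cmod a < R" "R < cmod u" for u v
  proof -
    have u0: "u \<noteq> 0" and v0: "v \<noteq> 0"
      using zero by (auto simp: uv)
    have ua: "u \<noteq> a"
      using that by auto
    have "u / q \<in># Y"
      using that by (intro up_mem) (auto simp: uv)
    then consider "u = q * (q * a)" | "u = q * a" | "u = q * u" | "u = q * v"
      using q0 by (auto simp: uv field_simps)
    then show thesis
    proof cases
      case 1
      have "cmod u \<le> cmod (q * a)"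
        by (rule max) (simp add: uv)
      with 1 less_q[of "q * a"] a0 q0 show thesis
        by simp
    next
      case 2
      then have "2 \<le> count Y (q * a)"
        by (simp add: uv)
      also have "\<dots> \<le> count Y a"
        using up[of "q * a"] big_m q0 by simp
      finally have "v = a"
        using ua q_neq[OF a0] by (auto simp: uv split: if_splits)
      with 2 have "Y = {#a, q * a, a, q * a#}"
        by (simp add: uv add_mset_commute)
      with that(2) big_m show thesis
        by (intro *(2)[of a a]) (auto simp: Y_def)
    next
      case 3
      with q_neq[OF u0] show thesis
        by simp
    next
      case 4
      have "cmod v < R"
      proof (rule ccontr)
        assume "\<not> cmod v < R"
        then have "v / q \<in># Y"
          by (intro up_mem) (auto simp: uv)
        moreover have "cmod (q * v) \<le> cmod (q * a)"
          using max[of u] 4 by (simp add: uv)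
        ultimately show False
          using less_q[of "q * a"] less_q[of "q * (q * a)"] less_q[of "q * v"] q0 a0 v0 q_neq[OF v0] 4
          by (auto simp: uv field_simps)
      qed
      moreover have "Y = {#a, q * a, v, q * v#}"
        by (simp add: uv 4 add_mset_commute)
      ultimately show thesis
        using that(2,3) big_m 4 by (intro *(2)[of a v]) (auto simp: Y_def)
    qed
  qed
  consider "R < cmod a" | "cmod a < R" "R < cmod u" | "cmod a < R" "R < cmod v"
    | "cmod a < R" "cmod u < R" "cmod v < R"
    using neq_R[of a] neq_R[of u] neq_R[of v] by (force simp: uv)
  then show thesis
  proof cases
    case 1
    define e where "e = a / q"
    have a_def: "a = q * e"
      using q0 by (simp add: e_def)
    have e0: "e \<noteq> 0"
      using a0 by (simp add: a_def)
    have "e \<in># Y"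
      using up_mem[OF a] 1 by (simp add: e_def)
    then have "e = u \<or> e = v"
      using q_neq[OF e0] by (auto simp: uv a_def)
    \<comment> \<open>Three consecutive terms of a string are found; the remaining root has to
      prolong it at one end, since repeating one of the three violates a multiplicity bound.\<close>
    then obtain w where Y: "Y = {#q * (q * e), q * e, e, w#}"
      by (auto simp: uv a_def add_mset_commute)
    have w0: "w \<noteq> 0"
      using zero by (auto simp: Y)
    show thesis
    proof (cases "R < cmod w")
      case True
      then have "w / q \<in># Y"
        by (intro up_mem) (auto simp: Y)
      then consider "w = q * (q * (q * e))" | "w = q * (q * e)" | "w = q * e" | "w = q * w"
        using q0 by (auto simp: Y field_simps)
      then show thesis
      proof cases
        case 1
        then have "Y = {#e, q * e, q^2 * e, q^3 * e#}"
          by (simp add: Y power2_eq_square power3_eq_cube mult.assoc add_mset_commute)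
        then show thesis
          by (intro *(1)) (simp add: Y_def)
      qed (use up[of w] True q_neq[OF e0] q_neq[OF w0] q0 in \<open>auto simp: Y\<close>)
    next
      case False
      then have "q * w \<in># Y"
        by (intro down_mem) (auto simp: Y)
      then consider "w = q * e" | "w = e" | "q * w = e" | "q * w = w"
        using q0 by (auto simp: Y)
      then show thesis
      proof cases
        case 3
        then have "Y = {#w, q * w, q^2 * w, q^3 * w#}"
          by (simp add: Y flip: 3) (simp add: power2_eq_square power3_eq_cube mult.assoc add_mset_commute)
        then show thesis
          by (intro *(1)) (simp add: Y_def)
      qed (use down[of w] False 1[unfolded a_def] q_neq[OF e0] q_neq[OF w0] q0 in \<open>auto simp: Y\<close>)
    qed
  next
    case 2
    then show thesis by (rule two[OF uv])
  next
    case 3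
    have "Y = {#q * a, a, v, u#}"
      by (simp add: uv add_mset_commute)
    from two[OF this] 3 show thesis
      by blast
  next
    case 4
    have neq: "u \<noteq> q * a" "v \<noteq> q * a"
      using 4 big_m by auto
    have mem: "q * u \<in># Y" "q * v \<in># Y"
      by (rule down_mem; use 4 in \<open>simp add: uv\<close>)+
    have "u \<noteq> a" "v \<noteq> a"
      using down[of a] 4 neq q_neq[OF a0] by (auto simp: uv split: if_splits)
    with mem have "q * u = a \<or> q * u = v" "q * v = a \<or> q * v = u"
      using q_neq(1)[of 1] u0 v0 q0 by (auto simp: uv)
    moreover have "\<not> (q * u = a \<and> q * v = a)"
      using down[of u] 4 q_neq[OF u0] q0 by (auto simp: uv)
    moreover have "\<not> (q * u = v \<and> q * v = u)"
      using q_neq[OF u0] by auto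
    \<comment> \<open>Two distinct small roots cannot both be a / q, nor can u and v be q times each
      other. What remains is a single chain through a.\<close>
    ultimately consider "a = q * u" "u = q * v" | "a = q * v" "v = q * u"
      by metis
    then show thesis
    proof cases
      case 1
      then have "Y = {#v, q * v, q^2 * v, q^3 * v#}"
        by (simp add: uv power2_eq_square power3_eq_cube mult.assoc add_mset_commute)
      then show thesis
        by (intro *(1)) (simp add: Y_def)
    next
      case 2
      then have "Y = {#u, q * u, q^2 * u, q^3 * u#}"
        by (simp add: uv power2_eq_square power3_eq_cube mult.assoc add_mset_commute)
      then show thesis
        by (intro *(1)) (simp add: Y_def)
    qed
  qed
qed

context sector_eigenfunction
begin

text \<open>The first ray controls the roots outside the circle of radius q^(3/2), and the third
  ray, read through \<open>dual\<close>, controls those inside; the second ray is consulted for the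
  double segments only.\<close>

theorem trivial_of_decay:
  defines "r \<equiv> 1 / real N powr (3 / 2)"
  assumes nz0: "\<Phi> 0 0 0 0 \<noteq> 0"
    and lim1: "(\<lambda>n. \<Phi> (int n) 0 0 0 * of_real r ^ n) \<longlonglongrightarrow> 0"
    and lim2: "(\<lambda>n. \<Phi> (int n) (int n) 0 0 * (1 / of_nat N ^ 2) ^ n) \<longlonglongrightarrow> 0"
    and lim3: "(\<lambda>n. \<Phi> (int n) (int n) (int n) 0 * of_real r ^ n) \<longlonglongrightarrow> 0"
  obtains c where "c^4 = 1" "l1 = c * (1 + q + q^2 + q^3)"
    "l2 = c^2 * (1 + q + 2 * q^2 + q^3 + q^4)" "l3 = c^3 * (1 + q + q^2 + q^3)"
proof -
  define R where "R = real N powr (3 / 2)"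
  have R: "0 < R" "r = 1 / R"
    using N_ge_2 by (simp_all add: R_def r_def)
  have R2: "R^2 = real N ^ 3"
  proof -
    have "R^2 = real N powr (real 2 * (3 / 2))"
      unfolding R_def by (subst powr_power) (use N_ge_2 in auto)
    also have "\<dots> = real N powr (real 3)"
      by simp
    also have "\<dots> = real N ^ 3"
      by (intro powr_realpow) (use N_ge_2 in simp)
    finally show ?thesis .
  qed
  obtain y1 y2 y3 y4 where "- l1 = - (y1 + y2 + y3 + y4)"
    "q * l2 = y1*y2 + y1*y3 + y1*y4 + y2*y3 + y2*y4 + y3*y4"
    "- (q^3 * l3) = - (y1*y2*y3 + y1*y2*y4 + y1*y3*y4 + y2*y3*y4)" "q^6 = y1*y2*y3*y4"
    by (rule quartic_roots)
  then have y: "l1 = y1 + y2 + y3 + y4"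
    "q * l2 = y1*y2 + y1*y3 + y1*y4 + y2*y3 + y2*y4 + y3*y4"
    "q^3 * l3 = y1*y2*y3 + y1*y2*y4 + y1*y3*y4 + y2*y3*y4" "q^6 = y1*y2*y3*y4"
    by (simp_all only: neg_equal_iff_equal)
  note q0 = of_nat_poly_neq_0(1)
  have y0: "y1 \<noteq> 0" "y2 \<noteq> 0" "y3 \<noteq> 0" "y4 \<noteq> 0"
    using y(4) q0 by auto
  define Y where "Y = {#y1, y2, y3, y4#}"
  have big: "{#y \<in># Y. R \<le> cmod y#} \<subseteq># {#q * y1, q * y2, q * y3, q * y4#}"
    using roots_on_ray[OF nz0 _ lim1 y] R by (simp add: Y_def)
  interpret dual: sector_eigenfunction N q "\<lambda>a b c d. \<Phi> (- d) (- c) (- b) (- a)" l3 l2 l1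
    by (rule dual)
  have dual_lim: "(\<lambda>n. \<Phi> (- 0) (- 0) (- 0) (- int n) * of_real r ^ n) \<longlonglongrightarrow> 0"
    using lim3 shift[of 0 "int n" 0 0 "- int n" for n] by simp
  \<comment> \<open>The roots attached to the dual eigenfunction are q^3 / y. As R^2 = q^3, this
    inversion exchanges the inside and the outside of the circle of radius R, and it turns
    multiplication by q into division by q.\<close>
  define g where "g y = q^3 / y" for y
  have q6: "q^3 * q^3 = y1*y2*y3*y4"
    using y(4) by (simp flip: power_add)
  have l1': "q^3 * l1 = g y1 * g y2 * g y3 + g y1 * g y2 * g y4 + g y1 * g y3 * g y4 + g y2 * g y3 * g y4"
    unfolding y(1) g_def using y0 q6 by (simp add: field_simps)
  have l2': "q * l2 = g y1 * g y2 + g y1 * g y3 + g y1 * g y4 + g y2 * g y3 + g y2 * g y4 + g y3 * g y4"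
    unfolding y(2) g_def using y0 q6 by (simp add: field_simps; algebra?)
  have "q^3 * l3 = q^3 * (g y1 + g y2 + g y3 + g y4)"
    unfolding y(3) g_def using y0 q6 by (simp add: field_simps; algebra?)
  then have l3': "l3 = g y1 + g y2 + g y3 + g y4"
    using q0 by simp
  have q6': "q^6 = g y1 * g y2 * g y3 * g y4"
    unfolding y(4) g_def using y0 q6 by (simp add: field_simps; algebra?)
  have "{#y \<in># {#g y1, g y2, g y3, g y4#}. 1 \<le> cmod y * r#} \<subseteq>#
      {#q * g y1, q * g y2, q * g y3, q * g y4#}"
    using dual.roots_on_ray[OF _ _ dual_lim l3' l2' l1' q6'] R nz0 by simp
  then have sub: "image_mset g {#y \<in># {#g y1, g y2, g y3, g y4#}. 1 \<le> cmod y * r#} \<subseteq>#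
      image_mset g {#q * g y1, q * g y2, q * g y3, q * g y4#}"
    by (rule image_mset_subseteq_mono)
  have gg: "g (g y) = y" "g (q * g y) = y / q" if "y \<noteq> 0" for y
    using that q0 by (simp_all add: g_def)
  have g_le: "1 \<le> cmod (g y) * r \<longleftrightarrow> cmod y \<le> R" if "y \<noteq> 0" for y
  proof -
    have "cmod (g y) * r = R^2 / (cmod y * R)"
      unfolding R2 by (simp add: g_def norm_divide norm_power q_def R)
    also have "\<dots> = R / cmod y"
      using R(1) by (simp add: power2_eq_square)
    finally show ?thesis
      using that by (simp add: le_divide_eq)
  qed
  have small: "{#y \<in># Y. cmod y \<le> R#} \<subseteq># {#y1 / q, y2 / q, y3 / q, y4 / q#}"
  proof -
    have "image_mset g {#y \<in># {#g y1, g y2, g y3, g y4#}. 1 \<le> cmod y * r#} = {#y \<in># Y. cmod y \<le> R#}"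
      using y0 by (simp add: gg g_le Y_def)
    moreover have "image_mset g {#q * g y1, q * g y2, q * g y3, q * g y4#} = {#y1 / q, y2 / q, y3 / q, y4 / q#}"
      using y0 by (simp add: gg)
    ultimately show ?thesis
      using sub by simp
  qed
  have "cmod (y1 * y2 * y3 * y4) = R^4"
  proof -
    have "cmod (y1 * y2 * y3 * y4) = (real N ^ 3)^2"
      unfolding y(4)[symmetric] by (simp add: q_def norm_power flip: power_mult)
    then show ?thesis
      by (simp flip: R2 power_mult)
  qed
  from segment_cases[OF q_def N_ge_2 R(1) this big[unfolded Y_def] small[unfolded Y_def]]
  consider c where "Y = {#c, q * c, q^2 * c, q^3 * c#}"
    | a b where "Y = {#a, q * a, b, q * b#}" "cmod a < R" "R < cmod (q * a)" "cmod b < R" "R < cmod (q * b)"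
    unfolding Y_def by metis
  moreover have D: "[:1, - l1, q * l2, - (q^3 * l3), q^6:] = (\<Prod>y\<in>#Y. lin_factor y)"
    unfolding y by (simp add: Y_def lin_factor_def algebra_simps)
  ultimately show thesis
  proof cases
    case (1 c)
    have "l1 = c + q * c + q^2 * c + q^3 * c"
      "q * l2 = c * (q * c) + c * (q^2 * c) + c * (q^3 * c) + q * c * (q^2 * c) + q * c * (q^3 * c) + q^2 * c * (q^3 * c)"
      "q^3 * l3 = c * (q * c) * (q^2 * c) + c * (q * c) * (q^3 * c) + c * (q^2 * c) * (q^3 * c) + q * c * (q^2 * c) * (q^3 * c)"
      "q^6 = c * (q * c) * (q^2 * c) * (q^3 * c)"
      using D[unfolded 1] by (simp_all add: lin_factor_def algebra_simps)
    then have "l1 = c * (1 + q + q^2 + q^3)" "q * l2 = q * (c^2 * (1 + q + 2 * q^2 + q^3 + q^4))"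
      "q^3 * l3 = q^3 * (c^3 * (1 + q + q^2 + q^3))" "q^6 * c^4 = q^6 * 1"
      by (simp_all add: algebra_simps eval_nat_numeral)
    then show thesis
      using q0 by (intro that[of c]) auto
  next
    case (2 a b)
    \<comment> \<open>The two segments play symmetric roles, so \<open>cmod b \<le> cmod a\<close>
      may be assumed, and |a| < R < |q b| bounds a / b by q. The constant term gives (a b)^2 = q^4,
      so \<open>\<epsilon>\<close> is a sign.\<close>
    have no: False if Y: "Y = {#a, q * a, b, q * b#}" and "cmod a < R" "R < cmod (q * b)" "cmod b \<le> cmod a" for a b
    proof -
      have b0: "b \<noteq> 0"
        using R that by auto
      have e: "l1 = a + q * a + b + q * b"
        "q * l2 = a * (q * a) + a * b + a * (q * b) + q * a * b + q * a * (q * b) + b * (q * b)"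
        "q^3 * l3 = a * (q * a) * b + a * (q * a) * (q * b) + a * b * (q * b) + q * a * b * (q * b)"
        "q^6 = a * (q * a) * b * (q * b)"
        using D[unfolded Y] by (simp_all add: lin_factor_def algebra_simps)
      define \<epsilon> where "\<epsilon> = a * b / q^2"
      have ab: "a * b = \<epsilon> * q^2"
        using q0 by (simp add: \<epsilon>_def)
      show False
      proof (rule no_double_segment[OF nz0, of \<epsilon> "a + b" "a / b"])
        have "q^6 * (\<epsilon> * \<epsilon>) = q^6 * 1"
          using e(4) ab by algebra
        then show "\<epsilon> * \<epsilon> = 1"
          using q0 by simp
        show "l1 = (1 + q) * (a + b)"
          unfolding e by (simp add: algebra_simps)
        have "q^3 * l3 = q^3 * (\<epsilon> * (1 + q) * (a + b))"
          using e(3) ab by algebra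
        then show "l3 = \<epsilon> * (1 + q) * (a + b)"
          using q0 by simp
        have "q * l2 = q * ((a + b)^2 + \<epsilon> * q * (1 + q^2))"
          using e(2) ab by algebra
        then show "l2 = (a + b)^2 + \<epsilon> * q * (1 + q^2)"
          using q0 by simp
        show "a / b * (a + b)^2 = \<epsilon> * q^2 * (1 + a / b)^2"
          unfolding ab[symmetric] using b0 by (simp add: field_simps power2_eq_square)
        show "1 \<le> cmod (a / b)"
          using b0 that by (simp add: norm_divide)
        show "cmod (a / b) < of_nat N"
          using b0 that by (simp add: norm_divide norm_mult q_def field_simps)
      qed (rule lim2)
    qed
    have "Y = {#b, q * b, a, q * a#}"
      by (simp add: 2(1) add_mset_commute)
    then show thesis
      using no[of a b] no[of b a] 2 by (meson le_cases)
  qed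
qed

end

subsection \<open>Power series, polynomials and matrices over them\<close>

lemma mem_power_series_ring: "f \<in> power_series_ring \<longleftrightarrow> (\<forall>n<0. f $$ n = 0)"
proof
  assume "\<forall>n<0. f $$ n = 0"
  then have "f = fps_to_fls (Abs_fps (\<lambda>n. f $$ int n))"
    by (intro fls_eqI) auto
  then show "f \<in> power_series_ring"
    unfolding power_series_ring_def by blast
qed (auto simp: power_series_ring_def)

lemma fls_nth_poly_X_inv:
  "poly (map_poly fls_const (p :: 'a::field poly)) fls_X_inv $$ n = (if 0 < n then 0 else coeff p (nat (- n)))"
proof (induction p arbitrary: n)
  case (pCons a p)
  have "poly (map_poly fls_const (pCons a p)) fls_X_inv =
      fls_const a + fls_X_inv * poly (map_poly fls_const p) fls_X_inv"
    by (simp add: map_poly_pCons)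
  moreover have "nat (- n) = Suc (nat (- (n + 1)))" if "n < 0"
    using that by auto
  ultimately show ?case
    using pCons.IH[of "n + 1"] by (auto simp: fls_X_inv_times_conv_shift)
qed simp

text \<open>Because \<open>fls_X\<close> is 1 / t, powers of t sit at non-positive exponents. A
  Laurent series has finitely many negative exponents anyway, so only the positive ones impose a
  condition.\<close>

lemma mem_polynomial_ring: "f \<in> polynomial_ring \<longleftrightarrow> (\<forall>n>0. f $$ n = 0)"
proof
  assume *: "\<forall>n>0. f $$ n = 0"
  define p where "p = Poly (map (\<lambda>k. f $$ (- int k)) [0..<Suc (nat (- fls_subdegree f))])"
  have "f $$ (- int k) = 0" if "nat (- fls_subdegree f) < k" for k
    using that by (intro fls_eq0_below_subdegree) linarith
  then have "coeff p k = f $$ (- int k)" for k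
    by (auto simp: p_def nth_default_def not_less simp del: upt_Suc)
  then have "f = poly (map_poly fls_const p) fls_X_inv"
    using * by (intro fls_eqI) (simp add: fls_nth_poly_X_inv)
  then show "f \<in> polynomial_ring"
    unfolding polynomial_ring_def by blast
qed (auto simp: polynomial_ring_def fls_nth_poly_X_inv)

text \<open>One predicate covers both F_q[t] and O, so that products, determinants and inverses of
  matrices are treated once for the two groups.\<close>

definition subring :: "'a::field fls set \<Rightarrow> bool" where
  "subring R \<longleftrightarrow> 0 \<in> R \<and> 1 \<in> R \<and> (\<forall>x\<in>R. \<forall>y\<in>R. x + y \<in> R \<and> x * y \<in> R \<and> - x \<in> R)"

lemma subringD:
  assumes "subring R"
  shows "0 \<in> R" "1 \<in> R" "x \<in> R \<Longrightarrow> y \<in> R \<Longrightarrow> x + y \<in> R" "x \<in> R \<Longrightarrow> y \<in> R \<Longrightarrow> x * y \<in> R" "x \<in> R \<Longrightarrow> - x \<in> R"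
  using assms by (auto simp: subring_def)

lemma subring_sum:
  assumes "subring R" "\<And>i. i \<in> A \<Longrightarrow> f i \<in> R"
  shows "sum f A \<in> R"
  using assms(2) by (induction A rule: infinite_finite_induct) (auto simp: subringD[OF assms(1)])

lemma subring_prod:
  assumes "subring R" "\<And>i. i \<in> A \<Longrightarrow> f i \<in> R"
  shows "prod f A \<in> R"
  using assms(2) by (induction A rule: infinite_finite_induct) (auto simp: subringD[OF assms(1)])

lemma fls_times_nth_eq0_nonneg:
  fixes f g :: "'a::field fls"
  assumes "\<forall>n<a. f $$ n = 0" "\<forall>n<b. g $$ n = 0" "n < a + b"
  shows "(f * g) $$ n = 0"
proof (cases "f = 0 \<or> g = 0")
  case False
  then have "a \<le> fls_subdegree f" "b \<le> fls_subdegree g"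
    using assms by (auto intro: fls_subdegree_geI)
  then show ?thesis
    using assms(3) by (intro fls_times_nth_eq0) linarith
qed auto

lemma subring_power_series_ring [simp, intro]: "subring (power_series_ring :: 'a::field fls set)"
proof -
  have "x * y \<in> power_series_ring" if "x \<in> power_series_ring" "y \<in> power_series_ring" for x y :: "'a fls"
    using that fls_times_nth_eq0_nonneg[of 0 x 0 y] by (auto simp: mem_power_series_ring)
  then show ?thesis
    unfolding subring_def by (auto simp: mem_power_series_ring)
qed

lemma subring_polynomial_ring [simp, intro]: "subring (polynomial_ring :: 'a::field fls set)"
proof -
  have "x * y \<in> polynomial_ring" if xy: "x \<in> polynomial_ring" "y \<in> polynomial_ring" for x y :: "'a fls"
  proof -
    obtain p q where pq: "x = poly (map_poly fls_const p) fls_X_inv" "y = poly (map_poly fls_const q) fls_X_inv"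
      using xy unfolding polynomial_ring_def by blast
    have "fls_const (\<Sum>i\<in>A. f i) = (\<Sum>i\<in>A. fls_const (f i :: 'a))" for f and A :: "nat set"
      by (induction A rule: infinite_finite_induct) (simp_all add: fls_plus_const[symmetric])
    then have "map_poly fls_const (p * q) = map_poly fls_const p * map_poly fls_const q"
      by (simp add: poly_eq_iff coeff_map_poly coeff_mult)
    then have "x * y = poly (map_poly fls_const (p * q)) fls_X_inv"
      by (simp add: pq)
    then show ?thesis
      unfolding polynomial_ring_def by blast
  qed
  then show ?thesis
    unfolding subring_def by (auto simp: mem_polynomial_ring)
qed

text \<open>The power t^n: the shift moves the coefficient 1 to exponent -n of \<open>fls_X\<close>,
  and t is the inverse of \<open>fls_X\<close>.\<close>

definition tpow :: "int \<Rightarrow> 'a::field fls" where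
  "tpow n = fls_shift n 1"

lemma tpow_0 [simp]: "tpow 0 = 1"
  by (simp add: tpow_def)

lemma tpow_mult: "tpow m * tpow n = tpow (m + n)"
  using fls_X_intpow_times_fls_X_intpow[of "- m" "- n"] by (simp add: tpow_def add.commute)

lemma tpow_neq_0 [simp]: "tpow n \<noteq> 0"
  by (simp add: tpow_def fls_shift_eq0_iff)

lemma tpow_mult_nth [simp]: "(tpow m * f) $$ n = f $$ (n + m)"
  using fls_X_intpow_times_conv_shift(1)[of "- m" f] by (simp add: tpow_def)

lemma mult_tpow_nth [simp]: "(f * tpow m) $$ n = f $$ (n + m)"
  by (subst mult.commute) simp

lemma subdegree_tpow [simp]: "fls_subdegree (tpow n) = - n"
  by (simp add: tpow_def)

lemma fls_X_conv_tpow: "fls_X = tpow (- 1)"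
  by (simp add: tpow_def fls_X_conv_shift_1)

lemma tpow_nth: "tpow m $$ n = (if n = - m then 1 else 0)"
  by (auto simp: tpow_def)

section \<open>Scalar matrices and GL(4) over a subring\<close>

lemma mat_mult_nth [simp]: "(mat c ** g) $ i $ j = c * (g $ i $ j)"
  by (simp add: matrix_matrix_mult_def mat_def if_distrib[of "\<lambda>x. x * _"] cong: if_cong)

lemma mult_mat_nth [simp]: "(g ** mat c) $ i $ j = (g $ i $ j) * (c :: 'a::field)"
  by (simp add: matrix_matrix_mult_def mat_def if_distrib cong: if_cong)

lemma mat_commute: "mat c ** g = g ** mat (c :: 'a::field)"
  by (simp add: vec_eq_iff mult.commute)

lemma mat_mult_mat: "mat c ** mat d = (mat (c * d) :: 'a::field ^ 'n ^ 'n)"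
  by (simp add: vec_eq_iff) (simp add: mat_def)

lemma mat_vector_mult: "mat c *v x = c *s (x :: 'a::field ^ 'n)"
  by (simp add: vec_eq_iff matrix_vector_mult_def mat_def if_distrib[of "\<lambda>x. x * _"] cong: if_cong)

lemma det_mat_4: "det (mat c :: 'a::field ^ 4 ^ 4) = c ^ 4"
  by (subst det_diagonal) (simp_all add: mat_def)

lemma GL4_UNIV: "g \<in> GL4 UNIV \<longleftrightarrow> invertible g"
  by (auto simp: GL4_def invertible_def)

lemma GL4_imp_invertible: "g \<in> GL4 R \<Longrightarrow> invertible g"
  by (auto simp: GL4_def invertible_def)

lemma GL4_nth: "g \<in> GL4 R \<Longrightarrow> g $ i $ j \<in> R"
  by (auto simp: GL4_def)

lemma matrix_mult_nth: "(g ** h) $ i $ j = (\<Sum>k\<in>UNIV. g $ i $ k * h $ k $ j)"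
  by (simp add: matrix_matrix_mult_def)

lemma subring_matrix_mult:
  assumes "subring R" "\<And>i j. g $ i $ j \<in> R" "\<And>i j. h $ i $ j \<in> R"
  shows "(g ** h) $ i $ j \<in> R"
  unfolding matrix_mult_nth using assms by (intro subring_sum subringD(4)) auto

lemma matrix_mult_cancel:
  fixes g h :: "'a::field ^ 'n ^ 'n"
  assumes "g ** h = mat 1"
  shows "g ** (h ** k) = k" "h ** (g ** k) = k" "k ** g ** h = k" "k ** h ** g = k" "h ** g = mat 1"
proof -
  show hg: "h ** g = mat 1"
    using assms by (simp add: matrix_left_right_inverse)
  show "g ** (h ** k) = k" "h ** (g ** k) = k"
    by (simp_all add: matrix_mul_assoc assms hg)
  show "k ** g ** h = k" "k ** h ** g = k"
    by (simp_all add: assms hg flip: matrix_mul_assoc)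
qed

lemma GL4_inverse:
  assumes "g \<in> GL4 R"
  obtains h where "h \<in> GL4 R" "g ** h = mat 1" "h ** g = mat 1"
  using assms unfolding GL4_def by blast

lemma GL4_mult:
  assumes "subring R" "g \<in> GL4 R" "h \<in> GL4 R"
  shows "g ** h \<in> GL4 R"
proof -
  obtain g' where g': "g' \<in> GL4 R" "g ** g' = mat 1" "g' ** g = mat 1"
    using assms(2) by (rule GL4_inverse)
  obtain h' where h': "h' \<in> GL4 R" "h ** h' = mat 1" "h' ** h = mat 1"
    using assms(3) by (rule GL4_inverse)
  have "g ** h ** (h' ** g') = mat 1" "h' ** g' ** (g ** h) = mat 1"
    by (metis g' h' matrix_mul_assoc matrix_mul_rid)+
  then show ?thesis
    unfolding GL4_def using subring_matrix_mult[OF assms(1)] GL4_nth assms g' h' by blast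
qed

lemma GL4_one [simp]:
  assumes "subring R"
  shows "mat 1 \<in> GL4 R"
proof -
  have "mat 1 $ i $ j \<in> R" for i j
    using subringD[OF assms] by (simp add: mat_def)
  then show ?thesis
    unfolding GL4_def using matrix_mul_lid[of "mat 1"] by blast
qed

lemma subring_det:
  assumes "subring R" "\<And>i j. g $ i $ j \<in> R"
  shows "det g \<in> R"
proof -
  have "of_int (sign p) \<in> R" for p :: "'b \<Rightarrow> 'b"
    using subringD[OF assms(1)] by (simp add: sign_def)
  then show ?thesis
    unfolding det_def using assms by (intro subring_sum subringD(4) subring_prod) auto
qed

text \<open>Cramer's rule: the entries of the inverse are determinants with entries in
  \<open>R\<close>, divided by \<open>det g\<close>, whose inverse lies in \<open>R\<close>.\<close>

lemma GL4_I_det: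
  assumes "subring R" "\<And>i j. g $ i $ j \<in> R" "d \<in> R" "det g * d = 1"
  shows "g \<in> GL4 R"
proof -
  have nz: "det g \<noteq> 0" and d: "d = inverse (det g)"
    using assms(4) by (auto simp: inverse_unique)
  then obtain h where h: "g ** h = mat 1" "h ** g = mat 1"
    using invertible_det_nz unfolding invertible_def by blast
  have "h $ k $ j \<in> R" for k j
  proof -
    have "g *v column j h = axis j 1"
      using h(1) by (simp add: vec_eq_iff matrix_matrix_mult_def matrix_vector_mult_def column_def mat_def axis_def)
    then have "h $ k $ j = det (\<chi> i l. if l = k then axis j 1 $ i else g $ i $ l) / det g"
      using cramer[OF nz] by (auto simp: column_def vec_eq_iff)
    also have "\<dots> = det (\<chi> i l. if l = k then axis j 1 $ i else g $ i $ l) * d"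
      by (simp add: d field_simps)
    also have "\<dots> \<in> R"
      using assms by (intro subringD(4) subring_det) (auto simp: axis_def subringD)
    finally show ?thesis .
  qed
  then show ?thesis
    unfolding GL4_def using assms(2) h by blast
qed

lemma GL4_det_unit:
  assumes "subring R" "g \<in> GL4 R"
  obtains d where "d \<in> R" "det g \<in> R" "det g * d = 1"
proof -
  obtain h where h: "h \<in> GL4 R" "g ** h = mat 1"
    using assms(2) by (rule GL4_inverse)
  then have "det g * det h = 1"
    using det_mul[of g h] by simp
  then show thesis
    using that subring_det[OF assms(1)] GL4_nth h(1) assms(2) by metis
qed

lemma subdegree_unit_power_series:
  assumes "c \<in> power_series_ring" "d \<in> power_series_ring" "c * d = 1"
  shows "fls_subdegree c = 0"
proof -
  have nz: "c \<noteq> 0" "d \<noteq> 0"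
    using assms(3) by auto
  then have "0 \<le> fls_subdegree c" "0 \<le> fls_subdegree d"
    using assms(1,2) by (auto simp: mem_power_series_ring intro: fls_subdegree_geI)
  moreover have "fls_subdegree c + fls_subdegree d = 0"
    using fls_subdegree_mult[OF nz] assms(3) by simp
  ultimately show ?thesis
    by linarith
qed

lemma subdegree_unit_polynomial:
  assumes "c \<in> polynomial_ring" "d \<in> polynomial_ring" "c * d = 1"
  shows "fls_subdegree c = 0"
proof -
  have nz: "c \<noteq> 0" "d \<noteq> 0"
    using assms(3) by auto
  then have "c $$ fls_subdegree c \<noteq> 0" "d $$ fls_subdegree d \<noteq> 0"
    by simp_all
  then have "fls_subdegree c \<le> 0" "fls_subdegree d \<le> 0"
    using assms(1,2) unfolding mem_polynomial_ring by (meson not_le)+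
  moreover have "fls_subdegree c + fls_subdegree d = 0"
    using fls_subdegree_mult[OF nz] assms(3) by simp
  ultimately show ?thesis
    by linarith
qed

lemma subdegree_det_GL4_power_series: "g \<in> GL4 power_series_ring \<Longrightarrow> fls_subdegree (det g) = 0"
  by (elim GL4_det_unit[OF subring_power_series_ring]) (rule subdegree_unit_power_series)

lemma subdegree_det_GL4_polynomial: "g \<in> GL4 polynomial_ring \<Longrightarrow> fls_subdegree (det g) = 0"
  by (elim GL4_det_unit[OF subring_polynomial_ring]) (rule subdegree_unit_polynomial)

subsection \<open>Lattices and vertices\<close>

lemma lattice_of_mult: "lattice_of (g ** h) = (*v) g ` lattice_of h"
  by (simp add: lattice_of_def image_image matrix_vector_mul_assoc)

lemma smult_image_lattice_of: "(*s) c ` lattice_of g = lattice_of (mat c ** g)"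
  by (simp add: lattice_of_mult mat_vector_mult)

lemma vertex_of_eq: "vertex_of g = {lattice_of (mat c ** g) | c. c \<noteq> 0}"
  by (simp add: vertex_of_def smult_image_lattice_of)

lemma lattice_of_subset_iff:
  assumes "h' ** h = mat 1"
  shows "lattice_of g \<subseteq> lattice_of h \<longleftrightarrow> (\<forall>i j. (h' ** g) $ i $ j \<in> power_series_ring)"
proof
  assume sub: "lattice_of g \<subseteq> lattice_of h"
  show "\<forall>i j. (h' ** g) $ i $ j \<in> power_series_ring"
  proof (intro allI)
    fix i j
    have "axis j 1 \<in> {x :: 'a fls ^ 4. \<forall>i. x $ i \<in> power_series_ring}"
      by (auto simp: axis_def subringD[OF subring_power_series_ring])
    then have "g *v axis j 1 \<in> lattice_of h"
      using sub unfolding lattice_of_def by blast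
    then obtain x where x: "\<forall>i. x $ i \<in> power_series_ring" "g *v axis j 1 = h *v x"
      unfolding lattice_of_def by blast
    then have "(h' ** g) *v axis j 1 = x"
      using assms by (metis matrix_vector_mul_assoc matrix_vector_mul_lid)
    then have "(h' ** g) $ i $ j = x $ i"
      by (auto simp: matrix_vector_mult_def axis_def if_distrib[of "\<lambda>x. _ * x"] cong: if_cong)
    with x show "(h' ** g) $ i $ j \<in> power_series_ring"
      by simp
  qed
next
  assume int: "\<forall>i j. (h' ** g) $ i $ j \<in> power_series_ring"
  have "g *v x \<in> lattice_of h" if "\<forall>i. x $ i \<in> power_series_ring" for x
  proof -
    have "((h' ** g) *v x) $ i \<in> power_series_ring" for i
      unfolding matrix_vector_mult_def using int that
      by (auto intro!: subring_sum subringD(4))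
    moreover have "g *v x = h *v ((h' ** g) *v x)"
      using matrix_mult_cancel(2)[OF assms] by (simp add: matrix_vector_mul_assoc)
    ultimately show ?thesis
      unfolding lattice_of_def by blast
  qed
  then show "lattice_of g \<subseteq> lattice_of h"
    unfolding lattice_of_def by blast
qed

lemma lattice_of_mult_GL4:
  assumes "k \<in> GL4 power_series_ring"
  shows "lattice_of (g ** k) = lattice_of g"
proof -
  obtain k' where k': "k' \<in> GL4 power_series_ring" "k' ** k = mat 1" "k ** k' = mat 1"
    using assms by (rule GL4_inverse)
  have "lattice_of k = lattice_of (mat 1)"
    using lattice_of_subset_iff[of "mat 1" "mat 1" k] lattice_of_subset_iff[OF k'(2), of "mat 1"]
      GL4_nth[OF assms] GL4_nth[OF k'(1)] by simp
  then show ?thesis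
    using lattice_of_mult[of g k] lattice_of_mult[of g "mat 1"] by simp
qed

lemma lattice_of_eq_imp:
  assumes "invertible g" "invertible h" "lattice_of g = lattice_of h"
  obtains k where "k \<in> GL4 power_series_ring" "g = h ** k"
proof -
  obtain g' where g': "g' ** g = mat 1" "g ** g' = mat 1"
    using assms(1) unfolding invertible_def by blast
  obtain h' where h': "h' ** h = mat 1" "h ** h' = mat 1"
    using assms(2) unfolding invertible_def by blast
  have "\<forall>i j. (h' ** g) $ i $ j \<in> power_series_ring" "\<forall>i j. (g' ** h) $ i $ j \<in> power_series_ring"
    using lattice_of_subset_iff[OF h'(1)] lattice_of_subset_iff[OF g'(1)] assms(3) by blast+
  moreover have "(h' ** g) ** (g' ** h) = mat 1" "(g' ** h) ** (h' ** g) = mat 1"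
    by (metis g' h' matrix_mul_assoc matrix_mul_rid)+
  ultimately have "h' ** g \<in> GL4 power_series_ring"
    unfolding GL4_def by blast
  moreover have "g = h ** (h' ** g)"
    using matrix_mult_cancel(1)[OF h'(2)] by simp
  ultimately show thesis
    by (rule that)
qed

lemma mat_inverse_mult: "c \<noteq> 0 \<Longrightarrow> mat c ** mat (inverse c) = (mat 1 :: 'a::field ^ 'n ^ 'n)"
  by (simp add: mat_mult_mat)

lemma invertible_mat: "c \<noteq> 0 \<Longrightarrow> invertible (mat c :: 'a::field ^ 'n ^ 'n)"
  using mat_inverse_mult unfolding invertible_right_inverse by blast

lemma vertex_of_mat_mult:
  assumes "c \<noteq> 0"
  shows "vertex_of (mat c ** g) = vertex_of g"
proof -
  have eq: "mat d ** (mat c ** g) = mat (d * c) ** g" for d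
    by (simp add: mat_mult_mat matrix_mul_assoc)
  show ?thesis
    unfolding vertex_of_eq eq
  proof (intro equalityI subsetI)
    fix L
    assume "L \<in> {lattice_of (mat (d * c) ** g) | d. d \<noteq> 0}"
    with assms show "L \<in> {lattice_of (mat d ** g) | d. d \<noteq> 0}"
      by auto
  next
    fix L
    assume "L \<in> {lattice_of (mat d ** g) | d. d \<noteq> 0}"
    then obtain d where d: "L = lattice_of (mat d ** g)" "d \<noteq> 0"
      by blast
    have "L = lattice_of (mat (d / c * c) ** g)" "d / c \<noteq> 0"
      using assms d by simp_all
    then show "L \<in> {lattice_of (mat (d * c) ** g) | d. d \<noteq> 0}"
      by blast
  qed
qed

lemma vertex_of_mult_GL4: "k \<in> GL4 power_series_ring \<Longrightarrow> vertex_of (g ** k) = vertex_of g"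
  by (simp add: vertex_of_def lattice_of_mult_GL4)

lemma lattice_of_in_vertex_of: "lattice_of g \<in> vertex_of g"
  unfolding vertex_of_eq by (auto intro!: exI[of _ 1])

lemma vertex_of_eq_imp:
  assumes "invertible g" "invertible h" "vertex_of g = vertex_of h"
  obtains c k where "c \<noteq> 0" "k \<in> GL4 power_series_ring" "g = mat c ** h ** k"
proof -
  obtain c where c: "c \<noteq> 0" "lattice_of g = lattice_of (mat c ** h)"
  proof -
    have "lattice_of g \<in> vertex_of h"
      using lattice_of_in_vertex_of[of g] by (simp only: assms(3))
    then show ?thesis
      using that by (auto simp: vertex_of_eq)
  qed
  have "invertible (mat c ** h)"
    by (rule invertible_mult[OF invertible_mat[OF c(1)] assms(2)])
  then obtain k where "k \<in> GL4 power_series_ring" "g = mat c ** h ** k"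
    using lattice_of_eq_imp[OF assms(1) _ c(2)] by blast
  with c(1) that show thesis
    by blast
qed

lemma vertices_eq: "vertices = {vertex_of g | g. invertible g}"
  by (auto simp: vertices_def GL4_UNIV)

lemma vertex_of_in_vertices: "invertible g \<Longrightarrow> vertex_of g \<in> vertices"
  by (auto simp: vertices_eq)

lemma subdegree_det_mat_mult:
  assumes "invertible g" "c \<noteq> 0" "k \<in> GL4 power_series_ring"
  shows "fls_subdegree (det (mat c ** g ** k)) = 4 * fls_subdegree c + fls_subdegree (det g)"
proof -
  have nz: "det g \<noteq> 0" "det k \<noteq> 0"
    using assms(1) GL4_imp_invertible[OF assms(3)] by (simp_all flip: invertible_det_nz)
  have "det (mat c ** g ** k) = c ^ 4 * det g * det k"
    by (simp add: det_mul det_mat_4)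
  then show ?thesis
    using nz assms(2) subdegree_det_GL4_power_series[OF assms(3)] by (simp add: fls_subdegree_pow)
qed

lemma four_mult_eq_0: "4 * (a :: 4) = 0"
proof -
  have "(4 :: 4) = 0"
    by simp
  then show ?thesis
    by (metis mult_zero_left)
qed

lemma color_vertex_of:
  assumes "invertible g"
  shows "color (vertex_of g) = of_int (- fls_subdegree (det g))"
proof -
  define h where "h = (SOME h. h \<in> GL4 UNIV \<and> vertex_of h = vertex_of g)"
  have "h \<in> GL4 UNIV \<and> vertex_of h = vertex_of g"
    unfolding h_def by (rule someI[of _ g]) (simp add: GL4_UNIV assms)
  then obtain c k where "c \<noteq> 0" "k \<in> GL4 power_series_ring" "h = mat c ** g ** k"
    using assms by (auto simp: GL4_UNIV elim: vertex_of_eq_imp)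
  then show ?thesis
    unfolding color_def h_def[symmetric] by (simp add: subdegree_det_mat_mult[OF assms] four_mult_eq_0)
qed

text \<open>The action of a single matrix. A class in \<open>Gamma\<close> acts in the same way as
  any of its members, since a vertex contains all homothetic lattices.\<close>

definition mat_act :: "'a::field matrix4 \<Rightarrow> 'a vertex \<Rightarrow> 'a vertex" where
  "mat_act g x = (`) ((*v) g) ` x"

lemma mat_act_mult: "mat_act (g ** h) x = mat_act g (mat_act h x)"
  by (simp add: mat_act_def image_image matrix_vector_mul_assoc)

lemma mat_act_1 [simp]: "mat_act (mat 1) x = x"
  by (simp add: mat_act_def)

lemma mat_act_vertex_of: "mat_act g (vertex_of h) = vertex_of (g ** h)"
proof -
  have "(*v) g ` lattice_of (mat c ** h) = lattice_of (mat c ** (g ** h))" for c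
    by (metis lattice_of_mult mat_commute matrix_mul_assoc)
  then show ?thesis
    unfolding mat_act_def vertex_of_eq by (auto simp: image_iff)
qed

lemma vertices_cases:
  assumes "x \<in> vertices"
  obtains g where "invertible g" "x = vertex_of g"
  using assms by (auto simp: vertices_eq)

lemma mat_act_in_vertices:
  assumes "invertible g" "x \<in> vertices"
  shows "mat_act g x \<in> vertices"
  using assms(2) by (rule vertices_cases) (simp add: mat_act_vertex_of vertex_of_in_vertices invertible_mult assms(1))

lemma mat_act_mat_mult: "c \<noteq> 0 \<Longrightarrow> x \<in> vertices \<Longrightarrow> mat_act (mat c ** g) x = mat_act g x"
  by (auto simp: vertices_eq mat_act_vertex_of vertex_of_mat_mult simp flip: matrix_mul_assoc)

lemma mat_act_inverse:
  assumes "g ** h = mat 1"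
  shows "mat_act g (mat_act h x) = x" "mat_act h (mat_act g x) = x"
  using assms matrix_mult_cancel(5)[OF assms] by (simp_all flip: mat_act_mult)

lemma color_mat_act:
  assumes "g \<in> GL4 polynomial_ring" "x \<in> vertices"
  shows "color (mat_act g x) = color x"
proof -
  obtain h where h: "invertible h" "x = vertex_of h"
    using assms(2) by (rule vertices_cases)
  have "det g \<noteq> 0" "det h \<noteq> 0" "invertible (g ** h)"
    using h(1) GL4_imp_invertible[OF assms(1)] by (simp_all add: invertible_mult flip: invertible_det_nz)
  then show ?thesis
    using h subdegree_det_GL4_polynomial[OF assms(1)]
    by (simp add: mat_act_vertex_of color_vertex_of det_mul)
qed

lemma smult_image_mult_image: "(*s) c ` (*v) g ` L = (*v) g ` (*s) c ` (L :: 'a::field lattice)"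
  by (simp add: image_image vector_scalar_commute)

lemma adjacent_mat_act:
  assumes "invertible g" "adjacent x y"
  shows "adjacent (mat_act g x) (mat_act g y)"
proof -
  obtain h where h: "g ** h = mat 1"
    using assms(1) unfolding invertible_def by blast
  obtain L L' where L: "L \<in> x" "L' \<in> y" "(*s) fls_X ` L \<subseteq> L'" "L' \<subseteq> L"
    using assms(2) unfolding adjacent_def by blast
  have "(*v) g ` L \<in> mat_act g x" "(*v) g ` L' \<in> mat_act g y"
    using L by (auto simp: mat_act_def)
  moreover have "(*s) fls_X ` (*v) g ` L \<subseteq> (*v) g ` L'" "(*v) g ` L' \<subseteq> (*v) g ` L"
    using L by (auto simp: smult_image_mult_image)
  moreover have "mat_act g x \<noteq> mat_act g y"
    using assms(2) mat_act_inverse(2)[OF h] unfolding adjacent_def by metis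
  moreover have "mat_act g x \<in> vertices" "mat_act g y \<in> vertices"
    using assms by (simp_all add: adjacent_def mat_act_in_vertices)
  ultimately show ?thesis
    unfolding adjacent_def by (intro conjI bexI)
qed

lemma adjacent_sym:
  assumes "adjacent x y"
  shows "adjacent y x"
proof -
  obtain L L' where L: "L \<in> x" "L' \<in> y" "(*s) fls_X ` L \<subseteq> L'" "L' \<subseteq> L"
    using assms unfolding adjacent_def by blast
  have "x \<in> vertices"
    using assms by (simp add: adjacent_def)
  then obtain g where g: "x = vertex_of g"
    by (rule vertices_cases)
  then obtain c where c: "c \<noteq> 0" "L = lattice_of (mat c ** g)"
    using L(1) by (auto simp: vertex_of_eq)
  then have "(*s) fls_X ` L = lattice_of (mat (fls_X * c) ** g)"
    by (simp add: smult_image_lattice_of matrix_mul_assoc mat_mult_mat)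
  then have "(*s) fls_X ` L \<in> x"
    using c(1) by (auto simp: g vertex_of_eq intro!: exI[of _ "fls_X * c"])
  moreover have "(*s) fls_X ` L' \<subseteq> (*s) fls_X ` L"
    using L(4) by blast
  ultimately show ?thesis
    using assms L(2,3) by (auto simp: adjacent_def)
qed

subsection \<open>The quotient by the arithmetic group\<close>

definition GL4_poly :: "'a::field matrix4 set" where
  "GL4_poly = GL4 polynomial_ring"

lemma GL4_poly_invertible: "g \<in> GL4_poly \<Longrightarrow> invertible g"
  by (simp add: GL4_poly_def GL4_imp_invertible)

lemma GL4_poly_mult: "g \<in> GL4_poly \<Longrightarrow> h \<in> GL4_poly \<Longrightarrow> g ** h \<in> GL4_poly"
  by (simp add: GL4_poly_def GL4_mult)

lemma GL4_poly_1 [simp]: "mat 1 \<in> GL4_poly"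
  by (simp add: GL4_poly_def)

lemma GL4_poly_inverse:
  assumes "g \<in> GL4_poly"
  obtains h where "h \<in> GL4_poly" "g ** h = mat 1" "h ** g = mat 1"
  using assms unfolding GL4_poly_def by (rule GL4_inverse)

definition scalar_class :: "'a::field matrix4 \<Rightarrow> 'a pgl" where
  "scalar_class g = {mat c ** g | c. c \<in> units_in polynomial_ring}"

lemma Gamma_eq: "Gamma = scalar_class ` GL4_poly"
  by (simp add: Gamma_def PGL4_def scalar_class_def GL4_poly_def)

lemma units_in_neq_0: "c \<in> units_in R \<Longrightarrow> c \<noteq> 0"
  by (auto simp: units_in_def)

lemma one_in_units: "1 \<in> units_in polynomial_ring"
  unfolding units_in_def using subringD(2)[OF subring_polynomial_ring] by force

lemma units_in_mult:
  assumes "c \<in> units_in polynomial_ring" "d \<in> units_in polynomial_ring"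
  shows "c * d \<in> units_in polynomial_ring"
proof -
  obtain c' d' where *: "c \<in> polynomial_ring" "c' \<in> polynomial_ring" "c * c' = 1"
    "d \<in> polynomial_ring" "d' \<in> polynomial_ring" "d * d' = 1"
    using assms by (auto simp: units_in_def)
  have "c * d * (c' * d') = (c * c') * (d * d')"
    by (simp add: mult_ac)
  then have "c * d * (c' * d') = 1"
    using * by simp
  then show ?thesis
    using * subringD(4)[OF subring_polynomial_ring] unfolding units_in_def by blast
qed

lemma units_in_inverse:
  assumes "c \<in> units_in polynomial_ring"
  shows "inverse c \<in> units_in polynomial_ring"
proof -
  obtain d where d: "c \<in> polynomial_ring" "d \<in> polynomial_ring" "c * d = 1"
    using assms by (auto simp: units_in_def)
  then have "inverse c = d"
    by (simp add: inverse_unique)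
  then show ?thesis
    using d by (auto simp: units_in_def mult.commute intro!: bexI[of _ c])
qed

lemma finite_units: "finite (units_in (polynomial_ring :: 'a::{field,finite} fls set))"
proof (rule finite_subset)
  show "units_in polynomial_ring \<subseteq> range (fls_const :: 'a \<Rightarrow> 'a fls)"
  proof
    fix c :: "'a fls"
    assume "c \<in> units_in polynomial_ring"
    then obtain d where c: "c \<in> polynomial_ring" "d \<in> polynomial_ring" "c * d = 1"
      by (auto simp: units_in_def)
    then have "fls_subdegree c = 0"
      by (rule subdegree_unit_polynomial)
    then have "c = fls_const (c $$ 0)"
      using c(1) by (intro fls_eqI) (auto simp: mem_polynomial_ring linorder_neq_iff)
    then show "c \<in> range fls_const"
      by blast
  qed
qed simp

definition num_units :: "'a::{field,finite} itself \<Rightarrow> nat" where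
  "num_units _ = card (units_in (polynomial_ring :: 'a fls set))"

lemma num_units_pos: "0 < num_units TYPE('a::{field,finite})"
  unfolding num_units_def card_gt_0_iff using finite_units one_in_units by blast

lemma mat_mult_GL4_poly:
  assumes "c \<in> units_in polynomial_ring" "g \<in> GL4_poly"
  shows "mat c ** g \<in> GL4_poly"
proof -
  have "mat c \<in> GL4_poly"
  proof -
    obtain d where "c \<in> polynomial_ring" "d \<in> polynomial_ring" "c * d = 1"
      using assms(1) by (auto simp: units_in_def)
    moreover from this have "mat c ** mat d = (mat 1 :: 'a matrix4)" "mat d ** mat c = (mat 1 :: 'a matrix4)"
      by (simp_all add: mat_mult_mat mult.commute)
    ultimately show ?thesis
      unfolding GL4_poly_def GL4_def using subringD(1)[OF subring_polynomial_ring]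
      by (auto intro!: exI[of _ "mat d"]) (auto simp: mat_def)
  qed
  then show ?thesis
    using assms(2) by (rule GL4_poly_mult)
qed

lemma mem_scalar_class_self: "g \<in> scalar_class g"
  unfolding scalar_class_def using one_in_units by force

lemma scalar_class_eqI:
  assumes "h \<in> scalar_class g"
  shows "scalar_class h = scalar_class g"
proof -
  have sub: "scalar_class h \<subseteq> scalar_class g" if "h \<in> scalar_class g" for g h :: "'a matrix4"
    using that by (auto simp: scalar_class_def matrix_mul_assoc mat_mult_mat intro: units_in_mult)
  obtain c where c: "c \<in> units_in polynomial_ring" "h = mat c ** g"
    using assms by (auto simp: scalar_class_def)
  then have "g = mat (inverse c) ** h"
    using units_in_neq_0[OF c(1)] by (simp add: matrix_mul_assoc mat_mult_mat)
  then have "g \<in> scalar_class h"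
    using units_in_inverse[OF c(1)] by (auto simp: scalar_class_def)
  with sub[OF assms] sub show ?thesis
    by blast
qed

lemma Gamma_eq_scalar_class:
  assumes "\<gamma> \<in> Gamma" "h \<in> \<gamma>"
  shows "\<gamma> = scalar_class h"
proof -
  obtain g where "\<gamma> = scalar_class g"
    using assms(1) unfolding Gamma_eq by (rule imageE)
  then show ?thesis
    using scalar_class_eqI[of h g] assms(2) by simp
qed

lemma card_scalar_class:
  fixes g :: "'a::{field,finite} matrix4"
  assumes "invertible g"
  shows "finite (scalar_class g)" "card (scalar_class g) = num_units TYPE('a)"
proof -
  have eq: "scalar_class g = (\<lambda>c. mat c ** g) ` units_in polynomial_ring"
    by (auto simp: scalar_class_def)
  obtain h where h: "g ** h = mat 1"
    using assms unfolding invertible_def by blast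
  have "inj_on (\<lambda>c. mat c ** g) (units_in polynomial_ring)"
  proof (rule inj_onI)
    fix c d
    assume "mat c ** g = mat d ** g"
    then have "mat c ** (g ** h) = mat d ** (g ** h)"
      by (simp add: matrix_mul_assoc)
    then have "(mat c :: 'a matrix4) $ 1 $ 1 = (mat d :: 'a matrix4) $ 1 $ 1"
      by (simp add: h)
    then show "c = d"
      by (simp add: mat_def)
  qed
  then show "finite (scalar_class g)" "card (scalar_class g) = num_units TYPE('a)"
    unfolding eq num_units_def using finite_units by (auto simp: card_image)
qed

text \<open>Every class contains \<open>num_units\<close> matrices. Counting matrices instead of
  classes thus changes all stabilizer orders by one constant factor, which cancels in quotients of
  weights.\<close>

lemma card_Union_Gamma:
  fixes C :: "'a::{field,finite} pgl set"
  assumes "C \<subseteq> Gamma"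
  shows "card (\<Union>C) = num_units TYPE('a) * card C"
proof (cases "finite C")
  case True
  have "num_units TYPE('a) * card C = card (\<Union>C)"
  proof (rule card_partition[OF True])
    show "finite (\<Union>C)"
      using True assms card_scalar_class(1) GL4_poly_invertible by (auto simp: Gamma_eq)
    show "card c = num_units TYPE('a)" if "c \<in> C" for c
      using that assms card_scalar_class(2) GL4_poly_invertible by (auto simp: Gamma_eq)
    show "c1 \<inter> c2 = {}" if c12: "c1 \<in> C" "c2 \<in> C" "c1 \<noteq> c2" for c1 c2
    proof (rule ccontr)
      assume "c1 \<inter> c2 \<noteq> {}"
      then obtain h where h: "h \<in> c1" "h \<in> c2"
        by blast
      have "c1 \<in> Gamma" "c2 \<in> Gamma"
        using c12 assms by auto
      then have "c1 = scalar_class h" "c2 = scalar_class h"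
        using Gamma_eq_scalar_class[OF _ h(1)] Gamma_eq_scalar_class[OF _ h(2)] by simp_all
      with c12 show False
        by simp
    qed
  qed
  then show ?thesis
    by simp
next
  case False
  then have "infinite (\<Union>C)"
    using finite_UnionD by blast
  with False show ?thesis
    by simp
qed

lemma act_scalar_class:
  assumes "x \<in> vertices"
  shows "act (scalar_class g) x = mat_act g x"
proof -
  have eq: "mat_act h x = mat_act g x" if "h \<in> scalar_class g" for h
  proof -
    obtain c where "h = mat c ** g" "c \<in> units_in polynomial_ring"
      using \<open>h \<in> scalar_class g\<close> by (auto simp: scalar_class_def)
    then show ?thesis
      using mat_act_mat_mult[OF units_in_neq_0 assms] by simp
  qed
  have "act (scalar_class g) x = (\<Union>h\<in>scalar_class g. mat_act h x)"
    unfolding act_def mat_act_def by blast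
  also have "\<dots> = (\<Union>h\<in>scalar_class g. mat_act g x)"
    using eq by (rule SUP_cong[OF refl])
  also have "\<dots> = mat_act g x"
    using mem_scalar_class_self by blast
  finally show ?thesis .
qed

lemma act_image_scalar_class:
  assumes "s \<subseteq> vertices"
  shows "act (scalar_class g) ` s = mat_act g ` s"
  by (intro image_cong refl act_scalar_class) (use assms in blast)

section \<open>Orbits, stabilizers and weights\<close>

definition orbit :: "'a::field vertex \<Rightarrow> 'a vertex set" where
  "orbit x = {mat_act g x | g. g \<in> GL4_poly}"

definition edge_orbit :: "'a::field edge \<Rightarrow> 'a edge set" where
  "edge_orbit s = {mat_act g ` s | g. g \<in> GL4_poly}"

definition Stab :: "'a::field vertex \<Rightarrow> 'a matrix4 set" where
  "Stab x = {g \<in> GL4_poly. mat_act g x = x}"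

lemma orbit_eq: "x \<in> vertices \<Longrightarrow> {act \<gamma> x | \<gamma>. \<gamma> \<in> Gamma} = orbit x"
proof -
  assume x: "x \<in> vertices"
  have "{act \<gamma> x | \<gamma>. \<gamma> \<in> Gamma} = (\<lambda>g. act (scalar_class g) x) ` GL4_poly"
    unfolding Gamma_eq by blast
  then show ?thesis
    by (auto simp: act_scalar_class[OF x] orbit_def)
qed

lemma edge_orbit_eq: "s \<subseteq> vertices \<Longrightarrow> {act \<gamma> ` s | \<gamma>. \<gamma> \<in> Gamma} = edge_orbit s"
proof -
  assume s: "s \<subseteq> vertices"
  have "{act \<gamma> ` s | \<gamma>. \<gamma> \<in> Gamma} = (\<lambda>g. act (scalar_class g) ` s) ` GL4_poly"
    unfolding Gamma_eq by blast
  then show ?thesis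
    by (auto simp: act_image_scalar_class[OF s] edge_orbit_def)
qed

lemma quotient_vertices_eq: "quotient_vertices = orbit ` vertices"
  unfolding quotient_vertices_def by (intro image_cong refl orbit_eq)

lemma edges_subset_vertices: "s \<in> edges \<Longrightarrow> s \<subseteq> vertices"
  by (auto simp: edges_def adjacent_def)

lemma quotient_edges_eq: "quotient_edges = edge_orbit ` edges"
  unfolding quotient_edges_def by (intro image_cong refl edge_orbit_eq edges_subset_vertices)

lemma mem_orbit_self: "x \<in> orbit x"
  unfolding orbit_def by (rule CollectI, rule exI[of _ "mat 1"]) simp

lemma orbit_mat_act:
  assumes "g \<in> GL4_poly"
  shows "orbit (mat_act g x) = orbit x"
proof -
  obtain h where h: "h \<in> GL4_poly" "h ** g = mat 1"
    using assms by (rule GL4_poly_inverse)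
  have eq: "mat_act k x = mat_act (k ** h) (mat_act g x)" "mat_act k (mat_act g x) = mat_act (k ** g) x" for k
    using mat_act_inverse(1)[OF h(2)] by (simp_all add: mat_act_mult)
  show ?thesis
  proof (intro equalityI subsetI)
    fix y
    assume "y \<in> orbit (mat_act g x)"
    then obtain k where "k \<in> GL4_poly" "y = mat_act k (mat_act g x)"
      unfolding orbit_def by blast
    then have "k ** g \<in> GL4_poly" "y = mat_act (k ** g) x"
      by (simp_all add: eq(2) GL4_poly_mult assms)
    then show "y \<in> orbit x"
      unfolding orbit_def by blast
  next
    fix y
    assume "y \<in> orbit x"
    then obtain k where "k \<in> GL4_poly" "y = mat_act k x"
      unfolding orbit_def by blast
    then have "k ** h \<in> GL4_poly" "y = mat_act (k ** h) (mat_act g x)"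
      using eq(1)[of k] by (simp_all add: GL4_poly_mult h(1))
    then show "y \<in> orbit (mat_act g x)"
      unfolding orbit_def by blast
  qed
qed

lemma edge_orbit_mat_act:
  assumes "g \<in> GL4_poly"
  shows "edge_orbit (mat_act g ` s) = edge_orbit s"
proof -
  obtain h where h: "h \<in> GL4_poly" "h ** g = mat 1"
    using assms by (rule GL4_poly_inverse)
  have eq: "mat_act k ` s = mat_act (k ** h) ` mat_act g ` s" "mat_act k ` mat_act g ` s = mat_act (k ** g) ` s" for k
    using mat_act_inverse(1)[OF h(2)] by (simp_all add: image_image mat_act_mult)
  show ?thesis
  proof (intro equalityI subsetI)
    fix t
    assume "t \<in> edge_orbit (mat_act g ` s)"
    then obtain k where "k \<in> GL4_poly" "t = mat_act k ` mat_act g ` s"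
      unfolding edge_orbit_def by blast
    then have "k ** g \<in> GL4_poly" "t = mat_act (k ** g) ` s"
      by (simp_all only: eq(2) GL4_poly_mult assms)
    then show "t \<in> edge_orbit s"
      unfolding edge_orbit_def by blast
  next
    fix t
    assume "t \<in> edge_orbit s"
    then obtain k where "k \<in> GL4_poly" "t = mat_act k ` s"
      unfolding edge_orbit_def by blast
    then have "k ** h \<in> GL4_poly" "t = mat_act (k ** h) ` mat_act g ` s"
      by (simp_all only: eq(1)[symmetric] GL4_poly_mult h(1))
    then show "t \<in> edge_orbit (mat_act g ` s)"
      unfolding edge_orbit_def by blast
  qed
qed

lemma Union_stabilizer:
  assumes "x \<in> vertices"
  shows "\<Union>{\<gamma> \<in> Gamma. act \<gamma> x = x} = Stab x"
proof (intro equalityI subsetI)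
  fix g
  assume "g \<in> \<Union>{\<gamma> \<in> Gamma. act \<gamma> x = x}"
  then obtain h where h: "h \<in> GL4_poly" "g \<in> scalar_class h" "act (scalar_class h) x = x"
    by (auto simp: Gamma_eq)
  then have "scalar_class g = scalar_class h" "g \<in> GL4_poly"
    using scalar_class_eqI[OF h(2)] mat_mult_GL4_poly[OF _ h(1)] by (auto simp: scalar_class_def)
  with h assms show "g \<in> Stab x"
    by (simp add: Stab_def flip: act_scalar_class)
next
  fix g
  assume "g \<in> Stab x"
  then have "scalar_class g \<in> {\<gamma> \<in> Gamma. act \<gamma> x = x}"
    using assms by (auto simp: Stab_def Gamma_eq act_scalar_class)
  then show "g \<in> \<Union>{\<gamma> \<in> Gamma. act \<gamma> x = x}"
    using mem_scalar_class_self[of g] by blast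
qed

lemma Union_edge_stabilizer:
  assumes "s \<subseteq> vertices"
  shows "\<Union>{\<gamma> \<in> Gamma. act \<gamma> ` s = s} = {g \<in> GL4_poly. mat_act g ` s = s}"
proof (intro equalityI subsetI)
  fix g
  assume "g \<in> \<Union>{\<gamma> \<in> Gamma. act \<gamma> ` s = s}"
  then obtain h where h: "h \<in> GL4_poly" "g \<in> scalar_class h" "act (scalar_class h) ` s = s"
    by (auto simp: Gamma_eq)
  then have "scalar_class g = scalar_class h" "g \<in> GL4_poly"
    using scalar_class_eqI[OF h(2)] mat_mult_GL4_poly[OF _ h(1)] by (auto simp: scalar_class_def)
  with h assms show "g \<in> {g \<in> GL4_poly. mat_act g ` s = s}"
    by (simp flip: act_image_scalar_class)
next
  fix g
  assume "g \<in> {g \<in> GL4_poly. mat_act g ` s = s}"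
  then have "scalar_class g \<in> {\<gamma> \<in> Gamma. act \<gamma> ` s = s}"
    using assms by (auto simp: Gamma_eq act_image_scalar_class)
  then show "g \<in> \<Union>{\<gamma> \<in> Gamma. act \<gamma> ` s = s}"
    using mem_scalar_class_self[of g] by blast
qed

lemma card_conjugate:
  assumes g: "g \<in> GL4_poly" and h: "h \<in> GL4_poly" and gh: "g ** h = mat 1"
    and AB: "\<And>k. k \<in> GL4_poly \<Longrightarrow> k \<in> A \<longleftrightarrow> g ** k ** h \<in> B" and sub: "A \<subseteq> GL4_poly" "B \<subseteq> GL4_poly"
  shows "card A = card B"
proof (rule bij_betw_same_card)
  have hg: "h ** g = mat 1"
    using matrix_mult_cancel(5)[OF gh] .
  have c1: "h ** (g ** k ** h) ** g = k" and c2: "g ** (h ** k ** g) ** h = k" for k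
    by (metis gh hg matrix_mul_assoc matrix_mul_lid matrix_mul_rid)+
  show "bij_betw (\<lambda>k. g ** k ** h) A B"
  proof (rule bij_betwI[where g = "\<lambda>k. h ** k ** g"])
    show "(\<lambda>k. g ** k ** h) \<in> A \<rightarrow> B"
      using AB sub by blast
    show "(\<lambda>k. h ** k ** g) \<in> B \<rightarrow> A"
    proof
      fix k
      assume "k \<in> B"
      then have "h ** k ** g \<in> GL4_poly" "g ** (h ** k ** g) ** h \<in> B"
        using g h sub by (auto simp: c2 intro!: GL4_poly_mult)
      then show "h ** k ** g \<in> A"
        using AB by blast
    qed
  qed (simp_all add: c1 c2)
qed

lemma card_Stab_mat_act:
  assumes "g \<in> GL4_poly"
  shows "card (Stab (mat_act g x)) = card (Stab x)"
proof -
  obtain h where h: "h \<in> GL4_poly" "g ** h = mat 1"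
    using assms by (rule GL4_poly_inverse)
  have "mat_act g a = mat_act g b \<longleftrightarrow> a = b" for a b
    using mat_act_inverse(2)[OF h(2)] by metis
  then have "k \<in> Stab x \<longleftrightarrow> g ** k ** h \<in> Stab (mat_act g x)" if "k \<in> GL4_poly" for k
    using that assms h(1) by (simp add: Stab_def mat_act_mult mat_act_inverse[OF h(2)] GL4_poly_mult)
  then show ?thesis
    using card_conjugate[OF assms h, of "Stab x" "Stab (mat_act g x)"] by (auto simp: Stab_def)
qed

lemma vertex_weight_orbit:
  fixes x :: "'a::{field,finite} vertex"
  assumes "x \<in> vertices"
  shows "vertex_weight (orbit x) = num_units TYPE('a) / card (Stab x)"
proof -
  define y where "y = (SOME y. y \<in> orbit x)"
  have "y \<in> orbit x"
    unfolding y_def using mem_orbit_self by (rule someI)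
  then obtain g where g: "g \<in> GL4_poly" "y = mat_act g x"
    by (auto simp: orbit_def)
  have y: "y \<in> vertices"
    using g assms by (simp add: mat_act_in_vertices GL4_poly_invertible)
  have "card (Stab y) = num_units TYPE('a) * card {\<gamma> \<in> Gamma. act \<gamma> y = y}"
    unfolding Union_stabilizer[OF y, symmetric] by (rule card_Union_Gamma) auto
  then have "card (Stab x) = num_units TYPE('a) * card {\<gamma> \<in> Gamma. act \<gamma> y = y}"
    using card_Stab_mat_act[OF g(1), of x] by (simp add: g(2))
  then show ?thesis
    unfolding vertex_weight_def y_def[symmetric] using num_units_pos[where 'a = 'a] by simp
qed

lemma edge_weight_edge_orbit:
  fixes s :: "'a::{field,finite} edge"
  assumes "s \<subseteq> vertices"
  shows "edge_weight (edge_orbit s) = num_units TYPE('a) / card {g \<in> GL4_poly. mat_act g ` s = s}"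
proof -
  define t where "t = (SOME t. t \<in> edge_orbit s)"
  have "mat_act (mat 1) ` s \<in> edge_orbit s"
    unfolding edge_orbit_def using GL4_poly_1 by blast
  then have "t \<in> edge_orbit s"
    unfolding t_def by (rule someI)
  then obtain g where g: "g \<in> GL4_poly" "t = mat_act g ` s"
    by (auto simp: edge_orbit_def)
  obtain h where h: "h \<in> GL4_poly" "g ** h = mat 1"
    using g(1) by (rule GL4_poly_inverse)
  have t: "t \<subseteq> vertices"
    using g assms by (auto simp: mat_act_in_vertices GL4_poly_invertible)
  have inj: "mat_act g ` a = mat_act g ` b \<longleftrightarrow> a = b" for a b
    using mat_act_inverse(2)[OF h(2)] by (intro inj_image_eq_iff) (metis injI)
  have "mat_act (g ** k ** h) ` mat_act g ` s = mat_act g ` mat_act k ` s" for k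
    using mat_act_inverse(2)[OF h(2)] by (simp add: mat_act_mult image_image)
  then have "k \<in> {k \<in> GL4_poly. mat_act k ` s = s} \<longleftrightarrow> g ** k ** h \<in> {k \<in> GL4_poly. mat_act k ` t = t}" if "k \<in> GL4_poly" for k
    using that g(1) h(1) by (simp add: g(2) GL4_poly_mult inj)
  then have "card {k \<in> GL4_poly. mat_act k ` s = s} = card {k \<in> GL4_poly. mat_act k ` t = t}"
    by (intro card_conjugate[OF g(1) h]) auto
  then have "card {g \<in> GL4_poly. mat_act g ` s = s} = num_units TYPE('a) * card {\<gamma> \<in> Gamma. act \<gamma> ` t = t}"
    unfolding Union_edge_stabilizer[OF t, symmetric] using card_Union_Gamma[of "{\<gamma> \<in> Gamma. act \<gamma> ` t = t}"]
    by simp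
  then show ?thesis
    unfolding edge_weight_def t_def[symmetric] using num_units_pos[where 'a = 'a] by simp
qed

lemma quotient_color_orbit:
  assumes "x \<in> vertices"
  shows "quotient_color (orbit x) = color x"
proof -
  have "(SOME y. y \<in> orbit x) \<in> orbit x"
    using mem_orbit_self by (rule someI)
  then obtain g where "g \<in> GL4_poly" "(SOME y. y \<in> orbit x) = mat_act g x"
    by (auto simp: orbit_def)
  then show ?thesis
    unfolding quotient_color_def using assms by (simp add: color_mat_act GL4_poly_def)
qed

text \<open>Matrices over F_q[t] preserve colors, so none of them can swap the ends of the
  edge.\<close>

lemma Stab_edge:
  assumes "x \<in> vertices" "y \<in> vertices" "color x \<noteq> color y"
  shows "{g \<in> GL4_poly. mat_act g ` {x, y} = {x, y}} = Stab x \<inter> Stab y"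
proof -
  have "mat_act g x \<noteq> y" if "g \<in> GL4_poly" for g
    using color_mat_act[of g x] that assms by (auto simp: GL4_poly_def)
  then show ?thesis
    by (auto simp: Stab_def doubleton_eq_iff)
qed

text \<open>The orbit-stabilizer theorem for \<open>Stab x\<close> acting on \<open>y\<close>: the
  fibres of the orbit map are cosets of \<open>Stab x \<inter> Stab y\<close>.\<close>

lemma card_orbit_mult_Stab:
  assumes "finite (Stab x)"
  shows "card ((\<lambda>g. mat_act g y) ` Stab x) * card (Stab x \<inter> Stab y) = card (Stab x)"
proof -
  have fib: "card {g \<in> Stab x. mat_act g y = z} = card (Stab x \<inter> Stab y)"
    if z: "z \<in> (\<lambda>g. mat_act g y) ` Stab x" for z
  proof -
    obtain g where g: "g \<in> Stab x" "z = mat_act g y"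
      using z by blast
    then have "g \<in> GL4_poly"
      by (simp add: Stab_def)
    then obtain h where h: "h \<in> GL4_poly" "g ** h = mat 1"
      by (rule GL4_poly_inverse)
    have hx: "mat_act h x = x"
      using g(1) mat_act_inverse(2)[OF h(2), of x] by (simp add: Stab_def)
    have "bij_betw (\<lambda>k. h ** k) {k \<in> Stab x. mat_act k y = z} (Stab x \<inter> Stab y)"
    proof (rule bij_betwI[where g = "\<lambda>k. g ** k"])
      show "(\<lambda>k. h ** k) \<in> {k \<in> Stab x. mat_act k y = z} \<rightarrow> Stab x \<inter> Stab y"
        using h hx g mat_act_inverse(2)[OF h(2)] by (auto simp: Stab_def mat_act_mult intro: GL4_poly_mult)
      show "(\<lambda>k. g ** k) \<in> Stab x \<inter> Stab y \<rightarrow> {k \<in> Stab x. mat_act k y = z}"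
        using g by (auto simp: Stab_def mat_act_mult intro: GL4_poly_mult)
    qed (simp_all add: matrix_mult_cancel[OF h(2)])
    then show ?thesis
      by (rule bij_betw_same_card)
  qed
  have "card (Stab x) = (\<Sum>z\<in>(\<lambda>g. mat_act g y) ` Stab x. card {g \<in> Stab x. mat_act g y = z})"
    using sum.image_gen[OF assms, of "\<lambda>_. 1 :: nat" "\<lambda>g. mat_act g y"] by simp
  also have "\<dots> = card ((\<lambda>g. mat_act g y) ` Stab x) * card (Stab x \<inter> Stab y)"
    using fib by simp
  finally show ?thesis
    by simp
qed

lemma mat_1_in_Stab: "mat 1 \<in> Stab x"
  by (simp add: Stab_def)

lemma mem_edge_orbit_self: "s \<in> edge_orbit s"
  unfolding edge_orbit_def by (rule CollectI, rule exI[of _ "mat 1"]) simp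

text \<open>The quotient of weights is |Stab x| / |Stab x \<inter> Stab y|, the number of neighbours
  of \<open>x\<close> in the \<open>Stab x\<close>-orbit of \<open>y\<close>. Grouping the
  neighbours by these orbits therefore turns the weighted sum on the quotient into the plain sum on
  the building.\<close>

lemma weighted_adj_op_orbit:
  fixes x :: "'a::{field,finite} vertex"
  assumes x: "x \<in> vertices" and fin: "finite (Stab x)" "finite N"
    and N: "N = {y. adjacent x y \<and> color y = color x + of_nat i}" and i: "(of_nat i :: 4) \<noteq> 0"
  shows "weighted_adj_op i f (orbit x) = (\<Sum>y\<in>N. f (orbit y))"
proof -
  define P where "P = {(e, v). e \<in> quotient_edges \<and> v \<in> quotient_vertices \<and> joins e (orbit x) v \<and>
    quotient_color v = quotient_color (orbit x) + of_nat i}"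
  define p where "p y = (edge_orbit {x, y}, orbit y)" for y
  have NV: "y \<in> vertices" "color x \<noteq> color y" "adjacent x y" if "y \<in> N" for y
    using that i by (auto simp: N adjacent_def)
  have N_mat_act: "mat_act g y \<in> N" if "y \<in> N" "g \<in> Stab x" for g y
    using that NV[OF that(1)] adjacent_mat_act[of g x y] color_mat_act[of g y] GL4_poly_invertible[of g]
    by (auto simp: N Stab_def GL4_poly_def)
  \<comment> \<open>A matrix carrying one edge at x to the other has to fix x, because the two ends
    of an edge have different colors.\<close>
  have fiber: "{y' \<in> N. p y' = p y} = (\<lambda>g. mat_act g y) ` Stab x" if y: "y \<in> N" for y
  proof (intro equalityI subsetI)
    fix y'
    assume "y' \<in> {y' \<in> N. p y' = p y}"
    then have y': "y' \<in> N" "edge_orbit {x, y'} = edge_orbit {x, y}"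
      by (auto simp: p_def)
    then obtain g where g: "g \<in> GL4_poly" "{x, y'} = {mat_act g x, mat_act g y}"
      using mem_edge_orbit_self[of "{x, y'}"] by (auto simp: edge_orbit_def)
    have "color (mat_act g x) = color x" "color (mat_act g y) = color y"
      using g(1) x NV[OF y] by (simp_all add: color_mat_act GL4_poly_def)
    then have "mat_act g x = x" "mat_act g y = y'"
      using g(2) NV[OF y] by (auto simp: doubleton_eq_iff)
    with g(1) show "y' \<in> (\<lambda>g. mat_act g y) ` Stab x"
      by (auto simp: Stab_def)
  next
    fix y'
    assume "y' \<in> (\<lambda>g. mat_act g y) ` Stab x"
    then obtain g where g: "g \<in> Stab x" "y' = mat_act g y"
      by blast
    then have "{x, y'} = mat_act g ` {x, y}" "g \<in> GL4_poly"
      by (auto simp: Stab_def)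
    then show "y' \<in> {y' \<in> N. p y' = p y}"
      using edge_orbit_mat_act[of g "{x, y}"] orbit_mat_act[of g y] N_mat_act[OF y g(1)] g by (simp add: p_def)
  qed
  have "p ` N = P"
  proof (intro equalityI subsetI)
    fix ev
    assume "ev \<in> p ` N"
    then obtain y where y: "y \<in> N" "ev = (edge_orbit {x, y}, orbit y)"
      by (auto simp: p_def)
    have "edge_orbit {x, y} \<in> quotient_edges"
      using NV[OF y(1)] unfolding quotient_edges_eq edges_def by blast
    moreover have "orbit y \<in> quotient_vertices"
      using NV[OF y(1)] unfolding quotient_vertices_eq by blast
    moreover have "joins (edge_orbit {x, y}) (orbit x) (orbit y)"
      unfolding joins_def using mem_orbit_self mem_edge_orbit_self by blast
    ultimately show "ev \<in> P"
      using y NV[OF y(1)] x by (simp add: P_def quotient_color_orbit) (simp add: N)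
  next
    fix ev
    assume "ev \<in> P"
    then obtain e v where ev: "ev = (e, v)" "e \<in> quotient_edges" "v \<in> quotient_vertices" "joins e (orbit x) v"
      "quotient_color v = quotient_color (orbit x) + of_nat i"
      by (auto simp: P_def)
    then obtain x' y' where xy': "x' \<in> orbit x" "y' \<in> v" "{x', y'} \<in> e"
      by (auto simp: joins_def)
    obtain y0 where y0: "y0 \<in> vertices" "v = orbit y0"
      using ev(3) by (auto simp: quotient_vertices_eq)
    obtain g where g: "g \<in> GL4_poly" "x' = mat_act g x"
      using xy'(1) by (auto simp: orbit_def)
    obtain h where h: "h \<in> GL4_poly" "g ** h = mat 1"
      using g(1) by (rule GL4_poly_inverse)
    have hx: "mat_act h x' = x"
      by (simp add: g mat_act_inverse[OF h(2)])
    define y where "y = mat_act h y'"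
    obtain k where k: "k \<in> GL4_poly" "y' = mat_act k y0"
      using xy'(2) y0 by (auto simp: orbit_def)
    have v: "orbit y = v"
      by (simp add: y_def orbit_mat_act h k y0)
    obtain x1 y1 where e: "adjacent x1 y1" "e = edge_orbit {x1, y1}"
      using ev(2) by (auto simp: quotient_edges_eq edges_def)
    obtain l where l: "l \<in> GL4_poly" "{x', y'} = mat_act l ` {x1, y1}"
      using xy'(3) e(2) by (auto simp: edge_orbit_def)
    have "mat_act h ` {x', y'} = mat_act h ` mat_act l ` {x1, y1}"
      by (simp only: l(2))
    then have xy: "{x, y} = mat_act (h ** l) ` {x1, y1}" and hl: "h ** l \<in> GL4_poly"
      using hx h l(1) by (simp_all add: y_def mat_act_mult GL4_poly_mult)
    have "adjacent (mat_act (h ** l) x1) (mat_act (h ** l) y1)"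
      using e(1) hl by (intro adjacent_mat_act GL4_poly_invertible)
    then have "adjacent x y"
      using xy adjacent_sym by (auto simp: doubleton_eq_iff)
    moreover have "edge_orbit {x, y} = e"
      unfolding xy e(2) by (rule edge_orbit_mat_act[OF hl])
    moreover have "color y = color x + of_nat i"
      using ev(5) x calculation(1) unfolding v[symmetric] adjacent_def by (simp add: quotient_color_orbit)
    ultimately have "y \<in> N" "ev = p y"
      by (simp_all add: N p_def ev v)
    then show "ev \<in> p ` N"
      by blast
  qed
  have "(\<Sum>y\<in>N. f (orbit y)) = (\<Sum>ev\<in>p ` N. \<Sum>y\<in>{y \<in> N. p y = ev}. f (orbit y))"
    using fin(2) by (rule sum.image_gen)
  also have "\<dots> = (\<Sum>(e, v)\<in>p ` N. of_real (edge_weight e / vertex_weight (orbit x)) * f v)"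
  proof (intro sum.cong refl)
    fix ev
    assume "ev \<in> p ` N"
    then obtain y where y: "y \<in> N" "ev = p y"
      by blast
    have "(\<Sum>y'\<in>{y' \<in> N. p y' = ev}. f (orbit y')) = complex_of_real (real (card {y' \<in> N. p y' = ev})) * f (orbit y)"
      by (subst sum.cong[OF refl, of _ _ "\<lambda>_. f (orbit y)"]) (auto simp: y p_def)
    also have "real (card {y' \<in> N. p y' = ev}) = edge_weight (edge_orbit {x, y}) / vertex_weight (orbit x)"
    proof -
      have ew: "edge_weight (edge_orbit {x, y}) = num_units TYPE('a) / card (Stab x \<inter> Stab y)"
        unfolding Stab_edge[OF x NV(1,2)[OF y(1)], symmetric]
        by (rule edge_weight_edge_orbit) (use x NV(1)[OF y(1)] in simp)
      have "card (Stab x) \<noteq> 0" "card (Stab x \<inter> Stab y) \<noteq> 0"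
        using fin(1) mat_1_in_Stab by (auto simp: card_eq_0_iff)
      moreover have "real (card ((\<lambda>g. mat_act g y) ` Stab x)) * real (card (Stab x \<inter> Stab y)) = real (card (Stab x))"
        using card_orbit_mult_Stab[OF fin(1), of y] by (metis of_nat_mult)
      ultimately show ?thesis
        using num_units_pos[where 'a = 'a] unfolding y(2) fiber[OF y(1)] ew vertex_weight_orbit[OF x]
        by (simp add: field_simps)
    qed
    finally show "(\<Sum>y'\<in>{y' \<in> N. p y' = ev}. f (orbit y')) =
        (case ev of (e, v) \<Rightarrow> of_real (edge_weight e / vertex_weight (orbit x)) * f v)"
      by (simp add: y(2) p_def)
  qed
  finally show ?thesis
    unfolding \<open>p ` N = P\<close> weighted_adj_op_def P_def by simp
qed

subsection \<open>Subspaces in echelon form\<close>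

text \<open>Coordinates of a Schubert cell. The pivots form \<open>S\<close>, and a vector of the
  subspace is determined by its pivot coordinates; a coordinate r outside \<open>S\<close> depends
  linearly on those at pivots s > r, with coefficients \<open>c\<close>.\<close>

definition echelon_shape :: "4 set \<Rightarrow> 'a::field ^ 4 ^ 4 \<Rightarrow> bool" where
  "echelon_shape S c \<longleftrightarrow> (\<forall>r s. c $ r $ s \<noteq> 0 \<longrightarrow> s \<in> S \<and> r \<notin> S \<and> r < s)"

definition echelon :: "4 set \<Rightarrow> 'a::field ^ 4 ^ 4 \<Rightarrow> ('a ^ 4) set" where
  "echelon S c = {v. \<forall>r. r \<notin> S \<longrightarrow> v $ r = (c *v v) $ r}"

lemma echelon_shapeD: "echelon_shape S c \<Longrightarrow> \<not> (s \<in> S \<and> r \<notin> S \<and> r < s) \<Longrightarrow> c $ r $ s = 0"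
  by (auto simp: echelon_shape_def)

lemma echelon_basis:
  fixes c :: "'a::field ^ 4 ^ 4"
  assumes "echelon_shape S c" "s \<in> S"
  defines "w \<equiv> (\<chi> r. if r = s then 1 else c $ r $ s)"
  shows "w \<in> echelon S c" "w $ s = 1" "\<And>r. s < r \<Longrightarrow> w $ r = 0" "\<And>r. r \<in> S \<Longrightarrow> r \<noteq> s \<Longrightarrow> w $ r = 0"
proof -
  show 1: "w $ s = 1"
    by (simp add: w_def)
  show 2: "w $ r = 0" if "s < r" for r
  proof -
    have "c $ r $ s = 0"
      by (rule echelon_shapeD[OF assms(1)]) (use that in \<open>auto dest: less_asym\<close>)
    then show ?thesis
      using that by (auto simp: w_def)
  qed
  show 3: "w $ r = 0" if "r \<in> S" "r \<noteq> s" for r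
    using that echelon_shapeD[OF assms(1), of s r] by (auto simp: w_def)
  have "c $ r $ k * w $ k = (if k = s then c $ r $ s else 0)" for r k
    using 1 3[of k] echelon_shapeD[OF assms(1), of k r] by (cases "k \<in> S") auto
  then have "(c *v w) $ r = c $ r $ s" for r
    by (simp add: matrix_vector_mult_def)
  then show "w \<in> echelon S c"
    using assms(2) by (auto simp: echelon_def w_def)
qed

text \<open>Recovers \<open>S\<close> from the subspace alone, as the positions at which the last
  non-zero coordinate of a vector can occur. Uniqueness of the echelon form rests on this.\<close>

lemma echelon_pivots:
  assumes "echelon_shape S c"
  shows "s \<in> S \<longleftrightarrow> (\<exists>v\<in>echelon S c. v $ s \<noteq> 0 \<and> (\<forall>r>s. v $ r = 0))"
proof
  assume "s \<in> S"
  define w where "w = (\<chi> r. if r = s then 1 else c $ r $ s)"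
  note w = echelon_basis[OF assms \<open>s \<in> S\<close>, folded w_def]
  show "\<exists>v\<in>echelon S c. v $ s \<noteq> 0 \<and> (\<forall>r>s. v $ r = 0)"
    by (rule bexI[OF _ w(1)]) (simp add: w(2,3))
next
  assume "\<exists>v\<in>echelon S c. v $ s \<noteq> 0 \<and> (\<forall>r>s. v $ r = 0)"
  then obtain v where v: "v \<in> echelon S c" "v $ s \<noteq> 0" "\<And>r. s < r \<Longrightarrow> v $ r = 0"
    by blast
  show "s \<in> S"
  proof (rule ccontr)
    assume s: "s \<notin> S"
    have "c $ s $ k * v $ k = 0" for k
      using v(3)[of k] echelon_shapeD[OF assms, of k s] by (cases "s < k") auto
    then have "(\<Sum>k\<in>UNIV. c $ s $ k * v $ k) = 0"
      by (intro sum.neutral ballI)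
    then have "(c *v v) $ s = 0"
      by (simp add: matrix_vector_mult_def)
    with v(1,2) s show False
      by (auto simp: echelon_def)
  qed
qed

lemma echelon_unique:
  assumes "echelon_shape S c" "echelon_shape S' c'" "echelon S c = echelon S' c'"
  shows "S = S'" "c = c'"
proof -
  show S: "S = S'"
    using echelon_pivots[OF assms(1)] echelon_pivots[OF assms(2)] assms(3) by blast
  have "c $ r $ s = c' $ r $ s" for r s
  proof (cases "s \<in> S \<and> r \<notin> S")
    case True
    define w where "w = (\<chi> r. if r = s then 1 else c $ r $ s)"
    note w = echelon_basis[OF assms(1) conjunct1[OF True], folded w_def]
    have "c' $ r $ k * w $ k = (if k = s then c' $ r $ s else 0)" for k
      using w(2) w(4)[of k] echelon_shapeD[OF assms(2), of k r] by (cases "k \<in> S") (auto simp: S)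
    then have "(c' *v w) $ r = c' $ r $ s"
      by (simp add: matrix_vector_mult_def)
    moreover have "w $ r = (c' *v w) $ r"
      using w(1) True unfolding assms(3) by (simp add: echelon_def S)
    moreover have "w $ r = c $ r $ s"
      using True by (auto simp: w_def)
    ultimately show ?thesis
      by simp
  next
    case False
    then show ?thesis
      using echelon_shapeD[OF assms(1), of s r] echelon_shapeD[OF assms(2), of s r] S by auto
  qed
  then show "c = c'"
    by (simp add: vec_eq_iff)
qed

lemma echelon_exists:
  fixes V :: "('a::field ^ 4) set"
  assumes zero: "0 \<in> V" and add: "\<And>v w. v \<in> V \<Longrightarrow> w \<in> V \<Longrightarrow> v + w \<in> V"
    and scale: "\<And>a v. v \<in> V \<Longrightarrow> a *s v \<in> V"
  obtains S c where "echelon_shape S c" "V = echelon S c"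
proof -
  have diff: "v - w \<in> V" if "v \<in> V" "w \<in> V" for v w
    using add[OF that(1) scale[OF that(2), of "- 1"]] by (simp add: vector_sneg_minus1[symmetric])
  have sum: "sum g A \<in> V" if "\<And>i. i \<in> A \<Longrightarrow> g i \<in> V" for g :: "4 \<Rightarrow> 'a ^ 4" and A
    using that by (induction A rule: infinite_finite_induct) (auto intro: zero add)
  define S where "S = {s. \<exists>v\<in>V. v $ s \<noteq> 0 \<and> (\<forall>r>s. v $ r = 0)}"
  have "\<exists>x\<in>V. x $ s = 1 \<and> (\<forall>r>s. x $ r = 0)" if s: "s \<in> S" for s
  proof -
    obtain v where "v \<in> V" "v $ s \<noteq> 0" "\<forall>r>s. v $ r = 0"
      using s by (auto simp: S_def)
    then show ?thesis
      by (intro bexI[of _ "inverse (v $ s) *s v"] scale) auto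
  qed
  then obtain x where x: "\<And>s. s \<in> S \<Longrightarrow> x s \<in> V" "\<And>s. s \<in> S \<Longrightarrow> x s $ s = 1"
    "\<And>s r. s \<in> S \<Longrightarrow> s < r \<Longrightarrow> x s $ r = 0"
    by metis
  \<comment> \<open>Elimination from the largest index of the initial segment \<open>D\<close>
    downwards: pivot coordinates within \<open>D\<close> can be prescribed without leaving
    \<open>D\<close>. This is what turns the vectors \<open>x s\<close> into the reduced basis
    \<open>u\<close>.\<close>
  have red: "(\<forall>r\<in>D. \<forall>r'<r. r' \<in> D) \<longrightarrow> (\<forall>v. (\<forall>r. r \<notin> D \<longrightarrow> v $ r = 0) \<longrightarrow>
      (\<exists>w\<in>V. (\<forall>r. r \<notin> D \<longrightarrow> w $ r = 0) \<and> (\<forall>s\<in>S. w $ s = v $ s)))" for D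
  proof (induction D rule: finite_linorder_max_induct[OF finite])
    case 1
    show ?case
      using zero by (intro impI allI bexI[of _ 0]) auto
  next
    case (2 b A)
    show ?case
    proof (intro impI allI)
      fix v :: "'a ^ 4"
      assume down: "\<forall>r\<in>insert b A. \<forall>r'<r. r' \<in> insert b A" and v: "\<forall>r. r \<notin> insert b A \<longrightarrow> v $ r = 0"
      have downA: "\<forall>r\<in>A. \<forall>r'<r. r' \<in> A"
        using down 2(2) by (metis insert_iff less_asym)
      have A_eq: "r \<in> insert b A" if "r \<le> b" for r
        using down that by (metis insert_iff order_le_less)
      show "\<exists>w\<in>V. (\<forall>r. r \<notin> insert b A \<longrightarrow> w $ r = 0) \<and> (\<forall>s\<in>S. w $ s = v $ s)"
      proof (cases "b \<in> S")
        case True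
        define v' where "v' = v - v $ b *s x b"
        have "v' $ r = 0" if "r \<notin> A" for r
        proof (cases "r = b")
          case False
          then have "r \<notin> insert b A"
            using that by simp
          moreover from this have "b < r"
            using A_eq[of r] by (meson not_le)
          ultimately show ?thesis
            using v x(3)[OF True] by (simp add: v'_def)
        qed (simp add: v'_def x(2)[OF True])
        then obtain w where w: "w \<in> V" "\<forall>r. r \<notin> A \<longrightarrow> w $ r = 0" "\<forall>s\<in>S. w $ s = v' $ s"
          using 2(3) downA by blast
        have "(w + v $ b *s x b) $ r = 0" if "r \<notin> insert b A" for r
        proof -
          have "b < r"
            using A_eq[of r] that by (meson not_le)
          then show ?thesis
            using w(2) x(3)[OF True] that by simp
        qed
        moreover have "w + v $ b *s x b \<in> V"
          by (intro add scale w x True)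
        moreover have "(w + v $ b *s x b) $ s = v $ s" if "s \<in> S" for s
          using w(3) that by (simp add: v'_def)
        ultimately show ?thesis
          by blast
      next
        case False
        define v' where "v' = (\<chi> r. if r = b then 0 else v $ r)"
        have "v' $ r = 0" if "r \<notin> A" for r
          using v that by (simp add: v'_def)
        then obtain w where w: "w \<in> V" "\<forall>r. r \<notin> A \<longrightarrow> w $ r = 0" "\<forall>s\<in>S. w $ s = v' $ s"
          using 2(3) downA by blast
        have "w $ s = v $ s" if "s \<in> S" for s
          using w(3) that False by (auto simp: v'_def)
        with w show ?thesis
          by blast
      qed
    qed
  qed
  have "\<exists>u\<in>V. u $ s = 1 \<and> (\<forall>s'\<in>S - {s}. u $ s' = 0) \<and> (\<forall>r>s. u $ r = 0)" if s: "s \<in> S" for s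
  proof -
    define v where "v = (\<chi> r. if r = s then 0 else x s $ r)"
    have "\<forall>r\<in>{..<s}. \<forall>r'<r. r' \<in> {..<s}"
      by auto
    moreover have "\<forall>r. r \<notin> {..<s} \<longrightarrow> v $ r = 0"
      using x(3)[OF s] by (auto simp: v_def not_less order_le_less)
    ultimately obtain w where w: "w \<in> V" "\<forall>r. r \<notin> {..<s} \<longrightarrow> w $ r = 0" "\<forall>s'\<in>S. w $ s' = v $ s'"
      using red[of "{..<s}"] by blast
    show ?thesis
      using w x[OF s] by (intro bexI[of _ "x s - w"] diff x s) (auto simp: v_def)
  qed
  then obtain u where u: "\<And>s. s \<in> S \<Longrightarrow> u s \<in> V" "\<And>s. s \<in> S \<Longrightarrow> u s $ s = 1"
    "\<And>s s'. s \<in> S \<Longrightarrow> s' \<in> S \<Longrightarrow> s' \<noteq> s \<Longrightarrow> u s $ s' = 0" "\<And>s r. s \<in> S \<Longrightarrow> s < r \<Longrightarrow> u s $ r = 0"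
    by (metis DiffI singletonD)
  define c where "c = (\<chi> r s. if s \<in> S \<and> r \<notin> S then u s $ r else 0)"
  have shape: "echelon_shape S c"
    using u(2,4) by (auto simp: echelon_shape_def c_def) (metis linorder_neqE)
  have comb: "(\<Sum>s\<in>S. v $ s *s u s) $ r = (if r \<in> S then v $ r else (c *v v) $ r)" for v r
  proof -
    have "(\<Sum>s\<in>S. v $ s *s u s) $ r = (\<Sum>s\<in>S. v $ s * u s $ r)"
      by simp
    also have "\<dots> = (if r \<in> S then v $ r else (c *v v) $ r)"
    proof (cases "r \<in> S")
      case True
      have "(\<Sum>s\<in>S. v $ s * u s $ r) = (\<Sum>s\<in>S. if s = r then v $ r else 0)"
        using u(2,3) True by (intro sum.cong) auto
      then show ?thesis
        using True by simp
    next
      case False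
      then have "(c *v v) $ r = (\<Sum>s\<in>UNIV. if s \<in> S then v $ s * u s $ r else 0)"
        unfolding matrix_vector_mult_def by (auto simp: c_def intro!: sum.cong)
      also have "\<dots> = (\<Sum>s\<in>S. v $ s * u s $ r)"
        by (simp add: sum.If_cases)
      finally show ?thesis
        using False by simp
    qed
    finally show ?thesis .
  qed
  have inV: "(\<Sum>s\<in>S. v $ s *s u s) \<in> V" for v :: "'a ^ 4"
    by (intro sum scale u)
  have "V = echelon S c"
  proof (intro equalityI subsetI)
    fix v
    assume v: "v \<in> V"
    define z where "z = v - (\<Sum>s\<in>S. v $ s *s u s)"
    have z: "z \<in> V" "\<And>s. s \<in> S \<Longrightarrow> z $ s = 0"
      using v inV comb by (auto simp: z_def intro: diff simp del: sum_component)
    \<comment> \<open>All pivot coordinates of z vanish, but the last non-zero position of a vector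
      of V is a pivot by the definition of \<open>S\<close>.\<close>
    have "z = 0"
    proof (rule ccontr)
      assume "z \<noteq> 0"
      then have ne: "{r. z $ r \<noteq> 0} \<noteq> {}"
        by (auto simp: vec_eq_iff)
      define m where "m = Max {r. z $ r \<noteq> 0}"
      have "z $ m \<noteq> 0"
        using Max_in[OF _ ne] by (simp add: m_def)
      moreover have "z $ r = 0" if "m < r" for r
      proof (rule ccontr)
        assume "z $ r \<noteq> 0"
        then have "r \<le> m"
          unfolding m_def by (intro Max_ge) auto
        with that show False
          by simp
      qed
      ultimately have "m \<in> S"
        using z(1) by (auto simp: S_def)
      with z(2) \<open>z $ m \<noteq> 0\<close> show False
        by blast
    qed
    then have "v = (\<Sum>s\<in>S. v $ s *s u s)"
      by (simp add: z_def)
    then have eq: "v $ r = (\<Sum>s\<in>S. v $ s *s u s) $ r" for r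
      by (rule arg_cong)
    show "v \<in> echelon S c"
      unfolding echelon_def
    proof (intro CollectI allI impI)
      fix r
      assume "r \<notin> S"
      with trans[OF eq comb, of r] show "v $ r = (c *v v) $ r"
        by simp
    qed
  next
    fix v
    assume "v \<in> echelon S c"
    then have "v = (\<Sum>s\<in>S. v $ s *s u s)"
      by (simp add: vec_eq_iff comb echelon_def del: sum_component)
    then show "v \<in> V"
      using inV[of v] by simp
  qed
  with shape that show thesis
    by blast
qed

lemma card_echelon_shape:
  fixes S :: "4 set"
  defines "T \<equiv> {(r, s). s \<in> S \<and> r \<notin> S \<and> r < s}"
  shows "card {c :: 'a::{field,finite} ^ 4 ^ 4. echelon_shape S c} = CARD('a) ^ card T"
proof -
  have "bij_betw (\<lambda>g. \<chi> r s. if (r, s) \<in> T then g (r, s) else 0) (PiE T (\<lambda>_. UNIV :: 'a set))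
      {c :: 'a ^ 4 ^ 4. echelon_shape S c}"
  proof (rule bij_betwI[where g = "\<lambda>c. restrict (\<lambda>(r, s). c $ r $ s) T"])
    show "(\<lambda>g. \<chi> r s. if (r, s) \<in> T then g (r, s) else 0) \<in> (PiE T (\<lambda>_. UNIV)) \<rightarrow> {c. echelon_shape S c}"
      by (auto simp: echelon_shape_def T_def split: if_splits)
    show "restrict (\<lambda>(r, s). (\<chi> r s. if (r, s) \<in> T then g (r, s) else 0) $ r $ s) T = g"
      if "g \<in> PiE T (\<lambda>_. UNIV :: 'a set)" for g
      using that by (auto simp: fun_eq_iff PiE_def extensional_def restrict_def)
    show "(\<chi> r s. if (r, s) \<in> T then restrict (\<lambda>(r, s). c $ r $ s) T (r, s) else 0) = c"
      if "c \<in> {c. echelon_shape S c}" for c :: "'a ^ 4 ^ 4"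
      using that by (auto simp: vec_eq_iff echelon_shape_def T_def)
  qed auto
  then have "card {c :: 'a ^ 4 ^ 4. echelon_shape S c} = card (PiE T (\<lambda>_. UNIV :: 'a set))"
    by (simp add: bij_betw_same_card)
  then show ?thesis
    by (simp add: card_PiE)
qed

subsection \<open>Diagonal vertices and their neighbours\<close>

definition diag_mat :: "(4 \<Rightarrow> int) \<Rightarrow> 'a::field matrix4" where
  "diag_mat a = (\<chi> i j. if i = j then tpow (a i) else 0)"

lemma diag_mat_mult_nth [simp]: "(diag_mat a ** g) $ i $ j = tpow (a i) * g $ i $ j"
  by (simp add: matrix_matrix_mult_def diag_mat_def if_distrib[of "\<lambda>x. x * _"] cong: if_cong)

lemma mult_diag_mat_nth [simp]: "(g ** diag_mat a) $ i $ j = g $ i $ j * tpow (a j)"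
  by (simp add: matrix_matrix_mult_def diag_mat_def if_distrib cong: if_cong)

lemma diag_mat_mult_vector_nth [simp]: "(diag_mat a *v x) $ i = tpow (a i) * x $ i"
  by (simp add: matrix_vector_mult_def diag_mat_def if_distrib[of "\<lambda>x. x * _"] cong: if_cong)

lemma diag_mat_nth: "diag_mat a $ i $ j = (if i = j then tpow (a i) else 0)"
  by (simp add: diag_mat_def)

lemma diag_mat_mult: "diag_mat a ** diag_mat b = diag_mat (\<lambda>i. a i + b i)"
  by (auto simp: vec_eq_iff diag_mat_nth tpow_mult)

lemma diag_mat_0: "diag_mat (\<lambda>_. 0) = mat 1"
  by (auto simp: vec_eq_iff diag_mat_nth mat_def)

lemma diag_mat_const: "diag_mat (\<lambda>_. k) = mat (tpow k)"
  by (auto simp: vec_eq_iff diag_mat_nth mat_def)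

lemma diag_mat_inverse: "diag_mat a ** diag_mat (\<lambda>i. - a i) = mat 1" "diag_mat (\<lambda>i. - a i) ** diag_mat a = mat 1"
  by (simp_all add: diag_mat_mult diag_mat_0)

lemma invertible_diag_mat: "invertible (diag_mat a)"
  unfolding invertible_def using diag_mat_inverse by blast

lemma subdegree_det_diag_mat: "fls_subdegree (det (diag_mat a :: 'a::field matrix4)) = - (\<Sum>i\<in>UNIV. a i)"
proof -
  have "det (diag_mat a :: 'a matrix4) = (\<Prod>i\<in>UNIV. tpow (a i))"
    by (subst det_diagonal) (simp_all add: diag_mat_nth)
  moreover have "fls_subdegree (\<Prod>i\<in>A. tpow (a i) :: 'a fls) = - (\<Sum>i\<in>A. a i) \<and> (\<Prod>i\<in>A. tpow (a i) :: 'a fls) \<noteq> 0" for A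
    by (induction A rule: infinite_finite_induct) auto
  ultimately show ?thesis
    by simp
qed

definition diag_vertex :: "(4 \<Rightarrow> int) \<Rightarrow> 'a::field vertex" where
  "diag_vertex a = vertex_of (diag_mat a)"

lemma diag_vertex_in_vertices [simp]: "diag_vertex a \<in> vertices"
  by (simp add: diag_vertex_def vertex_of_in_vertices invertible_diag_mat)

lemma diag_vertex_shift: "diag_vertex (\<lambda>i. a i + k) = diag_vertex a"
proof -
  have "diag_mat (\<lambda>i. a i + k) = mat (tpow k) ** (diag_mat a :: 'a matrix4)"
    by (simp add: add.commute flip: diag_mat_const) (simp add: diag_mat_mult)
  then show ?thesis
    by (simp add: diag_vertex_def vertex_of_mat_mult)
qed

definition unip_mat :: "'a::field ^ 4 ^ 4 \<Rightarrow> 'a matrix4" where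
  "unip_mat c = (\<chi> i j. (if i = j then 1 else 0) + fls_const (c $ i $ j))"

text \<open>Columns of \<open>c\<close> are supported on \<open>S\<close> and rows on its
  complement, so c^2 = 0 and 1 - c inverts 1 + c.\<close>

lemma unip_mat_inverse:
  fixes c :: "'a::field ^ 4 ^ 4"
  assumes "echelon_shape S c"
  shows "unip_mat c ** unip_mat (- c) = mat 1"
proof -
  have 0: "c $ i $ k * c $ k $ j = 0" for i j k
    using echelon_shapeD[OF assms, of k i] echelon_shapeD[OF assms, of j k] by (cases "k \<in> S") auto
  have "(unip_mat c ** unip_mat (- c)) $ i $ j = mat 1 $ i $ j" for i j
  proof -
    have "(unip_mat c ** unip_mat (- c)) $ i $ j = (\<Sum>k\<in>UNIV. (if k = i then unip_mat (- c) $ i $ j else 0) -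
        (if k = j then fls_const (c $ i $ k) * - 1 else 0))"
      unfolding matrix_mult_nth
    proof (intro sum.cong refl)
      fix k
      show "unip_mat c $ i $ k * unip_mat (- c) $ k $ j = (if k = i then unip_mat (- c) $ i $ j else 0) -
          (if k = j then fls_const (c $ i $ k) * - 1 else 0)"
        by (cases "k = i"; cases "k = j") (simp_all add: unip_mat_def algebra_simps 0)
    qed
    also have "\<dots> = unip_mat (- c) $ i $ j + fls_const (c $ i $ j)"
      by (simp add: sum_subtractf)
    also have "\<dots> = mat 1 $ i $ j"
      by (simp add: unip_mat_def mat_def)
    finally show ?thesis .
  qed
  then show ?thesis
    by (simp add: vec_eq_iff)
qed

lemma echelon_shape_uminus: "echelon_shape S (- c) \<longleftrightarrow> echelon_shape S c"
  by (simp add: echelon_shape_def)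

lemma mem_lattice_of_iff:
  assumes "h ** m = mat 1"
  shows "x \<in> lattice_of m \<longleftrightarrow> (\<forall>i. (h *v x) $ i \<in> power_series_ring)"
proof
  assume "x \<in> lattice_of m"
  then obtain y where y: "\<forall>i. y $ i \<in> power_series_ring" "x = m *v y"
    by (auto simp: lattice_of_def)
  then have "h *v x = y"
    by (simp add: matrix_vector_mul_assoc assms)
  with y show "\<forall>i. (h *v x) $ i \<in> power_series_ring"
    by simp
next
  assume "\<forall>i. (h *v x) $ i \<in> power_series_ring"
  moreover have "x = m *v (h *v x)"
    using matrix_mult_cancel(5)[OF assms] by (simp add: matrix_vector_mul_assoc)
  ultimately show "x \<in> lattice_of m"
    unfolding lattice_of_def by blast
qed

definition indic :: "4 set \<Rightarrow> 4 \<Rightarrow> int" where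
  "indic S i = (if i \<in> S then 1 else 0)"

text \<open>On t O^4, which is \<open>std_t\<close> below, this is reduction modulo O^4 with values
  in F_q^4: the coefficient of t has exponent -1 in \<open>fls_X\<close>.\<close>

definition residue :: "'a::field fls ^ 4 \<Rightarrow> 'a ^ 4" where
  "residue x = (\<chi> i. x $ i $$ (- 1))"

definition std_t :: "('a::field fls ^ 4) set" where
  "std_t = {x. \<forall>i. \<forall>n< -1. x $ i $$ n = 0}"

lemma unip_mat_mult_vector_nth: "(unip_mat c *v x) $ i = x $ i + (\<Sum>k\<in>UNIV. fls_const (c $ i $ k) * x $ k)"
proof -
  have "(unip_mat c *v x) $ i = (\<Sum>k\<in>UNIV. (if k = i then x $ i else 0) + fls_const (c $ i $ k) * x $ k)"
    unfolding matrix_vector_mult_def by (auto simp: unip_mat_def algebra_simps intro!: sum.cong)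
  then show ?thesis
    by (simp add: sum.distrib)
qed

lemma fls_sum_nth: "(\<Sum>i\<in>A. f i) $$ n = (\<Sum>i\<in>A. f i $$ n)"
  by (induction A rule: infinite_finite_induct) auto

lemma all_less_shift:
  fixes P :: "int \<Rightarrow> bool"
  shows "(\<forall>n<0. P (n - 1)) \<longleftrightarrow> (\<forall>n< -1. P n)"
proof (intro iffI allI impI)
  fix n :: int
  assume "\<forall>n<0. P (n - 1)" "n < -1"
  then have "P ((n + 1) - 1)"
    by (elim allE[of _ "n + 1"]) simp
  then show "P n"
    by simp
qed simp

text \<open>Membership is integrality after applying the inverse matrix. At a pivot this excludes
  powers above t. At another coordinate the exponent -1 gives the equation of
  \<open>echelon\<close>, and the lower exponents force vanishing.\<close>

lemma lattice_of_echelon: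
  fixes c :: "'a::field ^ 4 ^ 4"
  assumes "echelon_shape S c"
  shows "lattice_of (unip_mat c ** diag_mat (indic S)) = {x \<in> std_t. residue x \<in> echelon S c}"
proof -
  have inv: "(diag_mat (\<lambda>i. - indic S i) ** unip_mat (- c)) ** (unip_mat c ** diag_mat (indic S)) = mat 1"
  proof -
    have "unip_mat (- c) ** unip_mat c = mat 1"
      using unip_mat_inverse[of S "- c"] assms by (simp add: echelon_shape_uminus)
    then show ?thesis
      by (metis diag_mat_inverse(2) matrix_mul_assoc matrix_mul_rid)
  qed
  have comp: "((diag_mat (\<lambda>i. - indic S i) ** unip_mat (- c)) *v x) $ i $$ n =
      x $ i $$ (n - indic S i) - (\<Sum>k\<in>UNIV. c $ i $ k * x $ k $$ (n - indic S i))" for x i n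
    by (simp add: unip_mat_mult_vector_nth fls_sum_nth sum_negf flip: matrix_vector_mul_assoc)
  have row0: "(\<Sum>k\<in>UNIV. c $ i $ k * z k) = 0" if "i \<in> S" for i and z :: "4 \<Rightarrow> 'a"
    using echelon_shapeD[OF assms, of _ i] that by simp
  have "x \<in> lattice_of (unip_mat c ** diag_mat (indic S)) \<longleftrightarrow> x \<in> std_t \<and> residue x \<in> echelon S c" for x
  proof -
    have "x \<in> lattice_of (unip_mat c ** diag_mat (indic S)) \<longleftrightarrow>
        (\<forall>i. \<forall>n<0. x $ i $$ (n - indic S i) = (\<Sum>k\<in>UNIV. c $ i $ k * x $ k $$ (n - indic S i)))"
      unfolding mem_lattice_of_iff[OF inv] mem_power_series_ring comp by simp
    also have "\<dots> \<longleftrightarrow> (\<forall>i\<in>S. \<forall>n< -1. x $ i $$ n = 0) \<and>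
        (\<forall>i. i \<notin> S \<longrightarrow> (\<forall>n<0. x $ i $$ n = (\<Sum>k\<in>UNIV. c $ i $ k * x $ k $$ n)))"
    proof -
      have "(\<forall>n<0. x $ i $$ (n - 1) = 0) \<longleftrightarrow> (\<forall>n< -1. x $ i $$ n = 0)" for i
        by (rule all_less_shift)
      then show ?thesis
        by (auto simp: indic_def row0)
    qed
    also have "\<dots> \<longleftrightarrow> x \<in> std_t \<and> residue x \<in> echelon S c"
    proof -
      have van: "(\<Sum>k\<in>UNIV. c $ i $ k * x $ k $$ n) = 0" if "\<forall>k\<in>S. \<forall>n< -1. x $ k $$ n = 0" "n < -1" for i n
      proof (intro sum.neutral ballI)
        fix k
        show "c $ i $ k * x $ k $$ n = 0"
          using that echelon_shapeD[OF assms, of k i] by (cases "k \<in> S") auto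
      qed
      show ?thesis
      proof (intro iffI conjI)
        assume L: "(\<forall>i\<in>S. \<forall>n< -1. x $ i $$ n = 0) \<and>
          (\<forall>i. i \<notin> S \<longrightarrow> (\<forall>n<0. x $ i $$ n = (\<Sum>k\<in>UNIV. c $ i $ k * x $ k $$ n)))"
        have "x $ i $$ n = 0" if "n < -1" for i n
          using L van[of n i] that by (cases "i \<in> S") auto
        then show "x \<in> std_t"
          by (simp add: std_t_def)
        show "residue x \<in> echelon S c"
          using L by (simp add: echelon_def residue_def matrix_vector_mult_def)
      next
        assume R: "x \<in> std_t \<and> residue x \<in> echelon S c"
        then show z: "\<forall>i\<in>S. \<forall>n< -1. x $ i $$ n = 0"
          by (simp add: std_t_def)
        show "\<forall>i. i \<notin> S \<longrightarrow> (\<forall>n<0. x $ i $$ n = (\<Sum>k\<in>UNIV. c $ i $ k * x $ k $$ n))"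
        proof (intro allI impI)
          fix i n
          assume "i \<notin> S" "n < (0::int)"
          show "x $ i $$ n = (\<Sum>k\<in>UNIV. c $ i $ k * x $ k $$ n)"
          proof (cases "n = -1")
            case True
            then show ?thesis
              using R \<open>i \<notin> S\<close> by (simp add: echelon_def residue_def matrix_vector_mult_def)
          next
            case False
            then have "n < -1"
              using \<open>n < 0\<close> by simp
            then show ?thesis
              using R van[OF z, of n i] by (simp add: std_t_def)
          qed
        qed
      qed
    qed
    finally show ?thesis .
  qed
  then show ?thesis
    by blast
qed

lemma residue_surj:
  obtains x :: "'a::field fls ^ 4" where "x \<in> std_t" "residue x = v"
proof
  show "(\<chi> i. tpow 1 * fls_const (v $ i)) \<in> std_t" "residue (\<chi> i. tpow 1 * fls_const (v $ i)) = v"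
    by (auto simp: std_t_def residue_def vec_eq_iff tpow_nth)
qed

text \<open>Lattices between O^4 and t O^4 are the preimages of subspaces of t O^4 / O^4. The
  echelon form of the subspace supplies a matrix for the lattice.\<close>

lemma between_lattice_echelon:
  fixes m :: "'a::field matrix4"
  assumes "lattice_of (mat 1) \<subseteq> lattice_of m" "lattice_of m \<subseteq> lattice_of (mat (tpow 1))"
  obtains S and c :: "'a ^ 4 ^ 4" where "echelon_shape S c" "lattice_of m = lattice_of (unip_mat c ** diag_mat (indic S))"
proof -
  have L_eq: "x \<in> lattice_of m \<longleftrightarrow> (\<exists>y. (\<forall>i. y $ i \<in> power_series_ring) \<and> x = m *v y)" for x
    by (auto simp: lattice_of_def)
  have L_add: "x + y \<in> lattice_of m" if xy: "x \<in> lattice_of m" "y \<in> lattice_of m" for x y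
  proof -
    obtain x' y' where *: "\<forall>i. x' $ i \<in> power_series_ring" "x = m *v x'" "\<forall>i. y' $ i \<in> power_series_ring" "y = m *v y'"
      using xy unfolding L_eq by blast
    then have "x + y = m *v (x' + y')" "\<forall>i. (x' + y') $ i \<in> power_series_ring"
      using subringD(3)[OF subring_power_series_ring] by (auto simp: matrix_vector_right_distrib)
    then show ?thesis
      unfolding L_eq by blast
  qed
  have L_scale: "a *s x \<in> lattice_of m" if xa: "x \<in> lattice_of m" "a \<in> power_series_ring" for x a
  proof -
    obtain x' where *: "\<forall>i. x' $ i \<in> power_series_ring" "x = m *v x'"
      using xa(1) unfolding L_eq by blast
    then have "a *s x = m *v (a *s x')" "\<forall>i. (a *s x') $ i \<in> power_series_ring"
      using xa(2) subringD(4)[OF subring_power_series_ring] by (auto simp: vector_scalar_commute)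
    then show ?thesis
      unfolding L_eq by blast
  qed
  have std: "x \<in> lattice_of m" if "\<forall>i. x $ i \<in> power_series_ring" for x
    using that assms(1) by (auto simp: lattice_of_def)
  have std_t: "x \<in> std_t" if "x \<in> lattice_of m" for x
  proof -
    have "x \<in> lattice_of (mat (tpow 1))"
      using that assms(2) by blast
    then obtain y where y: "\<forall>i. y $ i \<in> power_series_ring" "x = tpow 1 *s y"
      by (auto simp: lattice_of_def mat_vector_mult)
    then show ?thesis
      by (auto simp: std_t_def mem_power_series_ring)
  qed
  define V where "V = residue ` lattice_of m"
  have mem: "x \<in> lattice_of m" if x: "x \<in> std_t" "residue x \<in> V" for x
  proof -
    obtain y where y: "y \<in> lattice_of m" "residue x = residue y"
      using x(2) by (auto simp: V_def)
    have "(x + (- 1) *s y) $ i \<in> power_series_ring" for i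
    proof -
      have "x $ i $$ n = y $ i $$ n" if "n < 0" for n
      proof (cases "n = -1")
        case True
        then show ?thesis
          using arg_cong[OF y(2), of "\<lambda>v. v $ i"] by (simp add: residue_def)
      next
        case False
        then show ?thesis
          using x(1) std_t[OF y(1)] that by (simp add: std_t_def)
      qed
      then show ?thesis
        by (simp add: mem_power_series_ring)
    qed
    then have "(x + (- 1) *s y) + y \<in> lattice_of m"
      by (intro L_add std y) auto
    then show ?thesis
      by (simp add: vec_eq_iff)
  qed
  have const: "fls_const a \<in> power_series_ring" for a :: 'a
    by (simp add: mem_power_series_ring)
  have res_add: "residue x + residue y = residue (x + y)" and res_scale: "a *s residue x = residue (fls_const a *s x)"
    for a and x y :: "'a fls ^ 4"
    by (simp_all add: residue_def vec_eq_iff)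
  have "0 \<in> lattice_of m"
    using std[of 0] subringD(1)[OF subring_power_series_ring] by simp
  moreover have "residue 0 = (0 :: 'a ^ 4)"
    by (simp add: residue_def vec_eq_iff)
  ultimately have "0 \<in> V"
    unfolding V_def by (metis imageI)
  then obtain S and c :: "'a ^ 4 ^ 4" where Sc: "echelon_shape S c" "V = echelon S c"
    by (rule echelon_exists[of V]) (auto simp: V_def res_add res_scale intro!: imageI L_add L_scale const)
  have "lattice_of m = lattice_of (unip_mat c ** diag_mat (indic S))"
    unfolding lattice_of_echelon[OF Sc(1)] Sc(2)[symmetric] using mem std_t by (auto simp: V_def)
  with Sc(1) that show thesis
    by blast
qed

text \<open>
  The neighbours of the vertex of \<open>t\<^sup>a\<close> correspond to the subspaces of \<open>\<F>\<^sub>q\<^sup>4\<close>, here given by their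
  pivots \<open>S\<close> and the free entries \<open>c\<close> of their echelon forms.
\<close>

definition nbr :: "(4 \<Rightarrow> int) \<Rightarrow> 4 set \<Rightarrow> 'a::field ^ 4 ^ 4 \<Rightarrow> 'a vertex" where
  "nbr a S c = vertex_of (diag_mat a ** (unip_mat c ** diag_mat (indic S)))"

lemma invertible_unip_mat: "echelon_shape S c \<Longrightarrow> invertible (unip_mat c)"
  unfolding invertible_right_inverse using unip_mat_inverse by blast

lemma unip_mat_in_GL4:
  assumes "echelon_shape S c"
  shows "unip_mat c \<in> GL4 power_series_ring"
proof -
  have "unip_mat c $ i $ j \<in> power_series_ring" for c :: "'a ^ 4 ^ 4" and i j
    by (simp add: unip_mat_def mem_power_series_ring)
  moreover have "unip_mat (- c) ** unip_mat c = mat 1"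
    using unip_mat_inverse[of S "- c"] assms by (simp add: echelon_shape_uminus)
  ultimately show ?thesis
    unfolding GL4_def using unip_mat_inverse[OF assms] by blast
qed

lemma vertex_of_lattice_cong: "lattice_of m = lattice_of m' \<Longrightarrow> vertex_of (g ** m) = vertex_of (g ** m')"
  by (simp add: vertex_of_def lattice_of_mult)

lemma color_diag_vertex: "color (diag_vertex a :: 'a::field vertex) = of_int (\<Sum>i\<in>UNIV. a i)"
  by (simp add: diag_vertex_def color_vertex_of invertible_diag_mat subdegree_det_diag_mat)

lemma sum_indic: "(\<Sum>i\<in>UNIV. indic S i) = int (card S)"
  by (simp add: indic_def sum.If_cases)

lemma nbr_in_vertices: "echelon_shape S c \<Longrightarrow> nbr a S c \<in> vertices"
  unfolding nbr_def by (intro vertex_of_in_vertices invertible_mult invertible_diag_mat invertible_unip_mat)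

lemma color_nbr:
  fixes c :: "'a::field ^ 4 ^ 4"
  assumes "echelon_shape S c"
  shows "color (nbr a S c) = color (diag_vertex a :: 'a vertex) + of_nat (card S)"
proof -
  have inv: "invertible (diag_mat a :: 'a matrix4)" "invertible (unip_mat c)" "invertible (diag_mat (indic S) :: 'a matrix4)"
    using assms by (auto intro: invertible_diag_mat invertible_unip_mat)
  then have nz: "det (diag_mat a :: 'a matrix4) \<noteq> 0" "det (unip_mat c) \<noteq> 0" "det (diag_mat (indic S) :: 'a matrix4) \<noteq> 0"
    by (simp_all add: invertible_det_nz)
  have "fls_subdegree (det (diag_mat a ** (unip_mat c ** diag_mat (indic S)))) = - (\<Sum>i\<in>UNIV. a i) - int (card S)"
    using nz subdegree_det_GL4_power_series[OF unip_mat_in_GL4[OF assms]]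
    by (simp add: det_mul subdegree_det_diag_mat sum_indic)
  moreover have "invertible (diag_mat a ** (unip_mat c ** diag_mat (indic S)))"
    using inv by (intro invertible_mult)
  ultimately show ?thesis
    by (simp add: nbr_def color_vertex_of color_diag_vertex)
qed

text \<open>Colors modulo 4 confuse only the dimensions 0 and 4 of a subspace, and neither is a
  value of \<open>i\<close>.\<close>

lemma of_nat_4_eq_iff:
  assumes "m \<le> 4" "i \<in> {1, 2, 3}"
  shows "(of_nat m :: 4) = of_nat i \<longleftrightarrow> m = i"
proof -
  have "m = 0 \<or> m = 1 \<or> m = 2 \<or> m = 3 \<or> m = 4"
    using assms(1) by linarith
  then show ?thesis
    using assms(2) by auto
qed

lemma card_4_le: "card (S :: 4 set) \<le> 4"
  using card_mono[of "UNIV :: 4 set" S] by simp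

lemma lattice_of_mat_tpow_1: "lattice_of (mat (tpow 1)) = std_t"
proof -
  have "echelon_shape UNIV 0" "echelon UNIV (0 :: 'a ^ 4 ^ 4) = UNIV"
    by (auto simp: echelon_shape_def echelon_def)
  moreover have "unip_mat 0 ** diag_mat (indic UNIV) = (mat (tpow 1) :: 'a matrix4)"
    by (auto simp: vec_eq_iff unip_mat_def indic_def mat_def)
  ultimately show ?thesis
    using lattice_of_echelon[of UNIV "0 :: 'a ^ 4 ^ 4"] by simp
qed

lemma lattice_of_1_subset:
  fixes c :: "'a::field ^ 4 ^ 4"
  assumes "echelon_shape S c"
  shows "lattice_of (mat 1) \<subseteq> lattice_of (unip_mat c ** diag_mat (indic S))"
proof
  fix x :: "'a fls ^ 4"
  assume "x \<in> lattice_of (mat 1)"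
  then have x: "\<forall>i. x $ i \<in> power_series_ring"
    by (auto simp: lattice_of_def)
  then have "residue x = 0" "x \<in> std_t"
    by (auto simp: residue_def vec_eq_iff std_t_def mem_power_series_ring)
  then show "x \<in> lattice_of (unip_mat c ** diag_mat (indic S))"
    unfolding lattice_of_echelon[OF assms] by (auto simp: echelon_def)
qed

lemma mat_X_tpow: "mat fls_X ** (mat (tpow 1) ** g) = (g :: 'a::field matrix4)"
proof -
  have "mat fls_X ** mat (tpow 1) = (mat 1 :: 'a matrix4)"
    by (simp add: mat_mult_mat fls_X_conv_tpow tpow_mult)
  then show ?thesis
    by (simp add: matrix_mul_assoc)
qed

lemma adjacent_nbr:
  fixes c :: "'a::field ^ 4 ^ 4"
  assumes "echelon_shape S c" "card S \<in> {1, 2, 3}"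
  shows "adjacent (diag_vertex a) (nbr a S c)"
proof -
  let ?L = "lattice_of (mat (tpow 1) ** diag_mat a) :: 'a lattice"
  let ?m = "unip_mat c ** diag_mat (indic S)"
  let ?L' = "lattice_of (diag_mat a ** ?m)"
  have "?L \<in> diag_vertex a" "?L' \<in> nbr a S c"
    using lattice_of_in_vertex_of[of "mat (tpow 1) ** diag_mat a :: 'a matrix4"] lattice_of_in_vertex_of
    by (auto simp: diag_vertex_def nbr_def vertex_of_mat_mult)
  moreover have "?L' \<subseteq> ?L"
  proof -
    have "lattice_of ?m \<subseteq> lattice_of (mat (tpow 1))"
      unfolding lattice_of_mat_tpow_1 lattice_of_echelon[OF assms(1)] by blast
    then show ?thesis
      unfolding mat_commute[of "tpow 1"] lattice_of_mult[of "diag_mat a"] by (rule image_mono)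
  qed
  moreover have "(*s) fls_X ` ?L \<subseteq> ?L'"
  proof -
    have "(*s) fls_X ` ?L = lattice_of (diag_mat a ** mat 1)"
      unfolding smult_image_lattice_of mat_X_tpow by simp
    then show ?thesis
      unfolding lattice_of_mult[of "diag_mat a"] using lattice_of_1_subset[OF assms(1)] by auto
  qed
  moreover have "diag_vertex a \<noteq> nbr a S c"
  proof
    assume "diag_vertex a = nbr a S c"
    then have "(of_nat (card S) :: 4) = 0"
      using color_nbr[OF assms(1), of a] by simp
    with assms(2) show False
      by auto
  qed
  ultimately show ?thesis
    unfolding adjacent_def using nbr_in_vertices[OF assms(1)] diag_vertex_in_vertices by blast
qed

lemma adjacent_diag_vertex_imp_nbr:
  fixes y :: "'a::field vertex"
  assumes "adjacent (diag_vertex a) y"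
  obtains S and c :: "'a ^ 4 ^ 4" where "echelon_shape S c" "y = nbr a S c"
proof -
  obtain L L' where L: "L \<in> diag_vertex a" "L' \<in> y" "(*s) fls_X ` L \<subseteq> L'" "L' \<subseteq> L"
    using assms unfolding adjacent_def by blast
  have "y \<in> vertices"
    using assms by (simp add: adjacent_def)
  then obtain h where h: "invertible h" "y = vertex_of h"
    by (rule vertices_cases)
  obtain \<alpha> where \<alpha>: "\<alpha> \<noteq> 0" "L = lattice_of (mat \<alpha> ** diag_mat a)"
    using L(1) by (auto simp: diag_vertex_def vertex_of_eq)
  obtain \<beta> where \<beta>: "\<beta> \<noteq> 0" "L' = lattice_of (mat \<beta> ** h)"
    using L(2) by (auto simp: h vertex_of_eq)
  \<comment> \<open>The scalar is chosen so that \<open>k\<close> carries the larger lattice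
    \<open>L\<close> to t O^4. Then \<pi> L goes to O^4, and \<open>L'\<close> to a lattice between
    the two.\<close>
  define \<gamma> where "\<gamma> = tpow 1 * inverse \<alpha>"
  have \<gamma>: "\<gamma> \<noteq> 0" "\<gamma> * \<alpha> = tpow 1"
    using \<alpha>(1) by (simp_all add: \<gamma>_def)
  define k :: "'a matrix4" where "k = diag_mat (\<lambda>i. - a i) ** mat \<gamma>"
  define m where "m = k ** (mat \<beta> ** h)"
  have k\<alpha>: "k ** (mat \<alpha> ** diag_mat a) = mat (tpow 1)"
  proof -
    have "k ** (mat \<alpha> ** diag_mat a) = diag_mat (\<lambda>i. - a i) ** (mat \<gamma> ** mat \<alpha>) ** diag_mat a"
      by (simp add: k_def matrix_mul_assoc)
    also have "mat \<gamma> ** mat \<alpha> = (mat (tpow 1) :: 'a matrix4)"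
      by (simp add: mat_mult_mat \<gamma>)
    also have "diag_mat (\<lambda>i. - a i) ** mat (tpow 1) ** diag_mat a = mat (tpow 1) ** diag_mat (\<lambda>i. - a i) ** diag_mat a"
      by (simp only: mat_commute[of "tpow 1" "diag_mat (\<lambda>i. - a i)"])
    also have "\<dots> = mat (tpow 1) ** (diag_mat (\<lambda>i. - a i) ** diag_mat a)"
      by (simp only: matrix_mul_assoc)
    finally show ?thesis
      by (simp add: diag_mat_inverse)
  qed
  have m: "lattice_of m = (*v) k ` L'" "lattice_of (mat (tpow 1)) = (*v) k ` L"
    by (simp_all add: m_def \<alpha>(2) \<beta>(2) k\<alpha> flip: lattice_of_mult)
  have "lattice_of (mat 1) = (*s) fls_X ` lattice_of (mat (tpow 1) :: 'a matrix4)"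
    using mat_X_tpow[of "mat 1 :: 'a matrix4"] by (simp add: smult_image_lattice_of)
  also have "\<dots> = (*v) k ` (*s) fls_X ` L"
    by (simp add: m(2) smult_image_mult_image)
  also have "\<dots> \<subseteq> lattice_of m"
    unfolding m(1) using L(3) by (rule image_mono)
  finally have "lattice_of (mat 1) \<subseteq> lattice_of m" .
  moreover have "lattice_of m \<subseteq> lattice_of (mat (tpow 1))"
    unfolding m using L(4) by (rule image_mono)
  ultimately obtain S and c :: "'a ^ 4 ^ 4" where Sc: "echelon_shape S c" "lattice_of m = lattice_of (unip_mat c ** diag_mat (indic S))"
    by (rule between_lattice_echelon)
  have "diag_mat a ** m = mat (\<gamma> * \<beta>) ** h"
    by (simp add: m_def k_def matrix_mul_assoc diag_mat_inverse mat_mult_mat)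
  then have "y = vertex_of (diag_mat a ** m)"
    using \<beta>(1) \<gamma>(1) by (simp add: h vertex_of_mat_mult)
  then have "y = nbr a S c"
    unfolding nbr_def using vertex_of_lattice_cong[OF Sc(2)] by simp
  with Sc(1) that show thesis
    by blast
qed

text \<open>Equal cardinalities give determinants of equal valuation, so the scalar relating the two
  matrices is a unit of O. The lattices themselves agree then, not just their classes, and with them
  the residue subspaces.\<close>

lemma nbr_inj:
  fixes c c' :: "'a::field ^ 4 ^ 4"
  assumes "echelon_shape S c" "echelon_shape S' c'" "card S = card S'" "nbr a S c = nbr a S' c'"
  shows "S = S' \<and> c = c'"
proof -
  let ?m = "unip_mat c ** diag_mat (indic S)" and ?m' = "unip_mat c' ** diag_mat (indic S')"
  have inv: "invertible ?m" "invertible ?m'"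
    using assms by (auto intro!: invertible_mult invertible_diag_mat invertible_unip_mat)
  have eq: "vertex_of g = mat_act (diag_mat (\<lambda>i. - a i)) (vertex_of (diag_mat a ** g))" for g :: "'a matrix4"
    by (simp add: mat_act_vertex_of matrix_mul_assoc diag_mat_inverse)
  have "vertex_of ?m = vertex_of ?m'"
    using assms(4) eq[of ?m] eq[of ?m'] by (simp add: nbr_def)
  then obtain \<gamma> k where \<gamma>: "\<gamma> \<noteq> 0" "k \<in> GL4 power_series_ring" "?m = mat \<gamma> ** ?m' ** k"
    by (rule vertex_of_eq_imp[OF inv])
  have sd: "fls_subdegree (det (unip_mat c ** diag_mat (indic S))) = - int (card S)" if "echelon_shape S c" for S and c :: "'a ^ 4 ^ 4"
  proof -
    have "det (unip_mat c) \<noteq> 0" "det (diag_mat (indic S) :: 'a matrix4) \<noteq> 0"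
      using invertible_unip_mat[OF that] invertible_diag_mat by (auto simp: invertible_det_nz)
    then show ?thesis
      using subdegree_det_GL4_power_series[OF unip_mat_in_GL4[OF that]] by (simp add: det_mul subdegree_det_diag_mat sum_indic)
  qed
  have "fls_subdegree (det ?m) = 4 * fls_subdegree \<gamma> + fls_subdegree (det ?m')"
    unfolding \<gamma>(3) by (rule subdegree_det_mat_mult[OF inv(2) \<gamma>(1,2)])
  then have "fls_subdegree \<gamma> = 0"
    using sd[OF assms(1)] sd[OF assms(2)] assms(3) by simp
  then have "\<gamma> \<in> power_series_ring" "inverse \<gamma> \<in> power_series_ring"
    unfolding mem_power_series_ring by (auto intro!: fls_eq0_below_subdegree simp: fls_inverse_subdegree)
  then have "inverse \<gamma> ^ 4 \<in> power_series_ring"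
    unfolding power4_eq_xxxx by (intro subringD(4)[OF subring_power_series_ring])
  moreover have "(mat \<gamma> :: 'a matrix4) $ i $ j \<in> power_series_ring" for i j
    using \<open>\<gamma> \<in> power_series_ring\<close> by (simp add: mat_def mem_power_series_ring)
  moreover have "det (mat \<gamma> :: 'a matrix4) * inverse \<gamma> ^ 4 = 1"
    using \<gamma>(1) unfolding det_mat_4 by (simp flip: power_mult_distrib)
  ultimately have "mat \<gamma> \<in> GL4 power_series_ring"
    by (intro GL4_I_det) auto
  then have "lattice_of (?m' ** mat \<gamma>) = lattice_of ?m'"
    by (rule lattice_of_mult_GL4)
  then have "lattice_of ?m = lattice_of ?m'"
    unfolding \<gamma>(3) lattice_of_mult_GL4[OF \<gamma>(2)] mat_commute[of \<gamma>] .
  then have *: "{x \<in> std_t. residue x \<in> echelon S c} = {x \<in> std_t. residue x \<in> echelon S' c'}"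
    unfolding lattice_of_echelon[OF assms(1)] lattice_of_echelon[OF assms(2)] .
  have "v \<in> echelon S c \<longleftrightarrow> v \<in> echelon S' c'" for v
  proof -
    obtain x where "x \<in> std_t" "residue x = v"
      by (rule residue_surj)
    with * show ?thesis
      by blast
  qed
  then show ?thesis
    using echelon_unique[OF assms(1,2)] by blast
qed

text \<open>Conjugating 1 + c by t^a multiplies the entry (r, s) by t^(a_r - a_s). Non-zero entries
  have r < s, so dominance makes the conjugate polynomial, and it moves the diagonal vertex to the
  neighbour.\<close>

lemma orbit_nbr:
  fixes c :: "'a::field ^ 4 ^ 4"
  assumes dom: "\<And>r s. r < s \<Longrightarrow> a s \<le> a r" and "echelon_shape S c"
  shows "orbit (nbr a S c) = orbit (diag_vertex (\<lambda>i. a i + indic S i))"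
proof -
  define g where "g c = diag_mat a ** unip_mat c ** diag_mat (\<lambda>i. - a i)" for c :: "'a ^ 4 ^ 4"
  have ent: "g c $ i $ j \<in> polynomial_ring" if "echelon_shape S c" for c i j
  proof (cases "c $ i $ j = 0")
    case True
    then show ?thesis
      by (auto simp: g_def unip_mat_def mem_polynomial_ring tpow_nth)
  next
    case False
    then have "i < j"
      using that by (auto simp: echelon_shape_def)
    then show ?thesis
      using dom[of i j] by (auto simp: g_def unip_mat_def mem_polynomial_ring)
  qed
  have inv: "g c ** g (- c) = mat 1" if "echelon_shape S c" for c
  proof -
    have "g c ** g (- c) = diag_mat a ** (unip_mat c ** ((diag_mat (\<lambda>i. - a i) ** diag_mat a) ** unip_mat (- c))) ** diag_mat (\<lambda>i. - a i)"
      by (simp add: g_def matrix_mul_assoc)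
    then show ?thesis
      by (simp add: diag_mat_inverse unip_mat_inverse[OF that])
  qed
  have "g c \<in> GL4_poly"
  proof -
    have shape': "echelon_shape S (- c)"
      using assms(2) by (simp add: echelon_shape_uminus)
    have "g (- c) ** g c = mat 1"
      using inv[OF shape'] by simp
    then show ?thesis
      unfolding GL4_poly_def GL4_def using ent[OF assms(2)] ent[OF shape'] inv[OF assms(2)] by blast
  qed
  moreover have "nbr a S c = mat_act (g c) (diag_vertex (\<lambda>i. a i + indic S i))"
  proof -
    have "g c ** diag_mat (\<lambda>i. a i + indic S i) = diag_mat a ** unip_mat c ** (diag_mat (\<lambda>i. - a i) ** diag_mat a) ** diag_mat (indic S)"
      unfolding g_def diag_mat_mult[symmetric] by (simp add: matrix_mul_assoc)
    then show ?thesis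
      by (simp add: nbr_def diag_vertex_def mat_act_vertex_of diag_mat_inverse matrix_mul_assoc)
  qed
  ultimately show ?thesis
    by (simp add: orbit_mat_act)
qed

text \<open>The dimension of the Schubert cell with pivots \<open>S\<close>, that is, the number of
  free entries of its echelon matrices.\<close>

definition inversions :: "4 set \<Rightarrow> nat" where
  "inversions S = card {(r, s). s \<in> S \<and> r \<notin> S \<and> r < s}"

lemma sum_neighbours:
  fixes f :: "'a::{field,finite} vertex set \<Rightarrow> complex"
  assumes dom: "\<And>r s. r < s \<Longrightarrow> a s \<le> a r" and i: "i \<in> {1, 2, 3}"
    and N: "N = {y :: 'a vertex. adjacent (diag_vertex a) y \<and> color y = color (diag_vertex a :: 'a vertex) + of_nat i}"
  shows "finite N"
    "(\<Sum>y\<in>N. f (orbit y)) = (\<Sum>S | card S = i. of_nat CARD('a) ^ inversions S * f (orbit (diag_vertex (\<lambda>j. a j + indic S j))))"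
proof -
  define I where "I = Sigma {S :: 4 set. card S = i} (\<lambda>S. {c :: 'a ^ 4 ^ 4. echelon_shape S c})"
  have N_eq: "N = (\<lambda>(S, c). nbr a S c) ` I"
  proof (intro equalityI subsetI)
    fix y
    assume "y \<in> N"
    then have y: "adjacent (diag_vertex a) y" "color y = color (diag_vertex a :: 'a vertex) + of_nat i"
      by (simp_all add: N)
    obtain S and c :: "'a ^ 4 ^ 4" where Sc: "echelon_shape S c" "y = nbr a S c"
      using y(1) by (rule adjacent_diag_vertex_imp_nbr)
    then have "(of_nat (card S) :: 4) = of_nat i"
      using y(2) color_nbr[OF Sc(1), of a] by simp
    then have "card S = i"
      using of_nat_4_eq_iff[OF card_4_le i] by blast
    with Sc show "y \<in> (\<lambda>(S, c). nbr a S c) ` I"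
      by (auto simp: I_def)
  next
    fix y
    assume "y \<in> (\<lambda>(S, c). nbr a S c) ` I"
    then show "y \<in> N"
      using i by (auto simp: I_def N color_nbr adjacent_nbr)
  qed
  have fin: "finite I"
    unfolding I_def by (intro finite_SigmaI finite)
  then show "finite N"
    unfolding N_eq by (rule finite_imageI)
  have "inj_on (\<lambda>(S, c). nbr a S c) I"
  proof (rule inj_onI)
    fix x y
    assume xy: "x \<in> I" "y \<in> I" "(case x of (S, c) \<Rightarrow> nbr a S c) = (case y of (S, c) \<Rightarrow> nbr a S c)"
    obtain S c S' c' where "x = (S, c)" "y = (S', c')"
      by (metis surj_pair)
    with xy nbr_inj[of S c S' c' a] show "x = y"
      by (auto simp: I_def)
  qed
  then have "(\<Sum>y\<in>N. f (orbit y)) = (\<Sum>(S, c)\<in>I. f (orbit (nbr a S c)))"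
    unfolding N_eq by (subst sum.reindex) (auto simp: case_prod_unfold)
  also have "\<dots> = (\<Sum>S | card S = i. \<Sum>c | echelon_shape S (c :: 'a ^ 4 ^ 4). f (orbit (nbr a S c)))"
    unfolding I_def by (subst sum.Sigma) auto
  also have "\<dots> = (\<Sum>S | card S = i. of_nat CARD('a) ^ inversions S * f (orbit (diag_vertex (\<lambda>j. a j + indic S j))))"
  proof (intro sum.cong refl)
    fix S :: "4 set"
    have "(\<Sum>c | echelon_shape S (c :: 'a ^ 4 ^ 4). f (orbit (nbr a S c))) =
        (\<Sum>c | echelon_shape S (c :: 'a ^ 4 ^ 4). f (orbit (diag_vertex (\<lambda>j. a j + indic S j))))"
      by (intro sum.cong refl) (simp add: orbit_nbr[OF dom])
    then show "(\<Sum>c | echelon_shape S (c :: 'a ^ 4 ^ 4). f (orbit (nbr a S c))) =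
        of_nat CARD('a) ^ inversions S * f (orbit (diag_vertex (\<lambda>j. a j + indic S j)))"
      by (simp add: card_echelon_shape inversions_def)
  qed
  finally show "(\<Sum>y\<in>N. f (orbit y)) =
    (\<Sum>S | card S = i. of_nat CARD('a) ^ inversions S * f (orbit (diag_vertex (\<lambda>j. a j + indic S j))))" .
qed

lemma less_4: "(4 :: 4) < 1" "(4 :: 4) < 2" "(4 :: 4) < 3" "(1 :: 4) < 2" "(1 :: 4) < 3" "(2 :: 4) < 3"
  by (simp_all add: less_bit0_def bit0.Rep_numeral bit0.Rep_1)

subsection \<open>Reduction theory and stabilizers\<close>

lemma power_series_mult_nth_0:
  assumes "f \<in> power_series_ring" "g \<in> power_series_ring"
  shows "(f * g) $$ 0 = f $$ 0 * g $$ 0"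
proof -
  obtain F G where FG: "f = fps_to_fls F" "g = fps_to_fls G"
    using assms by (auto simp: power_series_ring_def)
  then have "f * g = fps_to_fls (F * G)"
    by (simp add: fls_times_fps_to_fls)
  then show ?thesis
    by (simp add: FG)
qed

lemma power_series_prod_nth_0:
  assumes "\<And>i. i \<in> A \<Longrightarrow> f i \<in> power_series_ring"
  shows "(\<Prod>i\<in>A. f i) $$ 0 = (\<Prod>i\<in>A. f i $$ 0)"
  using assms
proof (induction A rule: infinite_finite_induct)
  case (insert x A)
  then have "(\<Prod>i\<in>A. f i) \<in> power_series_ring"
    by (intro subring_prod) auto
  with insert show ?case
    by (simp add: power_series_mult_nth_0)
qed auto

lemma det_nth_0:
  fixes w :: "'a::field matrix4"
  assumes "\<And>i j. w $ i $ j \<in> power_series_ring"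
  shows "det w $$ 0 = det (\<chi> i j. w $ i $ j $$ 0)"
proof -
  have *: "(of_int (sign p) * (\<Prod>i\<in>UNIV. w $ i $ p i)) $$ 0 = of_int (sign p) * (\<Prod>i\<in>UNIV. w $ i $ p i $$ 0)"
    for p :: "4 \<Rightarrow> 4"
    using power_series_prod_nth_0[of UNIV "\<lambda>i. w $ i $ p i"] assms by (auto simp: sign_def)
  show ?thesis
    unfolding det_def fls_sum_nth by (intro sum.cong refl) (simp only: * vec_lambda_beta)
qed

lemma power_series_unit_iff:
  assumes "f \<in> power_series_ring" "f $$ 0 \<noteq> 0"
  shows "inverse f \<in> power_series_ring" "f * inverse f = 1"
proof -
  have "fls_subdegree f = 0"
    using assms by (intro fls_subdegree_eqI) (auto simp: mem_power_series_ring)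
  then show "inverse f \<in> power_series_ring"
    unfolding mem_power_series_ring by (auto intro!: fls_eq0_below_subdegree simp: fls_inverse_subdegree)
  show "f * inverse f = 1"
    using assms(2) by (intro right_inverse) auto
qed

lemma subdegree_nonneg_of_mem: "f \<in> power_series_ring \<Longrightarrow> f \<noteq> 0 \<Longrightarrow> 0 \<le> fls_subdegree f"
  unfolding mem_power_series_ring by (auto intro: fls_subdegree_geI)

lemma GL4_poly_subdegree_det: "g \<in> GL4_poly \<Longrightarrow> fls_subdegree (det g) = 0" "g \<in> GL4_poly \<Longrightarrow> det g \<noteq> 0"
  using GL4_poly_invertible invertible_det_nz by (auto simp: GL4_poly_def subdegree_det_GL4_polynomial)

text \<open>
  Reduction theory: among the bases of the polynomial lattice take one for which the sum of the
  column degrees of \<open>h ** \<gamma>\<close> is minimal. A linear relation between the leading coefficients of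
  the columns would allow one to lower the degree of one of them.
\<close>

lemma reduced_basis:
  fixes h :: "'a::field matrix4"
  assumes "invertible h"
  obtains \<gamma> d where "\<gamma> \<in> GL4_poly" "h ** \<gamma> ** diag_mat (\<lambda>j. - d j) \<in> GL4 power_series_ring"
proof -
  \<comment> \<open>The exponents \<open>d\<close> are upper bounds for the column degrees rather
    than the degrees themselves, which avoids maxima over entries.\<close>
  define A where "A = {(\<gamma>, d). \<gamma> \<in> GL4_poly \<and> (\<forall>i j n. n < - (d j) \<longrightarrow> (h ** \<gamma>) $ i $ j $$ n = 0)}"
  have int: "(h ** \<gamma> ** diag_mat (\<lambda>j. - d j)) $ i $ j \<in> power_series_ring" if "(\<gamma>, d) \<in> A" for \<gamma> d i j
    using that by (auto simp: A_def mem_power_series_ring)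
  define B where "B = - fls_subdegree (det h)"
  \<comment> \<open>The degree of a determinant is at most the sum of the column degrees, and
    \<open>det \<gamma>\<close> has degree 0. Hence the sums are bounded below and a minimum
    exists.\<close>
  have bound: "B \<le> (\<Sum>j\<in>UNIV. d j)" if "(\<gamma>, d) \<in> A" for \<gamma> d
  proof -
    have "det (h ** \<gamma> ** diag_mat (\<lambda>j. - d j)) \<in> power_series_ring"
      using int[OF that] by (intro subring_det) auto
    then have mem: "det h * det \<gamma> * det (diag_mat (\<lambda>j. - d j)) \<in> power_series_ring"
      by (simp only: det_mul)
    have nz: "det h \<noteq> 0" "det \<gamma> \<noteq> 0" "det (diag_mat (\<lambda>j. - d j) :: 'a matrix4) \<noteq> 0"
      using assms that invertible_diag_mat by (auto simp: A_def GL4_poly_subdegree_det simp flip: invertible_det_nz)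
    have "0 \<le> fls_subdegree (det h * det \<gamma> * det (diag_mat (\<lambda>j. - d j)))"
      by (rule subdegree_nonneg_of_mem[OF mem]) (simp add: nz)
    then show ?thesis
      using nz that by (simp add: B_def A_def GL4_poly_subdegree_det subdegree_det_diag_mat sum_negf)
  qed
  define K where "K = (\<Sum>i\<in>UNIV. \<Sum>j\<in>UNIV. \<bar>fls_subdegree (h $ i $ j)\<bar>)"
  have K: "- fls_subdegree (h $ i $ j) \<le> K" for i j
  proof -
    have "\<bar>fls_subdegree (h $ i $ j)\<bar> \<le> (\<Sum>j\<in>UNIV. \<bar>fls_subdegree (h $ i $ j)\<bar>)"
      by (rule member_le_sum) auto
    also have "\<dots> \<le> K"
      unfolding K_def by (rule member_le_sum[where f = "\<lambda>i. \<Sum>j\<in>UNIV. \<bar>fls_subdegree (h $ i $ j)\<bar>"])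
        (auto intro: sum_nonneg)
    finally show ?thesis
      by linarith
  qed
  have "h $ i $ j $$ n = 0" if "n < - K" for i j n
    using K[of i j] that by (intro fls_eq0_below_subdegree) linarith
  then have "(mat 1, \<lambda>_. K) \<in> A"
    by (simp add: A_def)
  then obtain p where p: "p \<in> A" "\<And>p'. p' \<in> A \<Longrightarrow> nat ((\<Sum>j\<in>UNIV. snd p j) - B) \<le> nat ((\<Sum>j\<in>UNIV. snd p' j) - B)"
    using ex_has_least_nat[of "\<lambda>p. p \<in> A" _ "\<lambda>p. nat ((\<Sum>j\<in>UNIV. snd p j) - B)"] by blast
  obtain \<gamma> d where \<gamma>d: "p = (\<gamma>, d)"
    by (rule prod.exhaust)
  have mem: "(\<gamma>, d) \<in> A" and \<gamma>: "\<gamma> \<in> GL4_poly"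
    using p(1) by (simp_all add: \<gamma>d A_def)
  define w where "w = h ** \<gamma> ** diag_mat (\<lambda>j. - d j)"
  have w_int: "w $ i $ j \<in> power_series_ring" for i j
    unfolding w_def by (rule int[OF mem])
  define w0 where "w0 = (\<chi> i j. w $ i $ j $$ 0)"
  have w0_nth: "w0 $ i $ j = (h ** \<gamma>) $ i $ j $$ (- d j)" for i j
    by (simp add: w0_def w_def)
  have "det w0 \<noteq> 0"
  proof
    assume "det w0 = 0"
    then have "\<not> (\<exists>B. B ** w0 = mat 1)"
      using invertible_det_nz invertible_left_inverse by blast
    then obtain c where c: "w0 *v c = 0" "c \<noteq> 0"
      unfolding matrix_left_invertible_ker by blast
    define J where "J = {i. c $ i \<noteq> 0}"
    have "J \<noteq> {}"
      using c(2) by (auto simp: J_def vec_eq_iff)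
    then have "Max (d ` J) \<in> d ` J"
      by (intro Max_in) auto
    then obtain j where j: "j \<in> J" "Max (d ` J) = d j"
      by blast
    have d_le: "d i \<le> d j" if "c $ i \<noteq> 0" for i
      unfolding j(2)[symmetric] using that by (intro Max_ge) (auto simp: J_def)
    have cj: "c $ j \<noteq> 0"
      using j(1) by (simp add: J_def)
    \<comment> \<open>The relation \<open>c\<close> between the leading columns is made homogeneous
      by powers of t. Since \<open>d j\<close> is largest among the columns involved, the exponents
      are non-negative and \<open>x\<close> is polynomial. Putting it into column j of the identity
      gives determinant \<open>c $ j\<close>, a non-zero constant, and the coefficient at degree
      \<open>d j\<close> of the new column cancels.\<close>
    define x :: "'a fls ^ 4" where "x = (\<chi> i. fls_const (c $ i) * tpow (d j - d i))"
    define E where "E = (\<chi> i l. if l = j then (mat 1 *v x) $ i else mat 1 $ i $ l)"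
    have E_nth: "E $ i $ l = (if l = j then x $ i else if i = l then 1 else 0)" for i l
      by (simp add: E_def) (simp add: mat_def)
    have "E \<in> GL4_poly"
      unfolding GL4_poly_def
    proof (rule GL4_I_det)
      show "E $ i $ l \<in> polynomial_ring" for i l
        using d_le[of i] subringD(1,2)[OF subring_polynomial_ring] unfolding E_nth
        by (cases "c $ i = 0") (auto simp: x_def mem_polynomial_ring)
      have "det E = x $ j"
        unfolding E_def by (subst cramer_lemma) simp
      then show "det E * fls_const (inverse (c $ j)) = 1"
        using cj by (simp add: x_def)
      show "fls_const (inverse (c $ j)) \<in> polynomial_ring"
        by (simp add: mem_polynomial_ring)
    qed simp
    define d' where "d' = d(j := d j - 1)"
    have col: "(h ** (\<gamma> ** E)) $ i $ l = (\<Sum>k\<in>UNIV. (h ** \<gamma>) $ i $ k * E $ k $ l)" for i l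
      by (simp add: matrix_mul_assoc matrix_mult_nth)
    have "(h ** (\<gamma> ** E)) $ i $ l $$ n = 0" if n: "n < - (d' l)" for i l n
    proof (cases "l = j")
      case False
      then have "(h ** (\<gamma> ** E)) $ i $ l = (h ** \<gamma>) $ i $ l"
        unfolding col E_nth by (simp add: if_distrib cong: if_cong)
      then show ?thesis
        using mem n False by (simp add: A_def d'_def)
    next
      case True
      have eq: "(h ** (\<gamma> ** E)) $ i $ l $$ n = (\<Sum>k\<in>UNIV. (h ** \<gamma>) $ i $ k $$ (n + (d j - d k)) * c $ k)"
        unfolding col E_nth True by (simp add: x_def fls_sum_nth flip: mult.assoc)
      show ?thesis
      proof (cases "n = - d j")
        case True
        then have "(h ** (\<gamma> ** E)) $ i $ l $$ n = (w0 *v c) $ i"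
          unfolding eq by (simp add: matrix_vector_mult_def w0_nth)
        then show ?thesis
          by (simp add: c(1))
      next
        case False
        then have "n + (d j - d k) < - d k" for k
          using n \<open>l = j\<close> by (simp add: d'_def)
        then show ?thesis
          unfolding eq using mem by (simp add: A_def)
      qed
    qed
    then have mem': "(\<gamma> ** E, d') \<in> A"
      using \<gamma> \<open>E \<in> GL4_poly\<close> by (simp add: A_def GL4_poly_mult)
    have "(\<Sum>l\<in>UNIV. d' l) = (\<Sum>l\<in>UNIV. d l - (if l = j then 1 else 0))"
      by (intro sum.cong refl) (simp add: d'_def)
    then have "(\<Sum>l\<in>UNIV. d' l) = (\<Sum>l\<in>UNIV. d l) - 1"
      by (simp add: sum_subtractf)
    then show False
      using p(2)[OF mem'] bound[OF mem'] by (simp add: \<gamma>d)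
  qed
  then have "det w $$ 0 \<noteq> 0"
    using det_nth_0[OF w_int] by (simp add: w0_def)
  moreover have "det w \<in> power_series_ring"
    using w_int by (intro subring_det) auto
  ultimately have "w \<in> GL4 power_series_ring"
    using w_int power_series_unit_iff by (intro GL4_I_det[of _ _ "inverse (det w)"]) auto
  then show thesis
    using that \<gamma> by (simp add: w_def)
qed

text \<open>The reduction is applied to the inverse of g: if g^-1 \<gamma> t^-d lies in GL(4,O),
  then g and \<gamma> t^-d define the same vertex.\<close>

lemma orbit_eq_orbit_diag_vertex:
  fixes x :: "'a::field vertex"
  assumes "x \<in> vertices"
  obtains a where "orbit x = orbit (diag_vertex a)"
proof -
  obtain g where g: "invertible g" "x = vertex_of g"
    using assms by (rule vertices_cases)
  then obtain h where h: "g ** h = mat 1" "h ** g = mat 1"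
    unfolding invertible_def by blast
  then have "invertible h"
    unfolding invertible_def by blast
  then obtain \<gamma> d where \<gamma>: "\<gamma> \<in> GL4_poly" "h ** \<gamma> ** diag_mat (\<lambda>j. - d j) \<in> GL4 power_series_ring"
    by (rule reduced_basis)
  have "g ** (h ** \<gamma> ** diag_mat (\<lambda>j. - d j)) = (g ** h) ** (\<gamma> ** diag_mat (\<lambda>j. - d j))"
    by (simp add: matrix_mul_assoc)
  then have "x = vertex_of (\<gamma> ** diag_mat (\<lambda>j. - d j))"
    using vertex_of_mult_GL4[OF \<gamma>(2), of g] by (simp add: g h)
  then have "x = mat_act \<gamma> (diag_vertex (\<lambda>j. - d j))"
    by (simp add: diag_vertex_def mat_act_vertex_of)
  then show thesis
    using that[of "\<lambda>j. - d j"] by (simp add: orbit_mat_act[OF \<gamma>(1)])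
qed

text \<open>Polynomials in t of degree at most d; for negative d only 0 remains, in accordance with
  \<open>nat (d + 1)\<close> being 0.\<close>

definition degree_le :: "int \<Rightarrow> 'a::field fls set" where
  "degree_le d = {f. \<forall>n. f $$ n \<noteq> 0 \<longrightarrow> - d \<le> n \<and> n \<le> 0}"

lemma card_degree_le:
  "finite (degree_le d :: 'a::{field,finite} fls set)"
  "card (degree_le d :: 'a::{field,finite} fls set) \<le> CARD('a) ^ nat (d + 1)"
proof -
  let ?r = "\<lambda>f :: 'a fls. restrict (\<lambda>n. f $$ n) {- d..0}"
  have inj: "inj_on ?r (degree_le d)"
  proof (rule inj_onI)
    fix f g :: "'a fls"
    assume fg: "f \<in> degree_le d" "g \<in> degree_le d" "?r f = ?r g"
    have "f $$ n = g $$ n" for n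
    proof (cases "n \<in> {- d..0}")
      case True
      with fun_cong[OF fg(3), of n] show ?thesis
        by simp
    next
      case False
      with fg(1,2) have "f $$ n = 0" "g $$ n = 0"
        unfolding degree_le_def by fastforce+
      then show ?thesis
        by simp
    qed
    then show "f = g"
      by (rule fls_eqI)
  qed
  have sub: "?r ` degree_le d \<subseteq> PiE {- d..0} (\<lambda>_. UNIV)"
    by auto
  have fin: "finite (PiE {- d..0} (\<lambda>_. UNIV :: 'a set))"
    by (intro finite_PiE) auto
  show "finite (degree_le d :: 'a fls set)"
    using inj_on_finite[OF inj sub fin] .
  have "card (degree_le d :: 'a fls set) \<le> card (PiE {- d..0} (\<lambda>_. UNIV :: 'a set))"
    using card_inj_on_le[OF inj sub fin] .
  then show "card (degree_le d :: 'a fls set) \<le> CARD('a) ^ nat (d + 1)"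
    by (simp add: card_PiE add.commute)
qed

text \<open>A stabilizing g satisfies g t^a = \<gamma> t^a k with k in GL(4,O), and comparing
  determinants gives \<gamma> valuation 0. So t^(-a_i) g_ij t^(a_j) is integral, which bounds the
  degree of the polynomial g_ij.\<close>

lemma Stab_diag_vertex_subset: "Stab (diag_vertex a) \<subseteq> {g. \<forall>i j. g $ i $ j \<in> degree_le (a i - a j)}"
proof (intro subsetI CollectI allI)
  fix g :: "'a matrix4" and i j
  assume "g \<in> Stab (diag_vertex a)"
  then have g: "g \<in> GL4_poly" "vertex_of (g ** diag_mat a) = vertex_of (diag_mat a)"
    by (simp_all add: Stab_def diag_vertex_def mat_act_vertex_of)
  have inv: "invertible (g ** diag_mat a)"
    using g(1) by (intro invertible_mult GL4_poly_invertible invertible_diag_mat)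
  obtain \<gamma> k where \<gamma>: "\<gamma> \<noteq> 0" "k \<in> GL4 power_series_ring" "g ** diag_mat a = mat \<gamma> ** diag_mat a ** k"
    using vertex_of_eq_imp[OF inv invertible_diag_mat g(2)] by blast
  have nz: "det (diag_mat a :: 'a matrix4) \<noteq> 0"
    using invertible_diag_mat invertible_det_nz by blast
  have "fls_subdegree (det (g ** diag_mat a)) = 4 * fls_subdegree \<gamma> + fls_subdegree (det (diag_mat a :: 'a matrix4))"
    unfolding \<gamma>(3) by (rule subdegree_det_mat_mult[OF invertible_diag_mat \<gamma>(1,2)])
  then have "fls_subdegree \<gamma> = 0"
    using GL4_poly_subdegree_det[OF g(1)] nz by (simp add: det_mul)
  then have "\<gamma> \<in> power_series_ring"
    unfolding mem_power_series_ring by (auto intro!: fls_eq0_below_subdegree)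
  then have "\<gamma> * k $ i $ j \<in> power_series_ring"
    using GL4_nth[OF \<gamma>(2)] subringD(4)[OF subring_power_series_ring] by blast
  moreover have "\<gamma> * k $ i $ j = tpow (- a i) * (g $ i $ j * tpow (a j))"
  proof -
    have "g $ i $ j * tpow (a j) = \<gamma> * (tpow (a i) * k $ i $ j)"
      using arg_cong[OF \<gamma>(3), of "\<lambda>m. m $ i $ j"] by (simp flip: matrix_mul_assoc)
    then have "tpow (- a i) * (g $ i $ j * tpow (a j)) = (tpow (- a i) * tpow (a i)) * (\<gamma> * k $ i $ j)"
      by (simp add: mult_ac)
    then show ?thesis
      by (simp add: tpow_mult)
  qed
  ultimately have "g $ i $ j $$ (n - a i + a j) = 0" if "n < 0" for n
    using that by (simp add: mem_power_series_ring)
  from this[of "_ + a i - a j"] have "g $ i $ j $$ n = 0" if "n < a j - a i" for n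
    using that by simp
  moreover have "g $ i $ j $$ n = 0" if "0 < n" for n
    using GL4_nth[of g polynomial_ring i j] g(1) that by (simp add: GL4_poly_def mem_polynomial_ring)
  ultimately show "g $ i $ j \<in> degree_le (a i - a j)"
    unfolding degree_le_def by (auto simp: not_le[symmetric])
qed

lemma card_Stab_diag_vertex:
  fixes a :: "4 \<Rightarrow> int"
  shows "finite (Stab (diag_vertex a :: 'a::{field,finite} vertex))"
    "card (Stab (diag_vertex a :: 'a::{field,finite} vertex)) \<le> CARD('a) ^ (\<Sum>i\<in>UNIV. \<Sum>j\<in>UNIV. nat (a i - a j + 1))"
proof -
  let ?M = "{g :: 'a matrix4. \<forall>i j. g $ i $ j \<in> degree_le (a i - a j)}"
  let ?P = "PiE UNIV (\<lambda>(i, j). degree_le (a i - a j) :: 'a fls set)"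
  let ?r = "\<lambda>(g :: 'a matrix4) (i, j). g $ i $ j"
  have inj: "inj_on ?r ?M"
    by (auto simp: inj_on_def fun_eq_iff vec_eq_iff)
  have sub: "?r ` ?M \<subseteq> ?P"
    by (auto simp: PiE_def)
  have fin: "finite ?P"
    by (intro finite_PiE) (auto simp: card_degree_le)
  have finM: "finite ?M"
    using inj_on_finite[OF inj sub fin] .
  then show "finite (Stab (diag_vertex a :: 'a vertex))"
    by (rule finite_subset[OF Stab_diag_vertex_subset])
  have "card (Stab (diag_vertex a :: 'a vertex)) \<le> card ?M"
    by (rule card_mono[OF finM Stab_diag_vertex_subset])
  also have "\<dots> \<le> card ?P"
    using card_inj_on_le[OF inj sub fin] .
  also have "card ?P = (\<Prod>(i, j)\<in>UNIV. card (degree_le (a i - a j) :: 'a fls set))"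
    by (subst card_PiE) (auto simp: case_prod_unfold)
  also have "\<dots> \<le> (\<Prod>(i, j)\<in>UNIV. CARD('a) ^ nat (a i - a j + 1))"
    by (intro prod_mono) (auto simp: card_degree_le)
  also have "\<dots> = CARD('a) ^ (\<Sum>(i, j)\<in>UNIV. nat (a i - a j + 1))"
    by (simp add: power_sum case_prod_unfold)
  also have "(\<Sum>(i, j)\<in>UNIV. nat (a i - a j + 1)) = (\<Sum>i\<in>UNIV. \<Sum>j\<in>UNIV. nat (a i - a j + 1))"
    by (simp add: sum.cartesian_product)
  finally show "card (Stab (diag_vertex a :: 'a vertex)) \<le> CARD('a) ^ (\<Sum>i\<in>UNIV. \<Sum>j\<in>UNIV. nat (a i - a j + 1))" .
qed

text \<open>An upper bound for the stabilizer is a lower bound for the weight, the direction in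
  which summability of |f|^2 w forces f to be small.\<close>

lemma vertex_weight_diag_vertex_ge:
  fixes a :: "4 \<Rightarrow> int"
  assumes "(\<Sum>i\<in>UNIV. \<Sum>j\<in>UNIV. nat (a i - a j + 1)) \<le> e"
  shows "1 / real CARD('a) ^ e \<le> vertex_weight (orbit (diag_vertex a :: 'a::{field,finite} vertex))"
proof -
  have "card (Stab (diag_vertex a :: 'a vertex)) \<le> CARD('a) ^ e"
    using card_Stab_diag_vertex(2)[where 'a = 'a, of a] assms
    by (rule order_trans[OF _ power_increasing]) simp
  moreover have "0 < card (Stab (diag_vertex a :: 'a vertex))"
    using card_Stab_diag_vertex(1) mat_1_in_Stab by (auto simp: card_gt_0_iff)
  moreover have "1 \<le> num_units TYPE('a)"
    using num_units_pos[where 'a = 'a] by simp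
  ultimately have "1 / real (CARD('a) ^ e) \<le> real (num_units TYPE('a)) / real (card (Stab (diag_vertex a :: 'a vertex)))"
    by (intro frac_le of_nat_mono) simp_all
  then show ?thesis
    by (simp add: vertex_weight_orbit)
qed

text \<open>A non-zero entry in column \<open>j\<close> of the connecting matrix g has degree at
  least 0, which compares a_j with some b_i; the determinants supply the scalar. The largest
  coordinate, normalized by the total, is thus an invariant of the orbit, enough to separate the
  points of a ray.\<close>

lemma orbit_diag_vertex_eq_imp:
  fixes a b :: "4 \<Rightarrow> int"
  assumes "orbit (diag_vertex a) = orbit (diag_vertex b :: 'a::field vertex)"
  obtains i where "4 * a j \<le> 4 * b i + (\<Sum>i\<in>UNIV. a i) - (\<Sum>i\<in>UNIV. b i)"
proof -
  have "(diag_vertex b :: 'a vertex) \<in> orbit (diag_vertex a)"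
    using mem_orbit_self[of "diag_vertex b :: 'a vertex"] assms by simp
  then obtain g where g: "g \<in> GL4_poly" "vertex_of (diag_mat b) = vertex_of (g ** diag_mat a :: 'a matrix4)"
    by (auto simp: orbit_def diag_vertex_def mat_act_vertex_of)
  have inv: "invertible (g ** diag_mat a)"
    using g(1) by (intro invertible_mult GL4_poly_invertible invertible_diag_mat)
  obtain \<gamma> k where \<gamma>: "\<gamma> \<noteq> 0" "k \<in> GL4 power_series_ring" "g ** diag_mat a = mat \<gamma> ** diag_mat b ** k"
    using vertex_of_eq_imp[OF inv invertible_diag_mat g(2)[symmetric]] by blast
  have nz: "det (diag_mat a :: 'a matrix4) \<noteq> 0"
    using invertible_diag_mat invertible_det_nz by blast
  have "fls_subdegree (det (g ** diag_mat a)) = 4 * fls_subdegree \<gamma> + fls_subdegree (det (diag_mat b :: 'a matrix4))"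
    unfolding \<gamma>(3) by (rule subdegree_det_mat_mult[OF invertible_diag_mat \<gamma>(1,2)])
  then have v: "4 * fls_subdegree \<gamma> = (\<Sum>i\<in>UNIV. b i) - (\<Sum>i\<in>UNIV. a i)"
    using GL4_poly_subdegree_det[OF g(1)] nz by (simp add: det_mul subdegree_det_diag_mat)
  obtain i where i: "g $ i $ j \<noteq> 0"
  proof (rule ccontr)
    assume "\<not> thesis"
    then have 0: "g $ i $ j = 0" for i
      using that by blast
    obtain g' where "g' ** g = mat 1"
      using g(1) by (rule GL4_poly_inverse)
    then have "(g' ** g) $ j $ j = 1"
      by (simp add: mat_def)
    then have "(\<Sum>i\<in>UNIV. g' $ j $ i * g $ i $ j) = 1"
      unfolding matrix_mult_nth .
    then show False
      by (simp add: 0)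
  qed
  have eq: "g $ i $ j * tpow (a j) = \<gamma> * (tpow (b i) * k $ i $ j)"
    using arg_cong[OF \<gamma>(3), of "\<lambda>m. m $ i $ j"] by (simp flip: matrix_mul_assoc)
  then have k: "k $ i $ j \<noteq> 0"
    using i by auto
  have "g $ i $ j $$ fls_subdegree (g $ i $ j) \<noteq> 0"
    using i by simp
  then have "fls_subdegree (g $ i $ j) \<le> 0"
    using GL4_nth[of g polynomial_ring i j] g(1) unfolding GL4_poly_def mem_polynomial_ring by (meson not_le)
  moreover have "0 \<le> fls_subdegree (k $ i $ j)"
    using k GL4_nth[OF \<gamma>(2)] by (intro subdegree_nonneg_of_mem)
  moreover have "fls_subdegree (g $ i $ j) - a j = fls_subdegree \<gamma> - b i + fls_subdegree (k $ i $ j)"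
    using arg_cong[OF eq, of fls_subdegree] i k \<gamma>(1) by simp
  ultimately have "4 * a j \<le> 4 * b i + (\<Sum>i\<in>UNIV. a i) - (\<Sum>i\<in>UNIV. b i)"
    using v by linarith
  then show thesis
    by (rule that)
qed

subsection \<open>The discrete spectrum\<close>

definition perm_mat :: "(4 \<Rightarrow> 4) \<Rightarrow> 'a::field matrix4" where
  "perm_mat p = (\<chi> r s. if s = p r then 1 else 0)"

lemma perm_mat_in_GL4:
  assumes "subring R" "\<And>i. p (p i) = i"
  shows "perm_mat p \<in> GL4 R"
proof -
  have "(perm_mat p ** perm_mat p) $ i $ j = (mat 1 :: 'a matrix4) $ i $ j" for i j
  proof -
    have "(perm_mat p ** perm_mat p :: 'a matrix4) $ i $ j = (\<Sum>k\<in>UNIV. if k = p i then if j = p k then 1 else 0 else 0)"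
      unfolding matrix_mult_nth by (intro sum.cong refl) (simp add: perm_mat_def)
    then show ?thesis
      by (auto simp: assms(2) mat_def)
  qed
  then have "perm_mat p ** perm_mat p = (mat 1 :: 'a matrix4)"
    by (simp add: vec_eq_iff)
  moreover have "(perm_mat p :: 'a matrix4) $ i $ j \<in> R" for i j
    using subringD(1,2)[OF assms(1)] by (simp add: perm_mat_def)
  ultimately show ?thesis
    unfolding GL4_def by blast
qed

text \<open>A permutation matrix belongs to both GL(4,F_q[t]) and GL(4,O): it acts on the left
  without leaving the orbit and is absorbed on the right.\<close>

lemma orbit_diag_vertex_transpose: "orbit (diag_vertex (a \<circ> Transposition.transpose i j)) = orbit (diag_vertex a :: 'a::field vertex)"
proof -
  let ?p = "Transposition.transpose i j"
  have "perm_mat ?p ** diag_mat a = (diag_mat (a \<circ> ?p) ** perm_mat ?p :: 'a matrix4)"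
    by (auto simp: vec_eq_iff perm_mat_def)
  moreover have "(perm_mat ?p :: 'a matrix4) \<in> GL4 power_series_ring" "(perm_mat ?p :: 'a matrix4) \<in> GL4_poly"
    unfolding GL4_poly_def by (auto intro!: perm_mat_in_GL4)
  ultimately have "mat_act (perm_mat ?p) (diag_vertex a) = (diag_vertex (a \<circ> ?p) :: 'a vertex)"
    by (simp add: diag_vertex_def mat_act_vertex_of vertex_of_mult_GL4)
  then show ?thesis
    using orbit_mat_act[OF \<open>perm_mat ?p \<in> GL4_poly\<close>, of "diag_vertex a"] by simp
qed

lemma less_4_asym: "\<not> (1::4) < 4" "\<not> (2::4) < 4" "\<not> (3::4) < 4" "\<not> (2::4) < 1" "\<not> (3::4) < 1" "\<not> (3::4) < 2"
  using less_4 by (meson less_asym)+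

text \<open>
  In the type \<open>4\<close> the numeral \<open>4\<close> is \<open>0\<close>, the least element, so coordinates are listed in the order
  \<open>4, 1, 2, 3\<close>.
\<close>

definition coords :: "int \<Rightarrow> int \<Rightarrow> int \<Rightarrow> int \<Rightarrow> 4 \<Rightarrow> int" where
  "coords a b c d i = (if i = 4 then a else if i = 1 then b else if i = 2 then c else d)"

lemma coords_nth [simp]: "coords a b c d 4 = a" "coords a b c d 1 = b" "coords a b c d 2 = c" "coords a b c d 3 = d"
  by (simp_all add: coords_def)

lemma coords_eqI: "t 4 = a \<Longrightarrow> t 1 = b \<Longrightarrow> t 2 = c \<Longrightarrow> t 3 = d \<Longrightarrow> t = coords a b c d"
  unfolding fun_eq_iff forall_4 by simp

lemma coords_mono:
  assumes "b \<le> a" "c \<le> b" "d \<le> c" "r < s"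
  shows "coords a b c d s \<le> coords a b c d r"
  using exhaust_4[of r] exhaust_4[of s] assms less_4_asym by auto

lemma sum_Pow_insert:
  fixes G :: "'b set \<Rightarrow> 'c::comm_monoid_add"
  assumes "x \<notin> A" "finite A"
  shows "sum G (Pow (insert x A)) = sum G (Pow A) + (\<Sum>S\<in>Pow A. G (insert x S))"
proof -
  have "inj_on (insert x) (Pow A)"
    using assms(1) by (auto simp: inj_on_def)
  moreover have "Pow A \<inter> insert x ` Pow A = {}"
    using assms(1) by auto
  ultimately show ?thesis
    unfolding Pow_insert using assms(2) by (subst sum.union_disjoint) (auto simp: sum.reindex)
qed

lemma inversions_eq: "inversions S = (\<Sum>r\<in>UNIV. \<Sum>s\<in>UNIV. if s \<in> S \<and> r \<notin> S \<and> r < s then 1 else 0)"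
proof -
  have "card T = (\<Sum>p\<in>UNIV. if p \<in> T then 1 else 0)" for T :: "(4 \<times> 4) set"
    by (simp add: sum.If_cases)
  then have "inversions S = (\<Sum>p\<in>UNIV. if p \<in> {(r, s). s \<in> S \<and> r \<notin> S \<and> r < s} then 1 else 0)"
    unfolding inversions_def .
  also have "\<dots> = (\<Sum>(r, s)\<in>UNIV \<times> UNIV. if s \<in> S \<and> r \<notin> S \<and> r < s then 1 else 0)"
    by (simp add: case_prod_unfold)
  also have "\<dots> = (\<Sum>r\<in>UNIV. \<Sum>s\<in>UNIV. if s \<in> S \<and> r \<notin> S \<and> r < s then 1 else 0)"
    by (simp add: sum.cartesian_product)
  finally show ?thesis .
qed

lemma sum_card_4:
  fixes G :: "4 set \<Rightarrow> complex"
  shows "(\<Sum>S | card S = i. G S) = (\<Sum>S\<in>Pow {4, 1, 2, 3}. if card S = i then G S else 0)"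
proof -
  have "(UNIV :: 4 set) = {4, 1, 2, 3}"
    using exhaust_4 by blast
  then have "finite (Pow {4, 1, 2, 3 :: 4})" "{S :: 4 set. card S = i} = {S \<in> Pow {4, 1, 2, 3}. card S = i}"
    by auto
  then show ?thesis
    by (simp only: sum.inter_filter)
qed

lemma sums_card_4:
  fixes G :: "4 set \<Rightarrow> complex"
  shows "(\<Sum>S | card S = 1. G S) = G {4} + G {1} + G {2} + G {3}"
    and "(\<Sum>S | card S = 2. G S) = G {4, 1} + G {4, 2} + G {4, 3} + G {1, 2} + G {1, 3} + G {2, 3}"
    and "(\<Sum>S | card S = 3. G S) = G {4, 1, 2} + G {4, 1, 3} + G {4, 2, 3} + G {1, 2, 3}"
  unfolding sum_card_4 by (simp_all add: sum_Pow_insert algebra_simps)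

lemma inversions_4:
  "inversions {4} = 0" "inversions {1} = 1" "inversions {2} = 2" "inversions {3} = 3"
  "inversions {4, 1} = 0" "inversions {4, 2} = 1" "inversions {4, 3} = 2"
  "inversions {1, 2} = 2" "inversions {1, 3} = 3" "inversions {2, 3} = 4"
  "inversions {4, 1, 2} = 0" "inversions {4, 1, 3} = 1" "inversions {4, 2, 3} = 2" "inversions {1, 2, 3} = 3"
  unfolding inversions_eq sum_4 by (simp_all add: less_4 less_4_asym)

lemma card_field_ge_2: "2 \<le> CARD('a::{field,finite})"
proof -
  have "card {0, 1 :: 'a} \<le> CARD('a)"
    by (intro card_mono) auto
  then show ?thesis
    by simp
qed

lemma hecke_relation:
  fixes f :: "'a::{field,finite} vertex set \<Rightarrow> complex"
  assumes "\<And>r s. r < s \<Longrightarrow> a s \<le> a r" and i: "i \<in> {1, 2, 3}"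
    and "\<forall>u\<in>quotient_vertices. weighted_adj_op i f u = l * f u"
  shows "(\<Sum>S | card S = i. of_nat CARD('a) ^ inversions S * f (orbit (diag_vertex (\<lambda>j. a j + indic S j)))) = l * f (orbit (diag_vertex a))"
proof -
  define N where "N = {y :: 'a vertex. adjacent (diag_vertex a) y \<and> color y = color (diag_vertex a :: 'a vertex) + of_nat i}"
  note N = sum_neighbours[OF assms(1) i N_def]
  have "(of_nat i :: 4) \<noteq> 0"
    using i by auto
  then have "weighted_adj_op i f (orbit (diag_vertex a)) = (\<Sum>y\<in>N. f (orbit y))"
    using card_Stab_diag_vertex(1) N(1) N_def by (intro weighted_adj_op_orbit) auto
  moreover have "weighted_adj_op i f (orbit (diag_vertex a)) = l * f (orbit (diag_vertex a))"
    using assms(3) by (auto simp: quotient_vertices_eq)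
  ultimately show ?thesis
    using N(2)[of f] by simp
qed

lemma sector_eigenfunction_of_eigenfunction:
  fixes f :: "'a::{field,finite} vertex set \<Rightarrow> complex" and l :: "nat \<Rightarrow> complex"
  assumes "\<forall>i\<in>{1, 2, 3}. \<forall>u\<in>quotient_vertices. weighted_adj_op i f u = l i * f u"
  shows "sector_eigenfunction CARD('a) (of_nat CARD('a)) (\<lambda>a b c d. f (orbit (diag_vertex (coords a b c d)))) (l 1) (l 2) (l 3)"
proof
  fix a b c d k :: int
  have swap: "orbit (diag_vertex (coords a' b' c' d')) = (orbit (diag_vertex (coords a b c d)) :: 'a vertex set)"
    if "coords a b c d \<circ> Transposition.transpose i j = coords a' b' c' d'" for a b c d a' b' c' d' i j
    using orbit_diag_vertex_transpose[of "coords a b c d" i j] that by simp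
  have "coords a b c d \<circ> Transposition.transpose 4 1 = coords b a c d"
    "coords a b c d \<circ> Transposition.transpose 1 2 = coords a c b d"
    "coords a b c d \<circ> Transposition.transpose 2 3 = coords a b d c"
    by (intro coords_eqI; simp add: Transposition.transpose_def)+
  from this[THEN swap] show "f (orbit (diag_vertex (coords b a c d))) = f (orbit (diag_vertex (coords a b c d)))"
    "f (orbit (diag_vertex (coords a c b d))) = f (orbit (diag_vertex (coords a b c d)))"
    "f (orbit (diag_vertex (coords a b d c))) = f (orbit (diag_vertex (coords a b c d)))"
    by simp_all
  have "(\<lambda>i. coords a b c d i + k) = coords (a + k) (b + k) (c + k) (d + k)"
    by (intro coords_eqI) simp_all
  then show "f (orbit (diag_vertex (coords (a + k) (b + k) (c + k) (d + k)))) = f (orbit (diag_vertex (coords a b c d)))"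
    using diag_vertex_shift[of "coords a b c d" k, where 'a = 'a] by simp
  assume le: "b \<le> a" "c \<le> b" "d \<le> c"
  have coords_add: "(\<lambda>i. coords a b c d i + indic S i) = coords (a + indic S 4) (b + indic S 1) (c + indic S 2) (d + indic S 3)" for S
    by (intro coords_eqI) simp_all
  have hecke: "(\<Sum>S | card S = i. of_nat CARD('a) ^ inversions S *
      f (orbit (diag_vertex (coords (a + indic S 4) (b + indic S 1) (c + indic S 2) (d + indic S 3))))) = l i * f (orbit (diag_vertex (coords a b c d)))"
    if "i \<in> {1, 2, 3}" for i
    unfolding coords_add[symmetric] by (rule hecke_relation[OF coords_mono[OF le] that]) (use assms that in auto)
  show "f (orbit (diag_vertex (coords (a + 1) b c d))) + of_nat CARD('a) * f (orbit (diag_vertex (coords a (b + 1) c d))) +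
      of_nat CARD('a) ^ 2 * f (orbit (diag_vertex (coords a b (c + 1) d))) + of_nat CARD('a) ^ 3 * f (orbit (diag_vertex (coords a b c (d + 1)))) =
      l 1 * f (orbit (diag_vertex (coords a b c d)))"
    using hecke[of 1] unfolding sums_card_4 by (simp add: inversions_4 indic_def)
  show "f (orbit (diag_vertex (coords (a + 1) (b + 1) c d))) + of_nat CARD('a) * f (orbit (diag_vertex (coords (a + 1) b (c + 1) d))) +
      of_nat CARD('a) ^ 2 * f (orbit (diag_vertex (coords (a + 1) b c (d + 1)))) +
      of_nat CARD('a) ^ 2 * f (orbit (diag_vertex (coords a (b + 1) (c + 1) d))) +
      of_nat CARD('a) ^ 3 * f (orbit (diag_vertex (coords a (b + 1) c (d + 1)))) +
      of_nat CARD('a) ^ 4 * f (orbit (diag_vertex (coords a b (c + 1) (d + 1)))) = l 2 * f (orbit (diag_vertex (coords a b c d)))"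
    using hecke[of 2] unfolding sums_card_4 by (simp add: inversions_4 indic_def)
  show "f (orbit (diag_vertex (coords (a + 1) (b + 1) (c + 1) d))) + of_nat CARD('a) * f (orbit (diag_vertex (coords (a + 1) (b + 1) c (d + 1)))) +
      of_nat CARD('a) ^ 2 * f (orbit (diag_vertex (coords (a + 1) b (c + 1) (d + 1)))) +
      of_nat CARD('a) ^ 3 * f (orbit (diag_vertex (coords a (b + 1) (c + 1) (d + 1)))) = l 3 * f (orbit (diag_vertex (coords a b c d)))"
    using hecke[of 3] unfolding sums_card_4 by (simp add: inversions_4 indic_def)
qed (simp_all add: card_field_ge_2)

section \<open>Decay of square summable functions along rays\<close>

lemma summable_on_imp_tendsto_0:
  fixes h :: "'v \<Rightarrow> real"
  assumes "h summable_on V" "\<And>v. v \<in> V \<Longrightarrow> 0 \<le> h v" "inj u" "range u \<subseteq> V"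
  shows "(\<lambda>n :: nat. h (u n)) \<longlonglongrightarrow> 0"
proof -
  have "h summable_on range u"
    using assms(1,4) by (rule summable_on_subset_banach)
  then have "(h \<circ> u) summable_on UNIV"
    using assms(3) by (simp add: summable_on_reindex)
  then have "summable (h \<circ> u)"
    using assms(2,4) by (subst (asm) summable_on_UNIV_nonneg_real_iff) auto
  then show ?thesis
    using summable_LIMSEQ_zero by (force simp: comp_def)
qed

text \<open>Along distinct vertices |f|^2 w tends to 0, while w >= q^(-16 - e n). The constant 16
  collects the summand 1 of the degree count over the sixteen pairs (i, j), and \<open>e\<close>
  counts the pairs whose difference grows like n.\<close>

lemma ray_decay:
  fixes f :: "'a::{field,finite} vertex set \<Rightarrow> complex" and a :: "nat \<Rightarrow> 4 \<Rightarrow> int"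
  assumes f: "f \<in> weighted_L2 quotient_vertices vertex_weight"
    and inj: "inj (\<lambda>n. orbit (diag_vertex (a n) :: 'a vertex))"
    and e: "\<And>n. (\<Sum>i\<in>UNIV. \<Sum>j\<in>UNIV. nat (a n i - a n j + 1)) \<le> 16 + e * n"
    and r: "0 < r" "r^2 = 1 / real CARD('a) ^ e"
  shows "(\<lambda>n. f (orbit (diag_vertex (a n))) * of_real r ^ n) \<longlonglongrightarrow> 0"
proof -
  define N where "N = real CARD('a)"
  have N: "0 < N"
    by (simp add: N_def)
  define h where "h v = (cmod (f v))\<^sup>2 * vertex_weight v" for v
  have "(\<lambda>n. h (orbit (diag_vertex (a n)))) \<longlonglongrightarrow> 0"
  proof (rule summable_on_imp_tendsto_0[where V = quotient_vertices and u = "\<lambda>n. orbit (diag_vertex (a n))"])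
    show "h summable_on quotient_vertices"
      using f by (simp add: weighted_L2_def h_def[abs_def])
  qed (use inj in \<open>auto simp: h_def vertex_weight_def quotient_vertices_eq\<close>)
  then have "(\<lambda>n. N ^ 16 * h (orbit (diag_vertex (a n)))) \<longlonglongrightarrow> 0"
    by (rule tendsto_mult_right_zero)
  then have "(\<lambda>n. (norm (f (orbit (diag_vertex (a n))) * of_real r ^ n))\<^sup>2) \<longlonglongrightarrow> 0"
  proof (rule Lim_null_comparison[rotated], intro always_eventually allI)
    fix n
    have "1 / N ^ (16 + e * n) \<le> vertex_weight (orbit (diag_vertex (a n) :: 'a vertex))"
      using vertex_weight_diag_vertex_ge[OF e] by (simp add: N_def)
    then have "N ^ 16 * (1 / N ^ (16 + e * n)) \<le> N ^ 16 * vertex_weight (orbit (diag_vertex (a n) :: 'a vertex))"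
      using N by (intro mult_left_mono) auto
    moreover have "N ^ 16 * (1 / N ^ (16 + e * n)) = (r ^ n)\<^sup>2"
    proof -
      have "(r ^ n)\<^sup>2 = (r\<^sup>2) ^ n"
        by (simp add: mult.commute flip: power_mult)
      also have "\<dots> = 1 / N ^ (e * n)"
        by (simp add: r(2) N_def power_divide flip: power_mult)
      finally show ?thesis
        using N by (simp add: power_add)
    qed
    ultimately have "(cmod (f (orbit (diag_vertex (a n)))))\<^sup>2 * (r ^ n)\<^sup>2 \<le>
        (cmod (f (orbit (diag_vertex (a n)))))\<^sup>2 * (N ^ 16 * vertex_weight (orbit (diag_vertex (a n) :: 'a vertex)))"
      by (intro mult_left_mono) auto
    then show "norm ((norm (f (orbit (diag_vertex (a n))) * of_real r ^ n))\<^sup>2) \<le> N ^ 16 * h (orbit (diag_vertex (a n)))"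
      using r(1) by (simp add: h_def norm_mult norm_power power_mult_distrib mult_ac)
  qed
  then have "(\<lambda>n. sqrt ((norm (f (orbit (diag_vertex (a n))) * of_real r ^ n))\<^sup>2)) \<longlonglongrightarrow> sqrt 0"
    by (rule tendsto_real_sqrt)
  then show ?thesis
    by (simp add: tendsto_norm_zero_iff)
qed

text \<open>On each ray the coordinate at index 4 is maximal, and its excess over the mean grows
  strictly with n, so the orbit invariant determines n.\<close>

lemma inj_ray:
  assumes "a = (\<lambda>n. coords (int n) 0 0 0) \<or> a = (\<lambda>n. coords (int n) (int n) 0 0) \<or> a = (\<lambda>n. coords (int n) (int n) (int n) 0)"
  shows "inj (\<lambda>n. orbit (diag_vertex (a n) :: 'a::field vertex))"
proof (rule injI)
  have le: "m \<le> n" if eq: "orbit (diag_vertex (a m)) = (orbit (diag_vertex (a n)) :: 'a vertex set)" for m n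
  proof -
    obtain i where "4 * a m 4 \<le> 4 * a n i + (\<Sum>i\<in>UNIV. a m i) - (\<Sum>i\<in>UNIV. a n i)"
      using eq by (rule orbit_diag_vertex_eq_imp)
    then show ?thesis
      using assms exhaust_4[of i] by (auto simp: sum_4)
  qed
  fix m n
  assume "orbit (diag_vertex (a m)) = (orbit (diag_vertex (a n)) :: 'a vertex set)"
  then show "m = n"
    using le[of m n] le[of n m] by simp
qed

section \<open>The trivial triples in closed form\<close>

lemma fourth_root_of_unity:
  fixes c :: complex
  assumes "c ^ 4 = 1"
  obtains k :: nat where "k \<in> {0, 1, 2, 3}" "c = exp (of_nat k * of_real pi * \<i> / 2)"
proof -
  define E where "E = exp (of_real pi * \<i> / 2)"
  have E: "E = \<i>"
    using cis_pi_half by (simp add: E_def cis_conv_exp mult.commute)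
  have exp: "exp (of_nat k * of_real pi * \<i> / 2) = \<i> ^ k" for k
  proof -
    have "exp (of_nat k * of_real pi * \<i> / 2) = exp (of_nat k * (of_real pi * \<i> / 2))"
      by (simp add: mult.assoc)
    also have "\<dots> = E ^ k"
      unfolding E_def by (rule exp_of_nat_mult)
    finally show ?thesis
      by (simp only: E)
  qed
  have "(c - 1) * (c + 1) * (c - \<i>) * (c + \<i>) = 0"
    using assms by (simp add: algebra_simps power4_eq_xxxx)
  then have "c = 1 \<or> c = - 1 \<or> c = \<i> \<or> c = - \<i>"
    by (auto simp: add_eq_0_iff2)
  then have "c = \<i> ^ 0 \<or> c = \<i> ^ 1 \<or> c = \<i> ^ 2 \<or> c = \<i> ^ 3"
    by (auto simp: power3_eq_cube)
  then show thesis
    using that[of 0] that[of 1] that[of 2] that[of 3] unfolding exp by auto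
qed

lemma elem_sym_eq:
  "elem_sym 1 z = z 1 + z 2 + z 3 + z 4"
  "elem_sym 2 z = z 1 * z 2 + z 1 * z 3 + z 1 * z 4 + z 2 * z 3 + z 2 * z 4 + z 3 * z 4"
  "elem_sym 3 z = z 1 * z 2 * z 3 + z 1 * z 2 * z 4 + z 1 * z 3 * z 4 + z 2 * z 3 * z 4"
proof -
  have "{1..4} = {1, 2, 3, 4 :: nat}"
    by auto
  then have "{S. S \<subseteq> {1..4} \<and> card S = k} = {S \<in> Pow {1, 2, 3, 4 :: nat}. card S = k}" for k
    by auto
  then have "elem_sym k z = (\<Sum>S\<in>Pow {1, 2, 3, 4 :: nat}. if card S = k then \<Prod>j\<in>S. z j else 0)" for k
    unfolding elem_sym_def by (simp only: sum.inter_filter finite_Pow_iff finite.intros)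
  then show "elem_sym 1 z = z 1 + z 2 + z 3 + z 4"
    "elem_sym 2 z = z 1 * z 2 + z 1 * z 3 + z 1 * z 4 + z 2 * z 3 + z 2 * z 4 + z 3 * z 4"
    "elem_sym 3 z = z 1 * z 2 * z 3 + z 1 * z 2 * z 4 + z 1 * z 3 * z 4 + z 2 * z 3 * z 4"
    by (simp_all add: sum_Pow_insert algebra_simps)
qed

lemma trivial_triple_eq:
  fixes N :: nat
  assumes "0 < N" "c = exp (of_nat k * of_real pi * \<i> / 2)"
  defines "q \<equiv> of_nat N :: complex"
  shows "spectral_triple N (trivial_parameter N k) =
    (c * (1 + q + q^2 + q^3), c^2 * (1 + q + 2 * q^2 + q^3 + q^4), c^3 * (1 + q + q^2 + q^3))"
proof -
  define h where "h = real N powr (1 / 2)"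
  have h0: "0 < h"
    using assms(1) by (simp add: h_def)
  have hh: "h * h = real N"
    using assms(1) by (simp add: h_def flip: powr_add)
  have pow: "real N powr (real m / 2) = h ^ m" for m
    using assms(1) by (simp add: h_def powr_power)
  have neg: "real N powr (- (real m / 2)) = 1 / h ^ m" for m
    by (simp add: powr_minus_divide pow)
  \<comment> \<open>With a square root \<open>G\<close> of q all half-integral powers become
    integral powers of \<open>G\<close>, and the claim is an identity of rational functions.\<close>
  define G :: complex where "G = of_real h"
  have G: "G \<noteq> 0" "q = G * G"
    using h0 by (simp_all add: G_def q_def hh flip: of_real_mult)
  have p: "trivial_parameter N k 1 = c * G^3" "trivial_parameter N k 2 = c * G"
    "trivial_parameter N k 3 = c * (1 / G)" "trivial_parameter N k 4 = c * (1 / G^3)"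
    using pow[of 3] pow[of 1] neg[of 1] neg[of 3] by (simp_all add: trivial_parameter_def assms(2) G_def)
  have "complex_of_real (real N powr (3 / 2)) = G^3"
    using pow[of 3] by (simp add: G_def)
  moreover have "complex_of_real (real N) ^ 2 = (G * G)^2"
    by (simp add: G(2)[symmetric] q_def)
  ultimately show ?thesis
    unfolding spectral_triple_def elem_sym_eq p G(2) using G(1)
    by (auto simp: field_simps eval_nat_numeral)
qed

theorem theorem1p1:
  fixes l1 l2 l3 :: complex
  assumes "(l1, l2, l3) \<in> discrete_spectrum TYPE('a::{field,finite})"
    and "(l1, l2, l3) \<notin> trivial_triples CARD('a)"
  shows "(l1, l2, l3) \<in> building_spectrum TYPE('a)"
proof -
  obtain l :: "nat \<Rightarrow> complex" and f :: "'a vertex set \<Rightarrow> complex" where l: "l1 = l 1" "l2 = l 2" "l3 = l 3"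
    and f: "f \<in> weighted_L2 quotient_vertices vertex_weight" "\<exists>v\<in>quotient_vertices. f v \<noteq> 0"
      "\<forall>i\<in>{1, 2, 3}. \<forall>u\<in>quotient_vertices. weighted_adj_op i f u = l i * f u"
    using assms(1) unfolding discrete_spectrum_def by blast
  interpret sector_eigenfunction "CARD('a)" "of_nat CARD('a)" "\<lambda>a b c d. f (orbit (diag_vertex (coords a b c d)))" "l 1" "l 2" "l 3"
    using f(3) by (rule sector_eigenfunction_of_eigenfunction)
  define N where "N = CARD('a)"
  define r where "r = 1 / real N powr (3 / 2)"
  have N: "0 < N"
    by (simp add: N_def)
  have r: "0 < r" "r^2 = 1 / real N ^ 3"
  proof -
    have "(real N powr (3 / 2))^2 = real N powr 3"
      using N by (simp add: powr_power)
    also have "\<dots> = real N ^ 3"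
      using N powr_realpow[of "real N" 3] by simp
    finally show "0 < r" "r^2 = 1 / real N ^ 3"
      using N by (simp_all add: r_def power_divide)
  qed
  \<comment> \<open>If f vanished at the origin, it would vanish at all diagonal vertices, which by
    reduction theory represent every orbit.\<close>
  have nz: "f (orbit (diag_vertex (coords 0 0 0 0))) \<noteq> 0"
  proof
    assume zero: "f (orbit (diag_vertex (coords 0 0 0 0))) = 0"
    obtain x where x: "x \<in> vertices" "f (orbit x) \<noteq> 0"
      using f(2) by (auto simp: quotient_vertices_eq)
    obtain a where "orbit x = orbit (diag_vertex a)"
      using x(1) by (rule orbit_eq_orbit_diag_vertex)
    moreover have "a = coords (a 4) (a 1) (a 2) (a 3)"
      by (intro coords_eqI) simp_all
    ultimately show False
      using x(2) vanishes_if_0[OF zero, of "a 4" "a 1" "a 2" "a 3"] by metis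
  qed
  have "(\<lambda>n. f (orbit (diag_vertex (coords (int n) 0 0 0))) * of_real r ^ n) \<longlonglongrightarrow> 0"
    by (rule ray_decay[OF f(1) inj_ray]) (use r in \<open>auto simp: sum_4 N_def\<close>)
  moreover have "(\<lambda>n. f (orbit (diag_vertex (coords (int n) (int n) (int n) 0))) * of_real r ^ n) \<longlonglongrightarrow> 0"
    by (rule ray_decay[OF f(1) inj_ray]) (use r in \<open>auto simp: sum_4 N_def\<close>)
  \<comment> \<open>On this ray 2 times 2 pairs of coordinates differ by n, hence the exponent 4; on
    the other two rays there are 1 times 3 such pairs.\<close>
  moreover have "(\<lambda>n. f (orbit (diag_vertex (coords (int n) (int n) 0 0))) * of_real (1 / real N ^ 2) ^ n) \<longlonglongrightarrow> 0"
    by (rule ray_decay[OF f(1) inj_ray, where e = 4]) (use N in \<open>auto simp: sum_4 N_def power_divide simp flip: power_mult\<close>)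
  ultimately obtain c where c: "c^4 = 1" "l 1 = c * (1 + of_nat N + of_nat N^2 + of_nat N^3)"
    "l 2 = c^2 * (1 + of_nat N + 2 * of_nat N^2 + of_nat N^3 + of_nat N^4)"
    "l 3 = c^3 * (1 + of_nat N + of_nat N^2 + of_nat N^3)"
    using trivial_of_decay[OF nz] by (auto simp: N_def r_def)
  obtain k :: nat where k: "k \<in> {0, 1, 2, 3}" "c = exp (of_nat k * of_real pi * \<i> / 2)"
    using c(1) by (rule fourth_root_of_unity)
  have "(l1, l2, l3) = spectral_triple N (trivial_parameter N k)"
    unfolding trivial_triple_eq[OF N k(2)] l c ..
  then have "(l1, l2, l3) \<in> trivial_triples CARD('a)"
    using k(1) unfolding trivial_triples_def N_def by blast
  with assms(2) show ?thesis
    by contradiction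
qed

end
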